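(* Let $d\ge3$. There is no median filter scheme of the form $$\phi^{n+1}(x)=\mathbf{M}_{K_{\sqrt{2k}}}\phi^n(x),$$ with $K$ a positive (i.e. $K\ge0$), radially symmetric kernel on $\mathbb{R}^d$ with rapid decay and unit mass, that is second order consistent in time with the level set equation of motion by mean curvature $$\phi_t=|\nabla\phi|\,\nabla\cdot\Big(\frac{\nabla\phi}{|\nabla\phi|}\Big).$$
   Context: For $r>0$, $K_r(x)=r^{-d}K(x/r)$. The kernel $K$ is a nonnegative radially symmetric function with $\int K=1$, decaying at infinity faster than any power of $|x|$; one also allows $K$ to be a finite positive combination of surface measures on spheres (of positive radius) centered at $0$, of total mass $1$. For bounded continuous $\phi:\mathbb{R}^d\to\mathbb{R}$ and $\lambda\in\mathbb{R}$, let $\mathbf{T}_\lambda\phi=\{x:\phi(x)\ge\lambda\}$ and $\psi_K\phi(x,\lambda)=\int_{\mathbf{T}_\lambda\phi}K(x-y)\,dy$. The weighted median is $$\mathbf{M}_K\phi(x)=\sup\{\lambda\in\mathbb{R}:\psi_K\phi(x,\lambda)\ge\tfrac12\}.$$ Second order consistency in time. Write $F(\phi)=|\nabla\phi|\,\nabla\cdot\big(\frac{\nabla\phi}{|\nabla\phi|}\big)$. A scheme $\phi^{n+1}=\mathcal{F}_k\phi^n$ is second order consistent in time if for every bounded smooth function $\phi$ and every point $x$ with $\nabla\phi(x)\ne0$, $$\mathcal{F}_k\phi(x)=\phi(x)+k\,F(\phi)(x)+\frac{k^2}{2}\,\frac{d}{ds}\Big|_{s=0}F\big(\phi+sF(\phi)\big)(x)+O(k^3)\quad\text{as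 }k\to0^+,$$ i.e. one step agrees with the second order Taylor expansion in time of the solution of $\phi_t=F(\phi)$ starting from $\phi$; equivalently, the displacement of the level surface through $x$ along its normal in one step agrees with that of mean curvature motion for time $k$ up to $O(k^3)$. *)

theory Defs
  imports "HOL-Analysis.Analysis" "HOL-Library.Landau_Symbols"
begin

section \<open>Kernels\<close>

definition rapidly_decaying :: "('a::real_normed_vector \<Rightarrow> real) \<Rightarrow> bool" where
  "rapidly_decaying K \<longleftrightarrow> (\<forall>m::nat. ((\<lambda>x. norm x ^ m * K x) \<longlongrightarrow> 0) at_infinity)"

definition function_kernel :: "('a::euclidean_space \<Rightarrow> real) \<Rightarrow> bool" where
  "function_kernel K \<longleftrightarrow>
     K \<in> borel_measurable borel \<and>
     (\<forall>x. 0 \<le> K x) \<and>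
     (\<forall>x y. norm x = norm y \<longrightarrow> K x = K y) \<and>
     rapidly_decaying K \<and>
     has_bochner_integral lborel K 1"

text \<open>Surface measure on the sphere of radius \<open>r\<close> about the origin. On the unit sphere it is
  \<open>d\<close> times the volume of the cone \<open>{t *\<^sub>R u | 0 < t < 1, u \<in> A}\<close>, as in integration
  in polar coordinates.\<close>

definition surface_measure :: "real \<Rightarrow> 'a::euclidean_space measure" where
  "surface_measure r =
     scale_measure (ennreal (real DIM('a) * r ^ (DIM('a) - 1)))
       (distr (density lborel (indicator (ball 0 1))) borel (\<lambda>x. r *\<^sub>R sgn x))"

definition spherical_kernel :: "'a::euclidean_space measure \<Rightarrow> bool" where
  "spherical_kernel M \<longleftrightarrow>
     sets M = sets borel \<and> emeasure M UNIV = 1 \<and>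
     (\<exists>R c. finite R \<and> (\<forall>r\<in>R. 0 < r \<and> 0 < c r) \<and>
        (\<forall>A\<in>sets borel. emeasure M A = (\<Sum>r\<in>R. ennreal (c r) * emeasure (surface_measure r) A)))"

text \<open>As surface measures are admitted, a kernel is represented by the measure \<open>K(y) dy\<close>.\<close>

definition median_kernel :: "'a::euclidean_space measure \<Rightarrow> bool" where
  "median_kernel M \<longleftrightarrow>
     (\<exists>K. function_kernel K \<and> M = density lborel (\<lambda>x. ennreal (K x))) \<or> spherical_kernel M"

text \<open>The dilation \<open>K\<^sub>r\<close>; for densities see \<open>dilate_density\<close> below.\<close>

definition dilate :: "real \<Rightarrow> 'a::euclidean_space measure \<Rightarrow> 'a measure" where
  "dilate r M = distr M borel (\<lambda>x. r *\<^sub>R x)"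

section \<open>Median filters\<close>

definition superlevel :: "('a \<Rightarrow> real) \<Rightarrow> real \<Rightarrow> 'a set" where
  "superlevel \<phi> l = {x. l \<le> \<phi> x}"

text \<open>The convolution of the kernel with the indicator function of the superlevel set; for
  densities see \<open>level_mass_density\<close> below.\<close>

definition level_mass ::
    "'a::euclidean_space measure \<Rightarrow> ('a \<Rightarrow> real) \<Rightarrow> 'a \<Rightarrow> real \<Rightarrow> real" where
  "level_mass M \<phi> x l = measure M {z. x - z \<in> superlevel \<phi> l}"

definition weighted_median ::
    "'a::euclidean_space measure \<Rightarrow> ('a \<Rightarrow> real) \<Rightarrow> 'a \<Rightarrow> real" where
  "weighted_median M \<phi> x = Sup {l. 1/2 \<le> level_mass M \<phi> x l}"

section \<open>Mean curvature motion and consistency\<close>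

primrec C_k :: "nat \<Rightarrow> ('a::euclidean_space \<Rightarrow> real) \<Rightarrow> bool" where
  "C_k 0 f \<longleftrightarrow> continuous_on UNIV f"
| "C_k (Suc n) f \<longleftrightarrow>
     (\<forall>x. f differentiable at x) \<and> (\<forall>b\<in>Basis. C_k n (\<lambda>x. frechet_derivative f (at x) b))"

definition smooth :: "('a::euclidean_space \<Rightarrow> real) \<Rightarrow> bool" where
  "smooth f \<longleftrightarrow> (\<forall>n. C_k n f)"

definition grad :: "('a::euclidean_space \<Rightarrow> real) \<Rightarrow> 'a \<Rightarrow> 'a" where
  "grad f x = (THE D. GDERIV f x :> D)"

definition divergence :: "('a::euclidean_space \<Rightarrow> 'a) \<Rightarrow> 'a \<Rightarrow> real" where
  "divergence V x = (\<Sum>b\<in>Basis. frechet_derivative V (at x) b \<bullet> b)"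

definition mc_operator :: "('a::euclidean_space \<Rightarrow> real) \<Rightarrow> 'a \<Rightarrow> real" where
  "mc_operator \<phi> x =
     norm (grad \<phi> x) * divergence (\<lambda>y. grad \<phi> y /\<^sub>R norm (grad \<phi> y)) x"

definition second_order_consistent ::
    "(real \<Rightarrow> ('a::euclidean_space \<Rightarrow> real) \<Rightarrow> 'a \<Rightarrow> real) \<Rightarrow> bool" where
  "second_order_consistent S \<longleftrightarrow>
     (\<forall>\<phi> x. smooth \<phi> \<and> bounded (range \<phi>) \<and> grad \<phi> x \<noteq> 0 \<longrightarrow>
        (\<lambda>k. S k \<phi> x -
             (\<phi> x + k * mc_operator \<phi> x +
              k\<^sup>2 / 2 * deriv (\<lambda>s. mc_operator (\<lambda>y. \<phi> y + s * mc_operator \<phi> y) x) 0))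
          \<in> O[at_right 0](\<lambda>k. k ^ 3))"

section \<open>Agreement with the formulas for densities\<close>

lemma dilate_density:
  fixes K :: "'a::euclidean_space \<Rightarrow> real"
  assumes r: "0 < r" and [measurable]: "K \<in> borel_measurable borel" and nonneg: "\<And>x. 0 \<le> K x"
  shows "dilate r (density lborel (\<lambda>x. ennreal (K x))) =
         density lborel (\<lambda>x. ennreal (K (x /\<^sub>R r) / r ^ DIM('a)))"
proof (rule measure_eqI)
  fix A assume "A \<in> sets (dilate r (density lborel (\<lambda>x. ennreal (K x))))"
  then have A[measurable]: "A \<in> sets borel" by (simp add: dilate_def)
  have "emeasure (dilate r (density lborel (\<lambda>x. ennreal (K x)))) A
      = (\<integral>\<^sup>+x. ennreal (K x) * indicator A (r *\<^sub>R x) \<partial>lborel)"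
  proof -
    have "(\<lambda>x. r *\<^sub>R x) -` A \<in> sets borel"
      using measurable_sets[of "\<lambda>x. r *\<^sub>R x" borel borel A] by simp
    then show ?thesis
      unfolding dilate_def
      by (subst emeasure_distr) (auto simp: emeasure_density indicator_def intro!: nn_integral_cong)
  qed
  also have "\<dots> = (\<integral>\<^sup>+x. ennreal (K (x /\<^sub>R r) / r ^ DIM('a)) * indicator A x \<partial>lborel)"
    using r nonneg
    by (subst (2) lborel_affine[of r 0])
       (auto simp: nn_integral_density nn_integral_distr ennreal_mult[symmetric] mult.assoc[symmetric]
             intro!: nn_integral_cong)
  also have "\<dots> = emeasure (density lborel (\<lambda>x. ennreal (K (x /\<^sub>R r) / r ^ DIM('a)))) A"
    by (simp add: emeasure_density)
  finally show "emeasure (dilate r (density lborel (\<lambda>x. ennreal (K x)))) A = \<dots>" .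
qed (simp add: dilate_def)

lemma level_mass_density:
  fixes K :: "'a::euclidean_space \<Rightarrow> real"
  assumes [measurable]: "K \<in> borel_measurable borel" and nonneg: "\<And>x. 0 \<le> K x"
    and "continuous_on UNIV \<phi>"
  shows "level_mass (density lborel (\<lambda>x. ennreal (K x))) \<phi> x l =
         (LINT y:superlevel \<phi> l|lborel. K (x - y))"
proof -
  have [measurable]: "\<phi> \<in> borel_measurable borel"
    using assms(3) by (rule borel_measurable_continuous_onI)
  have T[measurable]: "superlevel \<phi> l \<in> sets borel"
    unfolding superlevel_def by measurable
  have [measurable]: "{z. x - z \<in> superlevel \<phi> l} \<in> sets borel"
    unfolding superlevel_def by measurable
  have "emeasure (density lborel (\<lambda>x. ennreal (K x))) {z. x - z \<in> superlevel \<phi> l}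
      = (\<integral>\<^sup>+z. ennreal (K z) * indicator (superlevel \<phi> l) (x - z) \<partial>lborel)"
    by (auto simp: emeasure_density indicator_def intro!: nn_integral_cong)
  also have "\<dots> = (\<integral>\<^sup>+y. ennreal (K (x - y)) * indicator (superlevel \<phi> l) y \<partial>lborel)"
    by (subst lborel_affine[of "-1" x]) (auto simp: nn_integral_density nn_integral_distr)
  also have "\<dots> = (\<integral>\<^sup>+y. ennreal (indicator (superlevel \<phi> l) y * K (x - y)) \<partial>lborel)"
    by (auto simp: indicator_def intro!: nn_integral_cong)
  finally show ?thesis
    unfolding level_mass_def set_lebesgue_integral_def
    by (subst integral_eq_nn_integral) (auto simp: nonneg measure_def)
qed

lemma emeasure_surface_measure_UNIV:
  assumes "0 < r"
  shows "emeasure (surface_measure r :: 'a::euclidean_space measure) UNIV =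
         ennreal (real DIM('a) * r ^ (DIM('a) - 1) * unit_ball_vol (real DIM('a)))"
proof -
  have "indicator (ball 0 1) \<in> (borel_measurable lborel :: ('a \<Rightarrow> ennreal) set)"
    by (simp add: borel_measurable_indicator)
  then have "emeasure (density lborel (indicator (ball 0 1))) (UNIV :: 'a set) =
      ennreal (unit_ball_vol (real DIM('a)))"
    using emeasure_ball[of 1 "0::'a"] by (simp add: emeasure_density)
  then show ?thesis
    using assms by (simp add: surface_measure_def emeasure_distr ennreal_mult)
qed

end

theory Submission
  imports Defs
begin

text \<open>
  The scheme is tested on \<open>\<phi> = cos y / cosh t\<close>, a function of two of three chosen coordinates, whose
  level sets are Angenent ovals: mean curvature motion multiplies \<open>\<phi>\<close> by \<open>exp (-\<tau>)\<close>, so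
  consistency predicts the value \<open>(1 - k + k\<^sup>2/2) / sqrt 2\<close> at the point with \<open>y = 0\<close>, \<open>sinh t = 1\<close>.

  Projected to the three coordinates, a radial kernel is a mixture over radii \<open>\<rho>\<close> of uniform measures
  on spheres. By Archimedes, the height on a sphere is uniformly distributed at every fixed azimuth, so
  the mass of a superlevel set at scale \<open>r = sqrt (2 k)\<close> is read off from the height at which the level
  set meets the meridian. Averaging over the azimuth gives, for the level \<open>1 / (sqrt 2 * (1 + N))\<close> and
  up to higher order,
  \<open>1/2 - (- (N - N\<^sup>2/2) * E (1/\<rho>) + (r\<^sup>2/4 + N * r\<^sup>2/8) * E \<rho>) / (sqrt 2 * r)\<close>.
  The point is chosen so that the terms with \<open>E (\<rho>\<^sup>3)\<close> cancel. First order consistency forces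
  \<open>E (1/\<rho>) \<le> E \<rho> / 2\<close>, and then the mass at the predicted level is below \<open>1/2\<close> by an amount of
  order \<open>r\<^sup>3\<close>, so the median falls short by order \<open>k\<^sup>2\<close>. Near the origin (small \<open>\<rho>\<close>) the
  expansion fails, but it errs in the favourable direction, since a mass is at most 1.
\<close>

text \<open>The obstacle is that nothing is known beforehand about \<open>E (1/\<rho>)\<close>: a
  density may blow up at the origin, so this mean might be infinite. Hence one-sided bounds valid
  for every radius are proved. The lower bound on the mass is used with the \<open>1/\<rho>\<close>
  term cut off below a radius \<delta>; monotone convergence then gives integrability together with
  the inequality, and only after that is the finer upper bound integrated.

  Origin of the point: let c be \<open>tanh\<close> of its t-coordinate and g the squared sine of
  the azimuth. The fourth-order term in \<rho> of the height equation has coefficient (1 - g) g^2 /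
  (8 c^2) - g^2 / 24. For a uniform azimuth g^2 and g^3 have means 3/8 and 5/16, so it averages to
  zero exactly if c^2 = 1/2, that is, if sinh t = 1. (Mass is height divided by \<rho>, whence
  \<open>E (\<rho>^3)\<close>.)

  The test function ignores the first axis, but this axis makes the projected spheres
  two-dimensional, so that heights are uniform. As the function is even in y, only the squared sine
  of the azimuth enters, which is why the cosine of the double angle suffices as angular
  coordinate.\<close>

section \<open>Spherical coordinates\<close>

text \<open>\<open>cos2 x y\<close> is the cosine of twice the polar angle of \<open>(x, y)\<close>, with value 0 at the origin.\<close>

definition cos2 :: "real \<Rightarrow> real \<Rightarrow> real" where
  "cos2 x y = (x\<^sup>2 - y\<^sup>2) / (x\<^sup>2 + y\<^sup>2)"

lemma cos2_measurable [measurable]: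
  assumes [measurable]: "f \<in> borel_measurable M" "g \<in> borel_measurable M"
  shows "(\<lambda>x. cos2 (f x) (g x)) \<in> borel_measurable M"
  unfolding cos2_def by measurable

lemma cos2_scale: "c \<noteq> 0 \<Longrightarrow> cos2 (c * x) (c * y) = cos2 x y"
  by (simp add: cos2_def power_mult_distrib flip: distrib_left right_diff_distrib)

lemma abs_cos2_le: "\<bar>cos2 x y\<bar> \<le> 1"
  by (auto simp: cos2_def abs_le_iff divide_le_eq le_divide_eq)

text \<open>Angles are measured by areas of sectors of the unit disc, so neither an angle function
  nor the value of the total area is needed; \<open>angle_mass UNIV\<close> later
  normalises.\<close>

definition angle_mass :: "real set \<Rightarrow> ennreal" where
  "angle_mass B = (\<integral>\<^sup>+x. \<integral>\<^sup>+y. indicator B (cos2 x y) * indicator {..<1} (x\<^sup>2 + y\<^sup>2) \<partial>lborel \<partial>lborel)"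

text \<open>Dilation by \<open>sqrt Q\<close> leaves \<open>cos2\<close> unchanged and multiplies
  areas by \<open>Q\<close>. For \<open>Q \<le> 0\<close> the disc is empty, in agreement with
  \<open>ennreal Q = 0\<close>.\<close>

lemma disc_mass_scale:
  assumes [measurable]: "B \<in> sets borel"
  shows "(\<integral>\<^sup>+x. \<integral>\<^sup>+y. indicator B (cos2 x y) * indicator {..<Q} (x\<^sup>2 + y\<^sup>2) \<partial>lborel \<partial>lborel)
         = ennreal Q * angle_mass B"
proof (cases "Q > 0")
  case False
  have "indicator {..<Q} (x\<^sup>2 + y\<^sup>2) = (0::ennreal)" for x y :: real
    using False order_trans[OF _ sum_power2_ge_zero, of Q x y] by (auto simp: indicator_def not_less)
  then show ?thesis using False by (simp add: ennreal_neg)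
next
  case True
  define c where "c = sqrt Q"
  have c: "c > 0" "c * c = Q" using True by (auto simp: c_def)
  have i: "indicator {..<Q} ((c*x)\<^sup>2 + (c*y)\<^sup>2) = (indicator {..<1} (x\<^sup>2 + y\<^sup>2) :: ennreal)" for x y
  proof -
    have "(c*x)\<^sup>2 + (c*y)\<^sup>2 = Q * (x\<^sup>2 + y\<^sup>2)" using c by (simp add: power2_eq_square algebra_simps flip: c(2))
    then show ?thesis using True by (auto simp: indicator_def)
  qed
  have "(\<integral>\<^sup>+x. \<integral>\<^sup>+y. indicator B (cos2 x y) * indicator {..<Q} (x\<^sup>2 + y\<^sup>2) \<partial>lborel \<partial>lborel)
     = ennreal c * (\<integral>\<^sup>+x. \<integral>\<^sup>+y. indicator B (cos2 (c*x) y) * indicator {..<Q} ((c*x)\<^sup>2 + y\<^sup>2) \<partial>lborel \<partial>lborel)"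
    using c by (subst nn_integral_real_affine[where c=c and t=0]) auto
  also have "\<dots> = ennreal c * (\<integral>\<^sup>+x. ennreal c * (\<integral>\<^sup>+y. indicator B (cos2 (c*x) (c*y)) * indicator {..<Q} ((c*x)\<^sup>2 + (c*y)\<^sup>2) \<partial>lborel) \<partial>lborel)"
  proof -
    have "(\<integral>\<^sup>+y. indicator B (cos2 (c*x) y) * indicator {..<Q} ((c*x)\<^sup>2 + y\<^sup>2) \<partial>lborel)
      = ennreal c * (\<integral>\<^sup>+y. indicator B (cos2 (c*x) (c*y)) * indicator {..<Q} ((c*x)\<^sup>2 + (c*y)\<^sup>2) \<partial>lborel)" for x
      using c by (subst nn_integral_real_affine[where c=c and t=0]) auto
    then show ?thesis by simp
  qed
  also have "\<dots> = ennreal c * (ennreal c * angle_mass B)"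
    using c by (simp add: i cos2_scale nn_integral_cmult angle_mass_def)
  finally show ?thesis using c by (simp add: mult.assoc[symmetric] ennreal_mult[symmetric])
qed

lemma angle_mass_finite:
  "angle_mass B < \<infinity>"
proof -
  have "angle_mass B \<le> (\<integral>\<^sup>+x. \<integral>\<^sup>+y. indicator {-1..1} x * indicator {-1..1} (y::real) \<partial>lborel \<partial>(lborel::real measure))"
    unfolding angle_mass_def
  proof (intro nn_integral_mono)
    fix x y :: real
    have "\<bar>x\<bar> \<le> 1 \<and> \<bar>y\<bar> \<le> 1" if "x\<^sup>2 + y\<^sup>2 < 1"
    proof -
      have "x\<^sup>2 \<le> 1" "y\<^sup>2 \<le> 1" using that zero_le_power2[of x] zero_le_power2[of y] by linarith+
      then show ?thesis by (simp add: abs_square_le_1)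
    qed
    then show "indicator B (cos2 x y) * indicator {..<1} (x\<^sup>2 + y\<^sup>2) \<le> (indicator {-1..1} x * indicator {-1..1} y :: ennreal)"
      by (auto simp: indicator_def abs_le_iff)
  qed
  also have "\<dots> < \<infinity>" by (simp add: nn_integral_cmult nn_integral_multc ennreal_mult_less_top)
  finally show ?thesis .
qed

text \<open>By \<open>disc_mass_scale\<close> the squared radius has constant density on the
  positive half-line within every sector. The two image measures are compared on half-lines, and the
  equality passes to all integrands \<open>f\<close>.\<close>

lemma plane_polar:
  assumes [measurable]: "B \<in> sets borel" "f \<in> borel_measurable borel"
  shows "(\<integral>\<^sup>+x. \<integral>\<^sup>+y. f (x\<^sup>2 + y\<^sup>2) * indicator B (cos2 x y) \<partial>lborel \<partial>lborel)
         = angle_mass B * (\<integral>\<^sup>+q. f q * indicator {0<..} q \<partial>lborel)"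
proof -
  let ?L = "lborel \<Otimes>\<^sub>M lborel :: (real \<times> real) measure"
  \<comment> \<open>The squared radius is negated because the comparison uses half-lines
    \<open>{t<..}\<close> of finite mass; after negation these correspond to bounded discs.\<close>
  define M1 where "M1 = distr (density ?L (\<lambda>(x,y). indicator B (cos2 x y))) borel (\<lambda>(x,y). - (x\<^sup>2 + y\<^sup>2))"
  define M2 where "M2 = distr (density lborel (\<lambda>q. angle_mass B * indicator {0<..} q)) borel (uminus :: real \<Rightarrow> real)"
  have "M1 = M2"
  proof (rule measure_eqI_lessThan)
    fix t :: real
    have a: "emeasure M1 {t<..} = ennreal (-t) * angle_mass B"
    proof -
      have "emeasure M1 {t<..} = (\<integral>\<^sup>+q. indicator {t<..} q \<partial>M1)"
        by (simp add: M1_def)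
      also have "\<dots> = (\<integral>\<^sup>+p. (case p of (x, y) \<Rightarrow> indicator {t<..} (-(x\<^sup>2+y\<^sup>2)) * indicator B (cos2 x y)) \<partial>?L)"
        unfolding M1_def
        by (simp add: nn_integral_distr nn_integral_density split_beta' mult.commute del: nn_integral_indicator)
      also have "\<dots> = (\<integral>\<^sup>+x. \<integral>\<^sup>+y. indicator {t<..} (-(x\<^sup>2+y\<^sup>2)) * indicator B (cos2 x y) \<partial>lborel \<partial>lborel)"
        by (subst lborel.nn_integral_fst[symmetric]) auto
      also have "\<dots> = (\<integral>\<^sup>+x. \<integral>\<^sup>+y. indicator B (cos2 x y) * indicator {..<-t} (x\<^sup>2 + y\<^sup>2) \<partial>lborel \<partial>lborel)"
        by (intro nn_integral_cong) (auto split: split_indicator)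
      finally show ?thesis by (simp add: disc_mass_scale)
    qed
    have b: "emeasure M2 {t<..} = ennreal (-t) * angle_mass B"
    proof -
      have "emeasure M2 {t<..} = (\<integral>\<^sup>+q. angle_mass B * indicator {0<..<-t} q \<partial>lborel)"
      proof -
        have "uminus -` {t<..} = {..<-t}" by auto
        then show ?thesis
          unfolding M2_def
          by (subst emeasure_distr) (auto simp: emeasure_density intro!: nn_integral_cong split: split_indicator)
      qed
      also have "\<dots> = angle_mass B * ennreal (-t)"
        by (cases "0 \<le> -t") (auto simp: nn_integral_cmult_indicator ennreal_neg)
      finally show ?thesis by (simp add: mult.commute)
    qed
    show "emeasure M1 {t<..} = emeasure M2 {t<..}" using a b by simp
    show "emeasure M1 {t<..} < \<infinity>" using a angle_mass_finite[of B] by (simp add: ennreal_mult_less_top)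
  qed (auto simp: M1_def M2_def)
  then have "(\<integral>\<^sup>+q. f (-q) \<partial>M1) = (\<integral>\<^sup>+q. f (-q) \<partial>M2)" by simp
  moreover have "(\<integral>\<^sup>+q. f (-q) \<partial>M1) = (\<integral>\<^sup>+x. \<integral>\<^sup>+y. f (x\<^sup>2 + y\<^sup>2) * indicator B (cos2 x y) \<partial>lborel \<partial>lborel)"
    unfolding M1_def
    by (simp add: nn_integral_distr nn_integral_density split_beta' mult.commute)
       (subst lborel.nn_integral_fst[symmetric], auto simp: add.commute)
  moreover have "(\<integral>\<^sup>+q. f (-q) \<partial>M2) = angle_mass B * (\<integral>\<^sup>+q. f q * indicator {0<..} q \<partial>lborel)"
    unfolding M2_def
    by (simp add: nn_integral_distr nn_integral_density mult.assoc nn_integral_cmult)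
       (simp add: mult.commute)
  ultimately show ?thesis by simp
qed

text \<open>Archimedes: at fixed \<open>\<sigma> = x\<^sup>2 + y\<^sup>2 + t\<^sup>2\<close> and fixed azimuth the height \<open>t\<close> is uniformly
  distributed, because \<open>(q, t) \<mapsto> (q + t\<^sup>2, t)\<close> preserves area.\<close>

lemma space_archimedes:
  assumes [measurable]: "B \<in> sets borel" "D \<in> sets borel" "f \<in> borel_measurable borel"
  shows "(\<integral>\<^sup>+t. \<integral>\<^sup>+x. \<integral>\<^sup>+y. f (x\<^sup>2 + y\<^sup>2 + t\<^sup>2) * indicator D (t / sqrt (x\<^sup>2 + y\<^sup>2 + t\<^sup>2))
            * indicator B (cos2 x y) \<partial>lborel \<partial>lborel \<partial>lborel)
         = angle_mass B * emeasure lborel (D \<inter> {-1<..<1}) *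
           (\<integral>\<^sup>+s. f s * ennreal (sqrt s) * indicator {0<..} s \<partial>lborel)"
proof -
  have "(\<integral>\<^sup>+t. \<integral>\<^sup>+x. \<integral>\<^sup>+y. f (x\<^sup>2 + y\<^sup>2 + t\<^sup>2) * indicator D (t / sqrt (x\<^sup>2 + y\<^sup>2 + t\<^sup>2))
            * indicator B (cos2 x y) \<partial>lborel \<partial>lborel \<partial>lborel)
     = (\<integral>\<^sup>+t. angle_mass B * (\<integral>\<^sup>+q. (f (q + t\<^sup>2) * indicator D (t / sqrt (q + t\<^sup>2))) * indicator {0<..} q \<partial>lborel) \<partial>lborel)"
    by (intro nn_integral_cong plane_polar) auto
  also have "\<dots> = angle_mass B * (\<integral>\<^sup>+t. \<integral>\<^sup>+q. f (q + t\<^sup>2) * indicator D (t / sqrt (q + t\<^sup>2)) * indicator {0<..} q \<partial>lborel \<partial>lborel)"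
    by (rule nn_integral_cmult) measurable
  also have "(\<integral>\<^sup>+t. \<integral>\<^sup>+q. f (q + t\<^sup>2) * indicator D (t / sqrt (q + t\<^sup>2)) * indicator {0<..} q \<partial>lborel \<partial>lborel)
    = (\<integral>\<^sup>+t. \<integral>\<^sup>+s. f s * indicator D (t / sqrt s) * indicator {0<..} (s - t\<^sup>2) \<partial>lborel \<partial>lborel)"
  proof (rule nn_integral_cong)
    fix t :: real
    show "(\<integral>\<^sup>+q. f (q + t\<^sup>2) * indicator D (t / sqrt (q + t\<^sup>2)) * indicator {0<..} q \<partial>lborel)
      = (\<integral>\<^sup>+s. f s * indicator D (t / sqrt s) * indicator {0<..} (s - t\<^sup>2) \<partial>lborel)"
      using nn_integral_real_affine[of "\<lambda>s. f s * indicator D (t / sqrt s) * indicator {0<..} (s - t\<^sup>2)" 1 "t\<^sup>2"]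
      by (auto simp: add.commute intro!: nn_integral_cong split: split_indicator)
  qed
  also have "\<dots> = (\<integral>\<^sup>+s. \<integral>\<^sup>+t. f s * indicator D (t / sqrt s) * indicator {0<..} (s - t\<^sup>2) \<partial>lborel \<partial>lborel)"
    by (rule lborel_pair.Fubini') measurable
  also have "\<dots> = (\<integral>\<^sup>+s. emeasure lborel (D \<inter> {-1<..<1}) * (f s * ennreal (sqrt s) * indicator {0<..} s) \<partial>lborel)"
  proof (rule nn_integral_cong)
    fix s :: real
    show "(\<integral>\<^sup>+t. f s * indicator D (t / sqrt s) * indicator {0<..} (s - t\<^sup>2) \<partial>lborel)
      = emeasure lborel (D \<inter> {-1<..<1}) * (f s * ennreal (sqrt s) * indicator {0<..} s)"
    proof (cases "s > 0")
      case False
      then have "indicator {0<..} (s - t\<^sup>2) = (0::ennreal)" for t :: real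
        using order_trans[OF _ zero_le_power2, of s t] by (simp add: indicator_def not_less)
      then show ?thesis using False by simp
    next
      case True
      have e: "(sqrt s * v)\<^sup>2 < s \<longleftrightarrow> v \<in> {-1<..<1}" for v
        using True by (simp add: power_mult_distrib abs_square_less_1 abs_less_iff) linarith
      have i: "f s * indicator D v * indicator {0<..} (s - (sqrt s * v)\<^sup>2)
          = f s * indicator (D \<inter> {-1<..<1}) v" for v
        using e[of v] by (auto split: split_indicator)
      \<comment> \<open>The substitution \<open>t = sqrt s * v\<close> normalises the height; its
        Jacobian is the weight \<open>sqrt s\<close> of the conclusion.\<close>
      have "(\<integral>\<^sup>+t. f s * indicator D (t / sqrt s) * indicator {0<..} (s - t\<^sup>2) \<partial>lborel)
        = ennreal (sqrt s) * (\<integral>\<^sup>+v. f s * indicator (D \<inter> {-1<..<1}) v \<partial>lborel)"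
        using True
        by (subst nn_integral_real_affine[where c="sqrt s" and t=0]) (auto simp: i)
      also have "\<dots> = ennreal (sqrt s) * (f s * emeasure lborel (D \<inter> {-1<..<1}))"
        by (subst nn_integral_cmult_indicator) auto
      finally show ?thesis using True by (simp add: ac_simps)
    qed
  qed
  also have "\<dots> = emeasure lborel (D \<inter> {-1<..<1}) * (\<integral>\<^sup>+s. f s * ennreal (sqrt s) * indicator {0<..} s \<partial>lborel)"
    by (rule nn_integral_cmult) measurable
  finally show ?thesis by (simp add: mult.assoc)
qed

section \<open>The law of the azimuth and its moments\<close>

definition angle_law :: "real measure" where
  "angle_law = scale_measure (inverse (angle_mass UNIV))
     (distr (density (lborel \<Otimes>\<^sub>M lborel) (\<lambda>(x, y). indicator {..<1} (x\<^sup>2 + y\<^sup>2)))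
        borel (\<lambda>(x, y). cos2 x y))"

lemma sets_angle_law [simp, measurable_cong]: "sets angle_law = sets borel"
  by (simp add: angle_law_def)

lemma space_angle_law [simp]: "space angle_law = UNIV"
  using sets_eq_imp_space_eq[OF sets_angle_law] by simp

lemma nn_integral_angle_law:
  assumes [measurable]: "f \<in> borel_measurable borel"
  shows "(\<integral>\<^sup>+c. f c \<partial>angle_law) =
    (\<integral>\<^sup>+x. \<integral>\<^sup>+y. f (cos2 x y) * indicator {..<1} (x\<^sup>2 + y\<^sup>2) \<partial>lborel \<partial>lborel) / angle_mass UNIV"
proof -
  have "(\<integral>\<^sup>+c. f c \<partial>angle_law) =
    inverse (angle_mass UNIV) * (\<integral>\<^sup>+p. f (cos2 (fst p) (snd p)) * indicator {..<1} ((fst p)\<^sup>2 + (snd p)\<^sup>2) \<partial>(lborel \<Otimes>\<^sub>M lborel))"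
    unfolding angle_law_def
    by (simp add: nn_integral_scale_measure nn_integral_distr nn_integral_density split_beta' mult.commute)
  also have "(\<integral>\<^sup>+p. f (cos2 (fst p) (snd p)) * indicator {..<1} ((fst p)\<^sup>2 + (snd p)\<^sup>2) \<partial>(lborel \<Otimes>\<^sub>M lborel))
    = (\<integral>\<^sup>+x. \<integral>\<^sup>+y. f (cos2 x y) * indicator {..<1} (x\<^sup>2 + y\<^sup>2) \<partial>lborel \<partial>lborel)"
    by (subst lborel.nn_integral_fst[symmetric]) auto
  finally show ?thesis by (simp add: divide_ennreal_def mult.commute)
qed

lemma angle_mass_pos: "angle_mass UNIV > 0"
proof -
  have "0 < ennreal 1 * ennreal 1" by simp
  also have "\<dots> = (\<integral>\<^sup>+x. \<integral>\<^sup>+y. indicator {-1/2..1/2} x * indicator {-1/2..1/2} (y::real) \<partial>lborel \<partial>(lborel::real measure))"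
    by (simp add: nn_integral_cmult nn_integral_multc)
  also have "\<dots> \<le> angle_mass UNIV"
    unfolding angle_mass_def
  proof (intro nn_integral_mono)
    fix x y :: real
    have "x\<^sup>2 + y\<^sup>2 < 1" if "\<bar>x\<bar> \<le> 1/2" "\<bar>y\<bar> \<le> 1/2"
    proof -
      have "x\<^sup>2 \<le> (1/2)\<^sup>2" "y\<^sup>2 \<le> (1/2)\<^sup>2"
        using power_mono[OF that(1), of 2] power_mono[OF that(2), of 2] by (simp_all only: power2_abs abs_ge_zero)
      then show ?thesis by (simp add: power2_eq_square)
    qed
    then show "(indicator {-1/2..1/2} x * indicator {-1/2..1/2} y :: ennreal) \<le> indicator UNIV (cos2 x y) * indicator {..<1} (x\<^sup>2 + y\<^sup>2)"
      by (auto simp: indicator_def abs_le_iff)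
  qed
  finally show ?thesis .
qed

lemma emeasure_angle_law:
  "B \<in> sets borel \<Longrightarrow> emeasure angle_law B = angle_mass B / angle_mass UNIV"
  using nn_integral_angle_law[of "indicator B"] by (simp add: angle_mass_def)

lemma emeasure_angle_law_UNIV: "emeasure angle_law UNIV = 1"
  using angle_mass_pos angle_mass_finite[of UNIV] by (simp add: emeasure_angle_law ennreal_divide_self less_top)

interpretation angle_law: finite_measure angle_law
  by standard (simp add: emeasure_angle_law_UNIV)

lemma AE_angle_law: "AE c in angle_law. \<bar>c\<bar> \<le> 1"
proof -
  have "angle_mass {c. \<not> \<bar>c\<bar> \<le> 1} = 0"
    unfolding angle_mass_def using abs_cos2_le by simp
  then show ?thesis
    by (intro AE_I[where N="{c. \<not> \<bar>c\<bar> \<le> 1}"]) (auto simp: emeasure_angle_law)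
qed

text \<open>Exchanging \<open>x\<close> and \<open>y\<close> preserves the disc and changes the sign
  of \<open>cos2\<close>. This symmetry kills the odd moments.\<close>

lemma angle_law_uminus: "distr angle_law borel uminus = angle_law"
proof (rule measure_eqI)
  fix A :: "real set" assume "A \<in> sets (distr angle_law borel uminus)"
  then have [measurable]: "A \<in> sets borel" by simp
  have m[measurable]: "uminus -` A \<in> sets borel"
    using measurable_sets[of uminus borel borel A] by simp
  have c: "cos2 x y = - cos2 y x" for x y
    by (simp add: cos2_def add.commute minus_divide_left)
  have "angle_mass (uminus -` A) = (\<integral>\<^sup>+x. \<integral>\<^sup>+y. indicator A (cos2 y x) * indicator {..<1} (y\<^sup>2 + x\<^sup>2) \<partial>lborel \<partial>lborel)"
    unfolding angle_mass_def
  proof (intro nn_integral_cong)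
    fix x y :: real
    have "indicator (uminus -` A) (cos2 x y) = (indicator A (cos2 y x) :: ennreal)"
      unfolding c[of y x] by (simp add: indicator_def)
    then show "indicator (uminus -` A) (cos2 x y) * indicator {..<1} (x\<^sup>2 + y\<^sup>2)
      = (indicator A (cos2 y x) * indicator {..<1} (y\<^sup>2 + x\<^sup>2) :: ennreal)"
      by (simp only: add.commute)
  qed
  also have "\<dots> = angle_mass A"
    unfolding angle_mass_def
    by (rule lborel_pair.Fubini'[symmetric]) measurable
  finally show "emeasure (distr angle_law borel uminus) A = emeasure angle_law A"
    by (simp add: emeasure_distr emeasure_angle_law m)
qed simp

lemma integrable_angle_law:
  assumes [measurable]: "f \<in> borel_measurable borel" and "\<And>c. \<bar>c\<bar> \<le> 1 \<Longrightarrow> \<bar>f c\<bar> \<le> (b::real)"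
  shows "integrable angle_law f"
  using AE_angle_law assms(2)
  by (intro angle_law.integrable_const_bound[where B=b]) (auto elim!: eventually_mono)

lemma integrable_angle_law_power: "integrable angle_law (\<lambda>c. c ^ n)"
  by (rule integrable_angle_law[where b=1]) (auto simp: power_abs intro: power_le_one)

lemma integral_angle_law_odd:
  assumes "odd n" shows "(\<integral>c. c ^ n \<partial>angle_law) = 0"
proof -
  have "(\<integral>c. c ^ n \<partial>angle_law) = (\<integral>c. (-c) ^ n \<partial>angle_law)"
    by (subst (1) angle_law_uminus[symmetric], subst integral_distr) auto
  also have "\<dots> = - (\<integral>c. c ^ n \<partial>angle_law)" using assms by simp
  finally show ?thesis by simp
qed

text \<open>The map is orthogonal. It is factored into one-dimensional substitutions, first
  \<open>p = x + y\<close> at fixed \<open>x\<close>, then \<open>x\<close> against the second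
  coordinate at fixed \<open>p\<close>, then a rescaling of \<open>p\<close>; the factors
  \<open>1 / sqrt 2\<close> and \<open>sqrt 2\<close> cancel.\<close>

lemma lborel_rotate45:
  assumes [measurable]: "case_prod f \<in> borel_measurable (borel \<Otimes>\<^sub>M borel :: (real \<times> real) measure)"
  shows "(\<integral>\<^sup>+x. \<integral>\<^sup>+y. f ((x + y) / sqrt 2) ((x - y) / sqrt 2) \<partial>lborel \<partial>lborel)
       = (\<integral>\<^sup>+x. \<integral>\<^sup>+y. f x y \<partial>lborel \<partial>lborel)"
proof -
  have "(\<integral>\<^sup>+x. \<integral>\<^sup>+y. f ((x + y) / sqrt 2) ((x - y) / sqrt 2) \<partial>lborel \<partial>lborel)
      = (\<integral>\<^sup>+x. \<integral>\<^sup>+p. f (p / sqrt 2) ((2 * x - p) / sqrt 2) \<partial>lborel \<partial>lborel)"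
  proof (rule nn_integral_cong)
    fix x :: real
    show "(\<integral>\<^sup>+y. f ((x + y) / sqrt 2) ((x - y) / sqrt 2) \<partial>lborel) = (\<integral>\<^sup>+p. f (p / sqrt 2) ((2 * x - p) / sqrt 2) \<partial>lborel)"
      using nn_integral_real_affine[of "\<lambda>p. f (p / sqrt 2) ((2 * x - p) / sqrt 2)" 1 x]
      by (simp add: algebra_simps)
  qed
  also have "\<dots> = (\<integral>\<^sup>+p. \<integral>\<^sup>+x. f (p / sqrt 2) ((2 * x - p) / sqrt 2) \<partial>lborel \<partial>lborel)"
    by (rule lborel_pair.Fubini') measurable
  also have "\<dots> = (\<integral>\<^sup>+p. ennreal (1 / sqrt 2) * (\<integral>\<^sup>+q. f (p / sqrt 2) q \<partial>lborel) \<partial>lborel)"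
  proof (rule nn_integral_cong)
    fix p :: real
    have "(2 * (p / 2 + 1 / sqrt 2 * q) - p) / sqrt 2 = q" for q
      by (simp add: field_simps)
    then show "(\<integral>\<^sup>+x. f (p / sqrt 2) ((2 * x - p) / sqrt 2) \<partial>lborel) = ennreal (1 / sqrt 2) * (\<integral>\<^sup>+q. f (p / sqrt 2) q \<partial>lborel)"
      by (subst nn_integral_real_affine[where c="1 / sqrt 2" and t="p/2"]) auto
  qed
  also have "\<dots> = ennreal (1 / sqrt 2) * (\<integral>\<^sup>+p. \<integral>\<^sup>+q. f (p / sqrt 2) q \<partial>lborel \<partial>lborel)"
    by (rule nn_integral_cmult) measurable
  also have "(\<integral>\<^sup>+p. \<integral>\<^sup>+q. f (p / sqrt 2) q \<partial>lborel \<partial>lborel) = ennreal (sqrt 2) * (\<integral>\<^sup>+p. \<integral>\<^sup>+q. f p q \<partial>lborel \<partial>lborel)"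
    by (subst nn_integral_real_affine[where c="sqrt 2" and t=0]) auto
  finally show ?thesis
    by (simp add: mult.assoc[symmetric] ennreal_mult[symmetric])
qed

text \<open>The orthogonal map of \<open>lborel_rotate45\<close> turns the cosine of the double
  angle into its sine \<open>s\<close>. So both squares have the same integral, and they add up to 1
  except at the origin, which the null set \<open>x = 0\<close> contains.\<close>

lemma integral_angle_law_square: "(\<integral>c. c\<^sup>2 \<partial>angle_law) = 1/2"
proof -
  let ?J = "\<lambda>f. (\<integral>\<^sup>+x. \<integral>\<^sup>+y. ennreal (f x y) * indicator {..<1} (x\<^sup>2 + y\<^sup>2) \<partial>lborel \<partial>(lborel :: real measure))"
  define s where "s = (\<lambda>x y::real. 2 * x * y / (x\<^sup>2 + y\<^sup>2))"
  have [measurable]: "(\<lambda>p. s (fst p) (snd p)) \<in> borel_measurable (borel \<Otimes>\<^sub>M borel)"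
    unfolding s_def by measurable
  have rot: "cos2 ((x + y) / sqrt 2) ((x - y) / sqrt 2) = s x y"
    "((x + y) / sqrt 2)\<^sup>2 + ((x - y) / sqrt 2)\<^sup>2 = x\<^sup>2 + y\<^sup>2" for x y
  proof -
    have "((x + y) / sqrt 2)\<^sup>2 = (x + y)\<^sup>2 / 2" "((x - y) / sqrt 2)\<^sup>2 = (x - y)\<^sup>2 / 2"
      by (simp_all add: power_divide)
    moreover have "(x + y)\<^sup>2 / 2 - (x - y)\<^sup>2 / 2 = 2 * x * y" "(x + y)\<^sup>2 / 2 + (x - y)\<^sup>2 / 2 = x\<^sup>2 + y\<^sup>2"
      by (simp_all add: power2_sum power2_diff add_divide_distrib diff_divide_distrib)
    ultimately show "cos2 ((x + y) / sqrt 2) ((x - y) / sqrt 2) = s x y"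
      "((x + y) / sqrt 2)\<^sup>2 + ((x - y) / sqrt 2)\<^sup>2 = x\<^sup>2 + y\<^sup>2"
      unfolding cos2_def s_def by (simp_all only:)
  qed
  have "?J (\<lambda>x y. (cos2 x y)\<^sup>2) = ?J (\<lambda>x y. (s x y)\<^sup>2)"
    using lborel_rotate45[of "\<lambda>x y. ennreal ((cos2 x y)\<^sup>2) * indicator {..<1} (x\<^sup>2 + y\<^sup>2)"]
    unfolding rot by simp
  moreover have "?J (\<lambda>x y. (cos2 x y)\<^sup>2) + ?J (\<lambda>x y. (s x y)\<^sup>2) = angle_mass UNIV"
  proof -
    have [measurable]: "(\<lambda>y. s x y) \<in> borel_measurable borel" for x
      unfolding s_def by measurable
    have e: "AE x in lborel. AE y in lborel. ennreal ((cos2 x y)\<^sup>2) * indicator {..<1} (x\<^sup>2 + y\<^sup>2) + ennreal ((s x y)\<^sup>2) * indicator {..<1} (x\<^sup>2 + y\<^sup>2)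
      = indicator UNIV (cos2 x y) * indicator {..<1} (x\<^sup>2 + y\<^sup>2)"
    proof -
      have "(cos2 x y)\<^sup>2 + (s x y)\<^sup>2 = 1" if "x \<noteq> 0" for x y
      proof -
        have "x\<^sup>2 + y\<^sup>2 \<noteq> 0" using that by (simp add: sum_power2_eq_zero_iff)
        then show ?thesis
          unfolding cos2_def s_def power_divide
          by (simp add: divide_simps) (simp add: power2_eq_square algebra_simps)
      qed
      moreover have "AE x in lborel. x \<noteq> (0::real)" by (rule AE_lborel_singleton)
      ultimately show ?thesis
      proof (elim eventually_mono, intro always_eventually allI)
        fix x y :: real assume *: "\<And>x y :: real. x \<noteq> 0 \<Longrightarrow> (cos2 x y)\<^sup>2 + (s x y)\<^sup>2 = 1" "x \<noteq> 0"
        have "ennreal ((cos2 x y)\<^sup>2) + ennreal ((s x y)\<^sup>2) = 1"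
          using *(1)[OF *(2), of y] by (subst ennreal_plus[symmetric]) simp_all
        then show "ennreal ((cos2 x y)\<^sup>2) * indicator {..<1} (x\<^sup>2 + y\<^sup>2) + ennreal ((s x y)\<^sup>2) * indicator {..<1} (x\<^sup>2 + y\<^sup>2)
          = indicator UNIV (cos2 x y) * indicator {..<1} (x\<^sup>2 + y\<^sup>2)"
          unfolding distrib_right[symmetric] by simp
      qed
    qed
    have "?J (\<lambda>x y. (cos2 x y)\<^sup>2) + ?J (\<lambda>x y. (s x y)\<^sup>2) =
      (\<integral>\<^sup>+x. (\<integral>\<^sup>+y. ennreal ((cos2 x y)\<^sup>2) * indicator {..<1} (x\<^sup>2 + y\<^sup>2) \<partial>lborel) +
        (\<integral>\<^sup>+y. ennreal ((s x y)\<^sup>2) * indicator {..<1} (x\<^sup>2 + y\<^sup>2) \<partial>lborel) \<partial>lborel)"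
      by (rule nn_integral_add[symmetric]) measurable
    also have "\<dots> = (\<integral>\<^sup>+x. \<integral>\<^sup>+y. ennreal ((cos2 x y)\<^sup>2) * indicator {..<1} (x\<^sup>2 + y\<^sup>2) +
        ennreal ((s x y)\<^sup>2) * indicator {..<1} (x\<^sup>2 + y\<^sup>2) \<partial>lborel \<partial>lborel)"
      by (intro nn_integral_cong nn_integral_add[symmetric]) measurable
    also have "\<dots> = angle_mass UNIV"
      unfolding angle_mass_def
      by (rule nn_integral_cong_AE, rule eventually_mono[OF e], rule nn_integral_cong_AE)
    finally show ?thesis .
  qed
  ultimately have 2: "2 * ?J (\<lambda>x y. (cos2 x y)\<^sup>2) = angle_mass UNIV"
    by (simp add: mult_2)
  have "2 * (\<integral>\<^sup>+c. ennreal (c\<^sup>2) \<partial>angle_law) = 2 * ?J (\<lambda>x y. (cos2 x y)\<^sup>2) / angle_mass UNIV"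
    by (subst nn_integral_angle_law) (simp_all only: ennreal_times_divide, measurable)
  also have "\<dots> = 1"
    unfolding 2 using angle_mass_pos angle_mass_finite[of UNIV]
    by (intro ennreal_divide_self) (auto simp: less_top)
  finally have "2 * (\<integral>\<^sup>+c. ennreal (c\<^sup>2) \<partial>angle_law) = 1" .
  moreover have "(\<integral>\<^sup>+c. ennreal (c\<^sup>2) \<partial>angle_law) = ennreal (\<integral>c. c\<^sup>2 \<partial>angle_law)"
    by (rule nn_integral_eq_integral) (auto intro: integrable_angle_law_power)
  ultimately have "ennreal (2 * (\<integral>c. c\<^sup>2 \<partial>angle_law)) = ennreal 1"
    by (simp add: ennreal_mult')
  then show ?thesis by (simp add: ennreal_eq_1)
qed

definition height_law :: "real measure" where
  "height_law = uniform_measure lborel {-1<..<1}"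

lemma sets_height_law [simp, measurable_cong]: "sets height_law = sets borel"
  by (simp add: height_law_def)

lemma space_height_law [simp]: "space height_law = UNIV"
  by (simp add: height_law_def)

lemma emeasure_height_law:
  "D \<in> sets borel \<Longrightarrow> emeasure height_law D = emeasure lborel (D \<inter> {-1<..<1}) / 2"
  by (simp add: height_law_def Int_commute)

interpretation height_law: finite_measure height_law
  by standard (simp add: emeasure_height_law)

section \<open>Integration over three of the d coordinates\<close>

lemma borel_measurable_PiM_lborel_component:
  "b \<in> I \<Longrightarrow> (\<lambda>f. f b) \<in> borel_measurable (Pi\<^sub>M I (\<lambda>_. lborel :: real measure))"
  using measurable_component_singleton[of b I "\<lambda>_. lborel :: real measure"] by simp

locale three_axes =
  fixes e1 e2 e3 :: "'a::euclidean_space"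
  assumes axes: "e1 \<in> Basis" "e2 \<in> Basis" "e3 \<in> Basis" "e1 \<noteq> e2" "e1 \<noteq> e3" "e2 \<noteq> e3"
begin

definition radius :: "'a \<Rightarrow> real" where
  "radius z = sqrt ((z \<bullet> e1)\<^sup>2 + (z \<bullet> e2)\<^sup>2 + (z \<bullet> e3)\<^sup>2)"

definition azimuth :: "'a \<Rightarrow> real" where
  "azimuth z = cos2 (z \<bullet> e1) (z \<bullet> e2)"

definition height :: "'a \<Rightarrow> real" where
  "height z = z \<bullet> e3 / radius z"

lemma borel_measurable_coordinates [measurable]:
  "radius \<in> borel_measurable borel" "azimuth \<in> borel_measurable borel" "height \<in> borel_measurable borel"
  unfolding radius_def azimuth_def height_def by measurable

text \<open>Lebesgue measure is a product over \<open>Basis\<close>, from which the three axes are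
  split off one at a time. The norm is kept as a fourth argument because a radial density depends on
  all coordinates; the remaining ones enter only through their sum of squares.\<close>

lemma nn_integral_split_axes:
  assumes F [measurable]: "F \<in> borel_measurable (borel \<Otimes>\<^sub>M borel \<Otimes>\<^sub>M borel \<Otimes>\<^sub>M borel)"
  shows "(\<integral>\<^sup>+z. F (z \<bullet> e1, z \<bullet> e2, z \<bullet> e3, norm z) \<partial>lborel) =
    (\<integral>\<^sup>+w. \<integral>\<^sup>+t. \<integral>\<^sup>+x. \<integral>\<^sup>+y. F (x, y, t, sqrt (x\<^sup>2 + y\<^sup>2 + t\<^sup>2 + (\<Sum>b\<in>Basis - {e1, e2, e3}. (w b)\<^sup>2))) \<partial>lborel \<partial>lborel \<partial>lborel
      \<partial>Pi\<^sub>M (Basis - {e1, e2, e3}) (\<lambda>_. lborel))"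
proof -
  define R where "R = Basis - {e1, e2, e3}"
  define q where "q = (\<lambda>I (f :: 'a \<Rightarrow> real). \<Sum>b\<in>I. (f b)\<^sup>2)"
  interpret product_sigma_finite "\<lambda>_::'a. lborel :: real measure"
    by standard
  have R: "finite R" "finite (insert e3 R)" "finite (insert e1 (insert e3 R))"
    "e3 \<notin> R" "e1 \<notin> insert e3 R" "e2 \<notin> insert e1 (insert e3 R)"
    using axes by (auto simp: R_def)
  have B: "Basis = insert e2 (insert e1 (insert e3 R))" using axes by (auto simp: R_def)
  have q_update: "q (insert e I) (f(e := y)) = y\<^sup>2 + q I f" if "finite I" "e \<notin> I" for e I f y
    using that unfolding q_def by simp (intro sum.cong, auto)
  have comp [measurable]: "(\<lambda>f. f b) \<in> borel_measurable (Pi\<^sub>M (insert b I) (\<lambda>_. lborel :: real measure))"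
    "(\<lambda>f. f b) \<in> borel_measurable (Pi\<^sub>M (insert c (insert b I)) (\<lambda>_. lborel :: real measure))"
    "(\<lambda>f. f b) \<in> borel_measurable (Pi\<^sub>M (insert d (insert c (insert b I))) (\<lambda>_. lborel :: real measure))" for b c d :: 'a and I
    by (rule borel_measurable_PiM_lborel_component, simp)+
  have [measurable]: "q I \<in> borel_measurable (Pi\<^sub>M I (\<lambda>_. lborel :: real measure))" for I
    unfolding q_def
    by (intro borel_measurable_sum borel_measurable_power borel_measurable_PiM_lborel_component)
  have n: "norm z = sqrt (\<Sum>b\<in>Basis. (z \<bullet> b)\<^sup>2)" for z :: 'a
    by (simp add: norm_eq_sqrt_inner euclidean_inner[of z z] power2_eq_square)
  have "(\<integral>\<^sup>+z. F (z \<bullet> e1, z \<bullet> e2, z \<bullet> e3, norm z) \<partial>lborel) =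
      (\<integral>\<^sup>+f. F (f e1, f e2, f e3, sqrt (q Basis f)) \<partial>Pi\<^sub>M Basis (\<lambda>_. lborel))"
  proof -
    have "(\<lambda>f. \<Sum>b\<in>Basis. f b *\<^sub>R b) \<in> Pi\<^sub>M Basis (\<lambda>_. lborel :: real measure) \<rightarrow>\<^sub>M (borel :: 'a measure)"
      by (intro borel_measurable_sum borel_measurable_scaleR borel_measurable_PiM_lborel_component) auto
    then show ?thesis
      using axes by (subst lborel_eq, subst nn_integral_distr) (auto simp: n q_def)
  qed
  also have "\<dots> = (\<integral>\<^sup>+f. F (f e1, f e2, f e3, sqrt (q (insert e2 (insert e1 (insert e3 R))) f))
      \<partial>Pi\<^sub>M (insert e2 (insert e1 (insert e3 R))) (\<lambda>_. lborel))"
    unfolding B[symmetric] ..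
  also have "\<dots> = (\<integral>\<^sup>+f. \<integral>\<^sup>+y. F (f e1, y, f e3, sqrt (y\<^sup>2 + q (insert e1 (insert e3 R)) f))
      \<partial>lborel \<partial>Pi\<^sub>M (insert e1 (insert e3 R)) (\<lambda>_. lborel))"
    using axes by (subst product_nn_integral_insert[OF R(3,6)]) (measurable, simp add: q_update[OF R(3,6)])
  also have "\<dots> = (\<integral>\<^sup>+f. \<integral>\<^sup>+x. \<integral>\<^sup>+y. F (x, y, f e3, sqrt (y\<^sup>2 + (x\<^sup>2 + q (insert e3 R) f)))
      \<partial>lborel \<partial>lborel \<partial>Pi\<^sub>M (insert e3 R) (\<lambda>_. lborel))"
    using axes by (subst product_nn_integral_insert[OF R(2,5)]) (measurable, simp add: q_update[OF R(2,5)])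
  also have "\<dots> = (\<integral>\<^sup>+w. \<integral>\<^sup>+t. \<integral>\<^sup>+x. \<integral>\<^sup>+y. F (x, y, t, sqrt (y\<^sup>2 + (x\<^sup>2 + (t\<^sup>2 + q R w))))
      \<partial>lborel \<partial>lborel \<partial>lborel \<partial>Pi\<^sub>M R (\<lambda>_. lborel))"
    by (subst product_nn_integral_insert[OF R(1,4)]) (measurable, simp add: q_update[OF R(1,4)])
  finally show ?thesis by (simp add: q_def R_def ac_simps)
qed

text \<open>At fixed remaining coordinates \<open>w\<close> the norm is a function of the radius, so
  \<open>space_archimedes\<close> applies with \<open>w\<close> as a parameter, and its two angular
  factors do not depend on \<open>w\<close>.\<close>

lemma nn_integral_axes_aux:
  assumes [measurable]: "(\<lambda>(s, n). f s n) \<in> borel_measurable (borel \<Otimes>\<^sub>M borel)"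
    "A \<in> sets borel" "D \<in> sets borel"
  shows "(\<integral>\<^sup>+z. f (radius z) (norm z) * indicator A (azimuth z) * indicator D (height z) \<partial>lborel) =
    angle_mass A * emeasure lborel (D \<inter> {-1<..<1}) *
    (\<integral>\<^sup>+w. \<integral>\<^sup>+s. f (sqrt s) (sqrt (s + (\<Sum>b\<in>Basis - {e1, e2, e3}. (w b)\<^sup>2))) * ennreal (sqrt s) * indicator {0<..} s \<partial>lborel
      \<partial>Pi\<^sub>M (Basis - {e1, e2, e3}) (\<lambda>_. lborel))"
proof -
  let ?R = "Basis - {e1, e2, e3}"
  have [measurable]: "(\<lambda>w. \<Sum>b\<in>?R. (w b)\<^sup>2) \<in> borel_measurable (Pi\<^sub>M ?R (\<lambda>_. lborel :: real measure))"
    by (intro borel_measurable_sum borel_measurable_power borel_measurable_PiM_lborel_component)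
  have "(\<integral>\<^sup>+z. f (radius z) (norm z) * indicator A (azimuth z) * indicator D (height z) \<partial>lborel) =
    (\<integral>\<^sup>+w. \<integral>\<^sup>+t. \<integral>\<^sup>+x. \<integral>\<^sup>+y. f (sqrt (x\<^sup>2 + y\<^sup>2 + t\<^sup>2)) (sqrt (x\<^sup>2 + y\<^sup>2 + t\<^sup>2 + (\<Sum>b\<in>?R. (w b)\<^sup>2)))
        * indicator A (cos2 x y) * indicator D (t / sqrt (x\<^sup>2 + y\<^sup>2 + t\<^sup>2)) \<partial>lborel \<partial>lborel \<partial>lborel
      \<partial>Pi\<^sub>M ?R (\<lambda>_. lborel))"
    unfolding radius_def azimuth_def height_def
    using nn_integral_split_axes[of "\<lambda>(x, y, t, n). f (sqrt (x\<^sup>2 + y\<^sup>2 + t\<^sup>2)) n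
        * indicator A (cos2 x y) * indicator D (t / sqrt (x\<^sup>2 + y\<^sup>2 + t\<^sup>2))"]
    by simp
  also have "\<dots> = (\<integral>\<^sup>+w. angle_mass A * emeasure lborel (D \<inter> {-1<..<1}) *
     (\<integral>\<^sup>+s. f (sqrt s) (sqrt (s + (\<Sum>b\<in>?R. (w b)\<^sup>2))) * ennreal (sqrt s) * indicator {0<..} s \<partial>lborel) \<partial>Pi\<^sub>M ?R (\<lambda>_. lborel))"
  proof (rule nn_integral_cong)
    fix w :: "'a \<Rightarrow> real"
    define c where "c = (\<Sum>b\<in>?R. (w b)\<^sup>2)"
    show "(\<integral>\<^sup>+t. \<integral>\<^sup>+x. \<integral>\<^sup>+y. f (sqrt (x\<^sup>2 + y\<^sup>2 + t\<^sup>2)) (sqrt (x\<^sup>2 + y\<^sup>2 + t\<^sup>2 + (\<Sum>b\<in>?R. (w b)\<^sup>2)))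
        * indicator A (cos2 x y) * indicator D (t / sqrt (x\<^sup>2 + y\<^sup>2 + t\<^sup>2)) \<partial>lborel \<partial>lborel \<partial>lborel)
      = angle_mass A * emeasure lborel (D \<inter> {-1<..<1}) *
     (\<integral>\<^sup>+s. f (sqrt s) (sqrt (s + (\<Sum>b\<in>?R. (w b)\<^sup>2))) * ennreal (sqrt s) * indicator {0<..} s \<partial>lborel)"
      unfolding c_def[symmetric]
      using space_archimedes[of A D "\<lambda>s. f (sqrt s) (sqrt (s + c))"]
      by (simp add: ac_simps)
  qed
  also have "\<dots> = angle_mass A * emeasure lborel (D \<inter> {-1<..<1}) * (\<integral>\<^sup>+w.
     (\<integral>\<^sup>+s. f (sqrt s) (sqrt (s + (\<Sum>b\<in>?R. (w b)\<^sup>2))) * ennreal (sqrt s) * indicator {0<..} s \<partial>lborel) \<partial>Pi\<^sub>M ?R (\<lambda>_. lborel))"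
    by (rule nn_integral_cmult) measurable
  finally show ?thesis .
qed

text \<open>The case \<open>A = D = UNIV\<close> of the previous lemma supplies the normalisation.
  Allowing \<open>f\<close> to depend on radius and norm together covers radial densities as well as
  the cones that define surface measure.\<close>

lemma nn_integral_axes:
  assumes [measurable]: "(\<lambda>(s, n). f s n) \<in> borel_measurable (borel \<Otimes>\<^sub>M borel)"
    "A \<in> sets borel" "D \<in> sets borel"
  shows "(\<integral>\<^sup>+z. f (radius z) (norm z) * indicator A (azimuth z) * indicator D (height z) \<partial>lborel) =
    emeasure angle_law A * emeasure height_law D * (\<integral>\<^sup>+z. f (radius z) (norm z) \<partial>(lborel :: 'a measure))"
proof -
  have "(\<integral>\<^sup>+z. f (radius z) (norm z) \<partial>lborel) =
    angle_mass UNIV * 2 *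
    (\<integral>\<^sup>+w. \<integral>\<^sup>+s. f (sqrt s) (sqrt (s + (\<Sum>b\<in>Basis - {e1, e2, e3}. (w b)\<^sup>2))) * ennreal (sqrt s) * indicator {0<..} s \<partial>lborel
      \<partial>Pi\<^sub>M (Basis - {e1, e2, e3}) (\<lambda>_. lborel))" (is "_ = _ * ?I")
    using nn_integral_axes_aux[of f UNIV UNIV] by simp
  moreover have "angle_mass A / angle_mass UNIV * (e / 2) * (angle_mass UNIV * 2 * I) = angle_mass A * e * I" for e I
  proof -
    have "angle_mass A / angle_mass UNIV * (e / 2) * (angle_mass UNIV * 2 * I)
      = (angle_mass UNIV * (angle_mass A / angle_mass UNIV)) * (2 * (e / 2)) * I"
      by (simp add: ac_simps)
    also have "angle_mass UNIV * (angle_mass A / angle_mass UNIV) = angle_mass A"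
      using angle_mass_pos angle_mass_finite[of UNIV]
      by (simp add: ennreal_times_divide mult.commute ennreal_mult_divide_eq less_top)
    also have "2 * (e / 2) = e"
      by (simp add: ennreal_times_divide mult.commute ennreal_mult_divide_eq)
    finally show ?thesis .
  qed
  ultimately show ?thesis
    by (simp add: nn_integral_axes_aux emeasure_angle_law emeasure_height_law)
qed

end

section \<open>Radial kernels\<close>

lemma nn_integral_inverse_1_plus_square: "(\<integral>\<^sup>+x. ennreal (1 / (1 + x\<^sup>2)) \<partial>lborel) < \<infinity>"
proof -
  let ?f = "\<lambda>x::real. ennreal (1 / (1 + x\<^sup>2))"
  have h: "(\<integral>\<^sup>+x. ?f x * indicator {0..} x \<partial>lborel) = ennreal (pi / 2)"
    using nn_integral_FTC_atLeast[of "\<lambda>x. 1 / (1 + x\<^sup>2)" 0 arctan "pi/2"]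
    using DERIV_arctan tendsto_arctan_at_top by (simp add: inverse_eq_divide)
  have "(\<integral>\<^sup>+x. ?f x \<partial>lborel) \<le> (\<integral>\<^sup>+x. ?f x * indicator {0..} x + ?f (-x) * indicator {0..} (-x) \<partial>lborel)"
    by (intro nn_integral_mono) (auto split: split_indicator)
  also have "\<dots> = (\<integral>\<^sup>+x. ?f x * indicator {0..} x \<partial>lborel) + (\<integral>\<^sup>+x. ?f (-x) * indicator {0..} (-x) \<partial>lborel)"
    by (rule nn_integral_add) measurable
  also have "(\<integral>\<^sup>+x. ?f (-x) * indicator {0..} (-x) \<partial>lborel) = (\<integral>\<^sup>+x. ?f x * indicator {0..} x \<partial>lborel)"
    using nn_integral_real_affine[of "\<lambda>x. ?f x * indicator {0..} x" "-1" 0] by simp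
  finally show ?thesis
    unfolding h by (rule order.strict_trans1) (simp flip: ennreal_plus)
qed

text \<open>A weight in product form is integrable coordinate by coordinate; it serves as majorant
  for the tails of kernels.\<close>

lemma integrable_prod_inverse_1_plus_square:
  "integrable lborel (\<lambda>z::'a::euclidean_space. \<Prod>b\<in>Basis. 1 / (1 + (z \<bullet> b)\<^sup>2))"
proof (rule integrableI_bounded)
  have "(\<integral>\<^sup>+z. ennreal (norm (\<Prod>b\<in>Basis. 1 / (1 + ((z::'a) \<bullet> b)\<^sup>2))) \<partial>lborel)
    = (\<integral>\<^sup>+z. (\<Prod>b\<in>Basis. ennreal (1 / (1 + ((z::'a) \<bullet> b)\<^sup>2))) \<partial>lborel)"
    by (intro nn_integral_cong) (simp add: prod_ennreal prod_nonneg abs_of_nonneg)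
  also have "\<dots> = (\<Prod>b\<in>(Basis :: 'a set). (\<integral>\<^sup>+x. ennreal (1 / (1 + x\<^sup>2)) \<partial>lborel))"
    by (rule nn_integral_lborel_prod) auto
  also have "\<dots> < \<infinity>"
    using nn_integral_inverse_1_plus_square by (simp add: power_less_top_ennreal)
  finally show "(\<integral>\<^sup>+z. ennreal (norm (\<Prod>b\<in>Basis. 1 / (1 + ((z::'a) \<bullet> b)\<^sup>2))) \<partial>lborel) < \<infinity>" .
qed measurable

text \<open>Near the origin the power of the norm is bounded and \<open>K\<close> is integrable. Far
  out, each factor \<open>1 / (1 + (z \<bullet> b)^2)\<close> of the product majorant is at least
  \<open>1 / (2 * norm z ^ 2)\<close>, so two powers of decay per coordinate, beyond the power
  \<open>m\<close>, are enough.\<close>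

lemma integrable_function_kernel_moment:
  fixes K :: "'a::euclidean_space \<Rightarrow> real"
  assumes "function_kernel K"
  shows "integrable lborel (\<lambda>z. K z * norm z ^ m)"
proof -
  have [measurable]: "K \<in> borel_measurable borel" and nonneg: "\<And>x. 0 \<le> K x"
    and decay: "rapidly_decaying K" and K: "integrable lborel K"
    using assms unfolding function_kernel_def has_bochner_integral_iff by blast+
  let ?n = "DIM('a)"
  have "((\<lambda>x. norm x ^ (m + 2 * ?n) * K x) \<longlongrightarrow> 0) at_infinity"
    using decay by (auto simp: rapidly_decaying_def)
  then have "eventually (\<lambda>x. norm x ^ (m + 2 * ?n) * K x < 1) at_infinity"
    by (rule order_tendstoD) simp
  then obtain b where b: "\<And>x. b \<le> norm x \<Longrightarrow> norm x ^ (m + 2 * ?n) * K x < 1"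
    by (auto simp: eventually_at_infinity)
  define c where "c = max b 1"
  have bound: "K z * norm z ^ m \<le> c ^ m * K z + 2 ^ ?n * (\<Prod>b\<in>Basis. 1 / (1 + (z \<bullet> b)\<^sup>2))" for z
  proof (cases "norm z \<le> c")
    case True
    then have "K z * norm z ^ m \<le> K z * c ^ m"
      by (intro mult_left_mono power_mono nonneg) auto
    moreover have "0 \<le> (\<Prod>b\<in>Basis. 1 / (1 + (z \<bullet> b)\<^sup>2))" by (intro prod_nonneg) auto
    ultimately show ?thesis by (simp add: mult.commute add_increasing2)
  next
    case False
    then have z: "1 < norm z" "b \<le> norm z" by (auto simp: c_def)
    have "1 / (2 * (norm z)\<^sup>2) \<le> 1 / (1 + (z \<bullet> b)\<^sup>2)" if "b \<in> Basis" for b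
    proof (rule divide_left_mono)
      have "\<bar>z \<bullet> b\<bar> \<le> norm z" using that by (rule Basis_le_norm)
      then have "(z \<bullet> b)\<^sup>2 \<le> (norm z)\<^sup>2" by (metis abs_ge_zero power2_abs power_mono)
      moreover have "1 \<le> (norm z)\<^sup>2" using z by (simp add: one_le_power)
      ultimately show "1 + (z \<bullet> b)\<^sup>2 \<le> 2 * (norm z)\<^sup>2" by simp
      show "0 < 2 * (norm z)\<^sup>2 * (1 + (z \<bullet> b)\<^sup>2)"
        using z by (intro mult_pos_pos add_pos_nonneg) auto
    qed simp
    then have "(\<Prod>b\<in>(Basis::'a set). 1 / (2 * (norm z)\<^sup>2)) \<le> (\<Prod>b\<in>Basis. 1 / (1 + (z \<bullet> b)\<^sup>2))"
      by (intro prod_mono) auto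
    then have "1 / (2 ^ ?n * norm z ^ (2 * ?n)) \<le> (\<Prod>b\<in>Basis. 1 / (1 + (z \<bullet> b)\<^sup>2))"
      by (simp add: power_divide power_mult_distrib power_mult)
    then have "2 ^ ?n * (1 / (2 ^ ?n * norm z ^ (2 * ?n))) \<le> 2 ^ ?n * (\<Prod>b\<in>Basis. 1 / (1 + (z \<bullet> b)\<^sup>2))"
      by (intro mult_left_mono) auto
    then have "1 / norm z ^ (2 * ?n) \<le> 2 ^ ?n * (\<Prod>b\<in>Basis. 1 / (1 + (z \<bullet> b)\<^sup>2))"
      by simp
    moreover have "K z * norm z ^ m \<le> 1 / norm z ^ (2 * ?n)"
    proof -
      have "0 < norm z ^ (2 * ?n)" using z(1) by (intro zero_less_power) linarith
      then show ?thesis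
        using b[OF z(2)] by (subst pos_le_divide_eq) (simp_all add: power_add ac_simps)
    qed
    moreover have "0 \<le> c ^ m * K z" using nonneg[of z] by (simp add: c_def)
    ultimately show ?thesis by linarith
  qed
  show ?thesis
  proof (rule Bochner_Integration.integrable_bound)
    show "integrable lborel (\<lambda>z. c ^ m * K z + 2 ^ ?n * (\<Prod>b\<in>Basis. 1 / (1 + (z \<bullet> b)\<^sup>2)))"
      using K integrable_prod_inverse_1_plus_square by auto
    show "AE z in lborel. norm (K z * norm z ^ m) \<le> norm (c ^ m * K z + 2 ^ ?n * (\<Prod>b\<in>Basis. 1 / (1 + (z \<bullet> b)\<^sup>2)))"
    proof (intro always_eventually allI)
      fix z
      show "norm (K z * norm z ^ m) \<le> norm (c ^ m * K z + 2 ^ ?n * (\<Prod>b\<in>Basis. 1 / (1 + (z \<bullet> b)\<^sup>2)))"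
        using bound[of z] nonneg[of z] by (simp add: abs_mult)
    qed
  qed measurable
qed

lemma emeasure_surface_measure:
  fixes A :: "'a::euclidean_space set"
  assumes "A \<in> sets borel"
  shows "emeasure (surface_measure r) A = ennreal (real DIM('a) * r ^ (DIM('a) - 1)) *
    (\<integral>\<^sup>+x. indicator {..<1} (norm x) * indicator A (r *\<^sub>R sgn x) \<partial>lborel)"
proof -
  have [measurable]: "A \<in> sets borel" by fact
  have [measurable]: "(\<lambda>x::'a. r *\<^sub>R sgn x) \<in> borel_measurable borel"
    unfolding sgn_div_norm by measurable
  have b[measurable]: "ball 0 1 \<in> sets (borel :: 'a measure)" by simp
  have "emeasure (distr (density lborel (indicator (ball 0 1))) borel (\<lambda>x. r *\<^sub>R sgn x)) A
    = (\<integral>\<^sup>+y. indicator A y \<partial>distr (density lborel (indicator (ball 0 1))) borel (\<lambda>x::'a. r *\<^sub>R sgn x))"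
    using assms by simp
  also have "\<dots> = (\<integral>\<^sup>+x. indicator (ball 0 1) x * indicator A (r *\<^sub>R sgn x) \<partial>lborel)"
    by (simp add: nn_integral_distr nn_integral_density del: nn_integral_indicator)
  also have "\<dots> = (\<integral>\<^sup>+x. indicator {..<1} (norm x) * indicator A (r *\<^sub>R sgn x) \<partial>lborel)"
    by (intro nn_integral_cong) (auto split: split_indicator)
  finally show ?thesis by (simp add: surface_measure_def)
qed

lemma spherical_kernelE:
  assumes "spherical_kernel M"
  obtains R c where "finite R" "\<And>r. r \<in> R \<Longrightarrow> 0 < r"
    "\<And>A. A \<in> sets borel \<Longrightarrow> emeasure M A = (\<Sum>r\<in>R. ennreal (c r) * emeasure (surface_measure r) A)"
  using assms unfolding spherical_kernel_def by blast

lemma sets_median_kernel: "median_kernel M \<Longrightarrow> sets M = sets borel"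
  by (auto simp: median_kernel_def spherical_kernel_def)

lemma emeasure_median_kernel_UNIV:
  fixes M :: "'a::euclidean_space measure"
  assumes "median_kernel M"
  shows "emeasure M UNIV = 1"
  using assms unfolding median_kernel_def
proof (elim disjE exE conjE)
  fix K :: "'a \<Rightarrow> real" assume K: "function_kernel K" "M = density lborel (\<lambda>x. ennreal (K x))"
  then have [measurable]: "K \<in> borel_measurable borel"
    and K': "\<And>x. 0 \<le> K x" "has_bochner_integral lborel K 1"
    unfolding function_kernel_def by blast+
  have "emeasure M UNIV = (\<integral>\<^sup>+x. ennreal (K x) \<partial>lborel)"
    by (simp add: K(2) emeasure_density)
  also have "\<dots> = ennreal 1"
    using K' by (intro nn_integral_eq_integrable[THEN iffD2]) (auto simp: has_bochner_integral_iff)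
  finally show ?thesis by simp
qed (auto simp: spherical_kernel_def)

lemma finite_measure_median_kernel: "median_kernel M \<Longrightarrow> finite_measure M"
  using emeasure_median_kernel_UNIV[of M] sets_eq_imp_space_eq[OF sets_median_kernel, of M]
  by (intro finite_measureI) simp

lemma integrable_median_kernel_moment:
  fixes M :: "'a::euclidean_space measure"
  assumes "median_kernel M"
  shows "integrable M (\<lambda>z. norm z ^ m)"
  using assms unfolding median_kernel_def
proof (elim disjE exE conjE)
  fix K :: "'a \<Rightarrow> real" assume K: "function_kernel K" "M = density lborel (\<lambda>x. ennreal (K x))"
  then have [measurable]: "K \<in> borel_measurable borel" and "\<And>x. 0 \<le> K x"
    unfolding function_kernel_def by blast+
  then show ?thesis
    using integrable_function_kernel_moment[OF K(1), of m] by (simp add: K(2) integrable_density)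
next
  assume S: "spherical_kernel M"
  then obtain R c where R: "finite R" "\<And>r. r \<in> R \<Longrightarrow> 0 < r"
    and M: "\<And>A. A \<in> sets borel \<Longrightarrow> emeasure M A = (\<Sum>r\<in>R. ennreal (c r) * emeasure (surface_measure r) A)"
    by (rule spherical_kernelE) blast
  have sets [measurable_cong]: "sets M = sets borel"
    using S unfolding spherical_kernel_def by blast
  interpret finite_measure M
    using S by (intro finite_measure_median_kernel) (simp add: median_kernel_def)
  \<comment> \<open>The sum of the positive radii bounds each of them, so all spheres lie in the
    ball of radius \<open>b\<close>.\<close>
  define b where "b = sum id R"
  have b: "r \<le> b" if "r \<in> R" for r
    using that R member_le_sum[of r R id] by (auto simp: b_def intro: less_imp_le)
  have "emeasure (surface_measure r) {z::'a. b < norm z} = 0" if "r \<in> R" for r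
  proof -
    have "norm (r *\<^sub>R sgn x) \<le> b" for x :: 'a
      using b[OF that] R(2)[OF that] by (simp add: norm_sgn)
    then have "indicator {z. b < norm z} (r *\<^sub>R sgn x) = (0::ennreal)" for x :: 'a
      by (simp add: not_less)
    moreover have "{z::'a. b < norm z} \<in> sets borel" by measurable
    ultimately show ?thesis by (simp add: emeasure_surface_measure)
  qed
  then have "emeasure M {z. b < norm z} = 0" by (subst M) auto
  then have "AE z in M. norm z \<le> b"
    by (intro AE_I[where N="{z. b < norm z}"]) (auto simp: sets)
  then show ?thesis
    by (intro integrable_const_bound[where B="b ^ m"]) (auto simp: power_mono elim!: eventually_mono)
qed

lemma finite_measure_pair_sections:
  assumes "finite_measure M1" "finite_measure M2" and X [measurable]: "X \<in> sets (M1 \<Otimes>\<^sub>M M2)"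
  shows "integrable M1 (\<lambda>x. measure M2 (Pair x -` X))"
    and "measure (M1 \<Otimes>\<^sub>M M2) X = (\<integral>x. measure M2 (Pair x -` X) \<partial>M1)"
proof -
  interpret M1: finite_measure M1 by fact
  interpret M2: finite_measure M2 by fact
  interpret P: pair_sigma_finite M1 M2 ..
  interpret F: finite_measure "M1 \<Otimes>\<^sub>M M2" by (rule finite_measure_pair_measure) fact+
  have i: "integrable (M1 \<Otimes>\<^sub>M M2) (indicator X :: _ \<Rightarrow> real)"
    using X F.emeasure_finite by (intro integrable_real_indicator) (auto simp: less_top[symmetric])
  have s: "(\<integral>y. indicator X (x, y) \<partial>M2) = measure M2 (Pair x -` X)" for x
  proof -
    have "(\<integral>y. indicator X (x, y) \<partial>M2) = (\<integral>y. indicator (Pair x -` X) y \<partial>M2)"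
      by (intro Bochner_Integration.integral_cong) (auto split: split_indicator)
    also have "\<dots> = measure M2 (Pair x -` X \<inter> space M2)" by simp
    also have "Pair x -` X \<inter> space M2 = Pair x -` X"
      using sets.sets_into_space[OF X] by (auto simp: space_pair_measure)
    finally show ?thesis .
  qed
  show "integrable M1 (\<lambda>x. measure M2 (Pair x -` X))"
    using P.integrable_fst'[OF i] unfolding s .
  show "measure (M1 \<Otimes>\<^sub>M M2) X = (\<integral>x. measure M2 (Pair x -` X) \<partial>M1)"
    using P.integral_fst'[OF i] sets.sets_into_space[OF X] unfolding s by (simp add: Int_absorb2)
qed

section \<open>Independence of radius, azimuth and height\<close>

context three_axes
begin

lemma radius_scaleR: "radius (c *\<^sub>R z) = \<bar>c\<bar> * radius z"
proof -
  have "(c * (z \<bullet> e1))\<^sup>2 + (c * (z \<bullet> e2))\<^sup>2 + (c * (z \<bullet> e3))\<^sup>2 = c\<^sup>2 * ((z \<bullet> e1)\<^sup>2 + (z \<bullet> e2)\<^sup>2 + (z \<bullet> e3)\<^sup>2)"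
    by (simp add: power_mult_distrib algebra_simps)
  then show ?thesis by (simp add: radius_def real_sqrt_mult)
qed

lemma azimuth_scaleR: "c \<noteq> 0 \<Longrightarrow> azimuth (c *\<^sub>R z) = azimuth z"
  by (simp add: azimuth_def cos2_scale)

lemma height_scaleR: "0 < c \<Longrightarrow> height (c *\<^sub>R z) = height z"
  by (simp add: height_def radius_scaleR)

lemma radius_le_norm: "radius z \<le> norm z"
proof -
  have "(z \<bullet> e1)\<^sup>2 + (z \<bullet> e2)\<^sup>2 + (z \<bullet> e3)\<^sup>2 = (\<Sum>b\<in>{e1, e2, e3}. (z \<bullet> b)\<^sup>2)"
    using axes by (simp add: ac_simps)
  also have "\<dots> \<le> (\<Sum>b\<in>Basis. (z \<bullet> b)\<^sup>2)"
    using axes by (intro sum_mono2) auto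
  also have "\<dots> = (norm z)\<^sup>2"
    unfolding power2_norm_eq_inner by (subst euclidean_inner) (simp add: power2_eq_square)
  finally show ?thesis unfolding radius_def by (simp add: real_le_lsqrt)
qed

lemma radius_nonneg: "0 \<le> radius z" by (simp add: radius_def)

text \<open>Both kinds of kernel reduce to \<open>nn_integral_axes\<close>. For surface measure,
  projecting \<open>x\<close> to the sphere keeps azimuth and height and turns the radius into
  \<open>r * radius x / norm x\<close>, a function of radius and norm.\<close>

lemma median_kernel_rectangle:
  assumes M: "median_kernel M" and [measurable]: "A \<in> sets borel" "B \<in> sets borel" "D \<in> sets borel"
  shows "emeasure M {z. radius z \<in> A \<and> azimuth z \<in> B \<and> height z \<in> D}
    = emeasure M {z. radius z \<in> A} * (emeasure angle_law B * emeasure height_law D)"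
  using M unfolding median_kernel_def
proof (elim disjE exE conjE)
  fix K :: "'a \<Rightarrow> real" assume K: "function_kernel K" "M = density lborel (\<lambda>x. ennreal (K x))"
  then have [measurable]: "K \<in> borel_measurable borel" and rad: "\<And>x y. norm x = norm y \<Longrightarrow> K x = K y"
    unfolding function_kernel_def by blast+
  \<comment> \<open>Evaluating \<open>K\<close> on a fixed ray writes it as a function of the
    norm.\<close>
  have rad': "K z = K (norm z *\<^sub>R e1)" for z using axes by (intro rad) simp
  have "emeasure M {z. radius z \<in> A \<and> azimuth z \<in> B \<and> height z \<in> D}
    = (\<integral>\<^sup>+z. ennreal (K (norm z *\<^sub>R e1)) * indicator A (radius z) * indicator B (azimuth z) * indicator D (height z) \<partial>lborel)"
    by (auto simp: K(2) emeasure_density rad'[symmetric] intro!: nn_integral_cong split: split_indicator)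
  also have "\<dots> = emeasure angle_law B * emeasure height_law D *
    (\<integral>\<^sup>+z. ennreal (K (norm z *\<^sub>R e1)) * indicator A (radius z) \<partial>lborel)"
    by (rule nn_integral_axes[of "\<lambda>s n. ennreal (K (n *\<^sub>R e1)) * indicator A s"]) auto
  also have "(\<integral>\<^sup>+z. ennreal (K (norm z *\<^sub>R e1)) * indicator A (radius z) \<partial>lborel) = emeasure M {z. radius z \<in> A}"
    by (auto simp: K(2) emeasure_density rad'[symmetric] intro!: nn_integral_cong split: split_indicator)
  finally show ?thesis by (simp add: mult.commute)
next
  assume S: "spherical_kernel M"
  then obtain R c where R: "finite R" "\<And>r. r \<in> R \<Longrightarrow> 0 < r"
    and M: "\<And>A. A \<in> sets borel \<Longrightarrow> emeasure M A = (\<Sum>r\<in>R. ennreal (c r) * emeasure (surface_measure r) A)"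
    by (rule spherical_kernelE) blast
  have "emeasure (surface_measure r) {z. radius z \<in> A \<and> azimuth z \<in> B \<and> height z \<in> D}
    = emeasure (surface_measure r) {z. radius z \<in> A} * (emeasure angle_law B * emeasure height_law D)"
    if "r \<in> R" for r
  proof -
    have r: "r > 0" using R(2)[OF that] by simp
    have *: "radius (r *\<^sub>R sgn x) = r * radius x / norm x" "azimuth (r *\<^sub>R sgn x) = azimuth x"
      "height (r *\<^sub>R sgn x) = height x" for x
    proof -
      have "radius (r *\<^sub>R sgn x) = r * radius x / norm x \<and> azimuth (r *\<^sub>R sgn x) = azimuth x
        \<and> height (r *\<^sub>R sgn x) = height x"
      proof (cases "x = 0")
        case False
        then have "0 < r / norm x" "r *\<^sub>R sgn x = (r / norm x) *\<^sub>R x"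
          using r by (simp_all add: sgn_div_norm divide_inverse)
        then show ?thesis
          using r by (simp only: radius_scaleR azimuth_scaleR height_scaleR) simp
      qed (simp add: radius_def)
      then show "radius (r *\<^sub>R sgn x) = r * radius x / norm x" "azimuth (r *\<^sub>R sgn x) = azimuth x"
        "height (r *\<^sub>R sgn x) = height x" by auto
    qed
    have m: "{z. radius z \<in> A} \<in> sets borel" "{z. radius z \<in> A \<and> azimuth z \<in> B \<and> height z \<in> D} \<in> sets borel"
      by measurable
    have "(\<integral>\<^sup>+x. indicator {..<1} (norm x) * indicator {z. radius z \<in> A \<and> azimuth z \<in> B \<and> height z \<in> D} (r *\<^sub>R sgn x) \<partial>lborel)
      = (\<integral>\<^sup>+x. (indicator {..<1} (norm x) * indicator A (r * radius x / norm x)) * indicator B (azimuth x) * indicator D (height x) \<partial>lborel)"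
      by (intro nn_integral_cong) (auto simp: * split: split_indicator)
    also have "\<dots> = emeasure angle_law B * emeasure height_law D *
      (\<integral>\<^sup>+x. indicator {..<1} (norm x) * indicator A (r * radius x / norm x) \<partial>lborel)"
      by (rule nn_integral_axes[of "\<lambda>s n. indicator {..<1} n * indicator A (r * s / n)"]) auto
    also have "(\<integral>\<^sup>+x. indicator {..<1} (norm x) * indicator A (r * radius x / norm x) \<partial>lborel)
      = (\<integral>\<^sup>+x. indicator {..<1} (norm x) * indicator {z. radius z \<in> A} (r *\<^sub>R sgn x) \<partial>lborel)"
      by (intro nn_integral_cong) (auto simp: * split: split_indicator)
    finally show ?thesis by (simp add: emeasure_surface_measure m ac_simps)
  qed
  moreover have "{z. radius z \<in> A} \<in> sets borel" "{z. radius z \<in> A \<and> azimuth z \<in> B \<and> height z \<in> D} \<in> sets borel"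
    by measurable
  ultimately show ?thesis
    by (simp add: M sum_distrib_right mult.assoc)
qed

text \<open>A product of two measures is determined by rectangles. With three factors this is
  applied twice: to azimuth and height over a fixed set of radii, then to the radius against that
  pair.\<close>

lemma median_kernel_coordinates_law:
  assumes "median_kernel M"
  shows "distr M (borel \<Otimes>\<^sub>M borel \<Otimes>\<^sub>M borel) (\<lambda>z. (radius z, azimuth z, height z))
    = distr M borel radius \<Otimes>\<^sub>M (angle_law \<Otimes>\<^sub>M height_law)"
proof -
  have sets[measurable_cong]: "sets M = sets borel" using assms by (rule sets_median_kernel)
  have sp[simp]: "space M = UNIV" using sets_eq_imp_space_eq[OF sets] by simp
  interpret M: finite_measure M
    using assms by (rule finite_measure_median_kernel)
  interpret R: finite_measure "distr M borel radius"
    by (rule M.finite_measure_distr) measurable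
  interpret AH: finite_measure "angle_law \<Otimes>\<^sub>M height_law"
    by (rule finite_measure_pair_measure) unfold_locales
  have rect: "emeasure M {z. radius z \<in> A \<and> (azimuth z, height z) \<in> X}
      = emeasure M {z. radius z \<in> A} * emeasure (angle_law \<Otimes>\<^sub>M height_law) X"
    if [measurable]: "A \<in> sets borel" and X: "X \<in> sets (borel \<Otimes>\<^sub>M borel)" for A X
  proof (cases "emeasure M {z. radius z \<in> A} = 0")
    case True
    have "emeasure M {z. radius z \<in> A \<and> (azimuth z, height z) \<in> X} \<le> emeasure M {z. radius z \<in> A}"
      by (rule emeasure_mono) (auto simp: sets)
    then show ?thesis using True by simp
  next
    case False
    define c where "c = emeasure M {z. radius z \<in> A}"
    have c: "c \<noteq> 0" "c \<noteq> \<infinity>" using False by (auto simp: c_def)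
    \<comment> \<open>The conditional law of azimuth and height, given that the radius lies in
      \<open>A\<close>.\<close>
    define N where "N = scale_measure (1 / c)
      (distr (density M (\<lambda>z. indicator A (radius z))) (borel \<Otimes>\<^sub>M borel) (\<lambda>z. (azimuth z, height z)))"
    have N: "emeasure N Y = emeasure M {z. radius z \<in> A \<and> (azimuth z, height z) \<in> Y} / c"
      if [measurable]: "Y \<in> sets (borel \<Otimes>\<^sub>M borel)" for Y
    proof -
      have "emeasure (distr (density M (\<lambda>z. indicator A (radius z))) (borel \<Otimes>\<^sub>M borel) (\<lambda>z. (azimuth z, height z))) Y
        = (\<integral>\<^sup>+y. indicator Y y \<partial>distr (density M (\<lambda>z. indicator A (radius z))) (borel \<Otimes>\<^sub>M borel) (\<lambda>z. (azimuth z, height z)))"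
        by simp
      also have "\<dots> = (\<integral>\<^sup>+z. indicator A (radius z) * indicator Y (azimuth z, height z) \<partial>M)"
        by (simp add: nn_integral_distr nn_integral_density del: nn_integral_indicator)
      also have "\<dots> = (\<integral>\<^sup>+z. indicator {z. radius z \<in> A \<and> (azimuth z, height z) \<in> Y} z \<partial>M)"
        by (intro nn_integral_cong) (auto split: split_indicator)
      also have "\<dots> = emeasure M {z. radius z \<in> A \<and> (azimuth z, height z) \<in> Y}"
        by (rule nn_integral_indicator) measurable
      finally show ?thesis by (simp add: N_def divide_ennreal_def mult.commute)
    qed
    have "angle_law \<Otimes>\<^sub>M height_law = N"
    proof (rule pair_measure_eqI)
      fix B D assume BD: "B \<in> sets angle_law" "D \<in> sets height_law"
      then have "B \<times> D \<in> sets (borel \<Otimes>\<^sub>M borel)" by simp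
      then have "emeasure N (B \<times> D) = emeasure M {z. radius z \<in> A \<and> azimuth z \<in> B \<and> height z \<in> D} / c"
        by (subst N) auto
      also have "\<dots> = (emeasure angle_law B * emeasure height_law D) * c / c"
        using BD by (subst median_kernel_rectangle[OF assms]) (auto simp: c_def mult.commute)
      also have "\<dots> = emeasure angle_law B * emeasure height_law D"
        using c by (simp add: ennreal_mult_divide_eq)
      finally show "emeasure angle_law B * emeasure height_law D = emeasure N (B \<times> D)" by simp
    qed (unfold_locales, simp add: N_def cong: sets_pair_measure_cong)
    then have "emeasure (angle_law \<Otimes>\<^sub>M height_law) X = emeasure M {z. radius z \<in> A \<and> (azimuth z, height z) \<in> X} / c"
      using N[OF X] by simp
    then show ?thesis
      using c ennreal_mult_divide_eq[of c "emeasure M {z. radius z \<in> A \<and> (azimuth z, height z) \<in> X}"]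
      by (simp add: c_def[symmetric] ennreal_times_divide mult.commute)
  qed
  show ?thesis
  proof (rule pair_measure_eqI[symmetric])
    fix A X assume A: "A \<in> sets (distr M borel radius)" and X: "X \<in> sets (angle_law \<Otimes>\<^sub>M height_law)"
    have "sets (angle_law \<Otimes>\<^sub>M height_law) = sets (borel \<Otimes>\<^sub>M borel)" by (intro sets_pair_measure_cong) auto
    with X have X': "X \<in> sets (borel \<Otimes>\<^sub>M borel)" by simp
    have "emeasure (distr M (borel \<Otimes>\<^sub>M borel \<Otimes>\<^sub>M borel) (\<lambda>z. (radius z, azimuth z, height z))) (A \<times> X)
      = emeasure M {z. radius z \<in> A \<and> (azimuth z, height z) \<in> X}"
      using A X' by (subst emeasure_distr) (auto intro!: arg_cong2[where f=emeasure])
    also have "\<dots> = emeasure (distr M borel radius) A * emeasure (angle_law \<Otimes>\<^sub>M height_law) X"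
      using A X' by (subst rect) (auto simp: emeasure_distr vimage_def)
    finally show "emeasure (distr M borel radius) A * emeasure (angle_law \<Otimes>\<^sub>M height_law) X
      = emeasure (distr M (borel \<Otimes>\<^sub>M borel \<Otimes>\<^sub>M borel) (\<lambda>z. (radius z, azimuth z, height z))) (A \<times> X)" ..
  qed (unfold_locales, simp cong: sets_pair_measure_cong)
qed

lemma median_kernel_measure_sections:
  assumes M: "median_kernel M" and X [measurable]: "X \<in> sets (borel \<Otimes>\<^sub>M borel \<Otimes>\<^sub>M borel)"
  shows "integrable angle_law (\<lambda>c. measure height_law {v. (\<rho>, c, v) \<in> X})"
    and "integrable M (\<lambda>z. \<integral>c. measure height_law {v. (radius z, c, v) \<in> X} \<partial>angle_law)"
    and "measure M {z. (radius z, azimuth z, height z) \<in> X} =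
      (\<integral>z. (\<integral>c. measure height_law {v. (radius z, c, v) \<in> X} \<partial>angle_law) \<partial>M)"
proof -
  have sets[measurable_cong]: "sets M = sets borel" using M by (rule sets_median_kernel)
  have sp[simp]: "space M = UNIV" using sets_eq_imp_space_eq[OF sets] by simp
  interpret M: finite_measure M
    using M by (rule finite_measure_median_kernel)
  have R: "finite_measure (distr M borel radius)"
    by (rule M.finite_measure_distr) measurable
  have AH: "finite_measure (angle_law \<Otimes>\<^sub>M height_law)"
    by (rule finite_measure_pair_measure) unfold_locales
  have X': "X \<in> sets (distr M borel radius \<Otimes>\<^sub>M (angle_law \<Otimes>\<^sub>M height_law))"
    using X by (simp cong: sets_pair_measure_cong)
  have Xr: "Pair \<rho> -` X \<in> sets (angle_law \<Otimes>\<^sub>M height_law)" for \<rho>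
    using X' by (rule sets_Pair1)
  have s: "measure (angle_law \<Otimes>\<^sub>M height_law) (Pair \<rho> -` X) =
      (\<integral>c. measure height_law {v. (\<rho>, c, v) \<in> X} \<partial>angle_law)"
    "integrable angle_law (\<lambda>c. measure height_law {v. (\<rho>, c, v) \<in> X})" for \<rho>
    using finite_measure_pair_sections[OF _ _ Xr[of \<rho>]] angle_law.finite_measure_axioms height_law.finite_measure_axioms
    by (simp_all add: vimage_def)
  show "integrable angle_law (\<lambda>c. measure height_law {v. (\<rho>, c, v) \<in> X})" by (rule s)
  note P = finite_measure_pair_sections[OF R AH X', unfolded s(1)]
  have m: "(\<lambda>\<rho>. \<integral>c. measure height_law {v. (\<rho>, c, v) \<in> X} \<partial>angle_law) \<in> borel_measurable borel"
    using borel_measurable_integrable[OF P(1)] by simp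
  show "integrable M (\<lambda>z. \<integral>c. measure height_law {v. (radius z, c, v) \<in> X} \<partial>angle_law)"
    using P(1) m by (subst (asm) integrable_distr_eq) auto
  have "measure M {z. (radius z, azimuth z, height z) \<in> X} =
    measure (distr M (borel \<Otimes>\<^sub>M borel \<Otimes>\<^sub>M borel) (\<lambda>z. (radius z, azimuth z, height z))) X"
    using X by (subst measure_distr) (auto simp: vimage_def)
  also have "\<dots> = (\<integral>\<rho>. (\<integral>c. measure height_law {v. (\<rho>, c, v) \<in> X} \<partial>angle_law) \<partial>distr M borel radius)"
    unfolding median_kernel_coordinates_law[OF M] by (rule P(2))
  also have "\<dots> = (\<integral>z. (\<integral>c. measure height_law {v. (radius z, c, v) \<in> X} \<partial>angle_law) \<partial>M)"
    using m by (subst integral_distr) auto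
  finally show "measure M {z. (radius z, azimuth z, height z) \<in> X} =
      (\<integral>z. (\<integral>c. measure height_law {v. (radius z, c, v) \<in> X} \<partial>angle_law) \<partial>M)" .
qed

text \<open>Where the radius vanishes, the height is 0 by the convention for division by zero, and
  the uniform height law has no atom at 0.\<close>

lemma AE_median_kernel_radius_pos:
  assumes M: "median_kernel M"
  shows "AE z in M. 0 < radius z"
proof -
  have sets: "sets M = sets borel" using M by (rule sets_median_kernel)
  have "emeasure M {z. height z \<in> {0}} = 0"
    using median_kernel_rectangle[OF M, of UNIV UNIV "{0}"]
    by (simp add: emeasure_height_law)
  moreover have "{z. height z \<in> {0}} \<in> sets borel" by measurable
  ultimately show ?thesis
    using radius_nonneg
    by (intro AE_I[where N="{z. height z \<in> {0}}"]) (auto simp: height_def sets not_less intro: order.antisym)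
qed

end

section \<open>The Angenent oval\<close>

lemma has_derivative_sinh_real [derivative_intros]:
  "(g has_derivative g') (at x within s) \<Longrightarrow>
    ((\<lambda>x. sinh (g x) :: real) has_derivative (\<lambda>h. g' h * cosh (g x))) (at x within s)"
  by (rule DERIV_compose_FDERIV) (auto intro!: derivative_eq_intros)

lemma has_derivative_cosh_real [derivative_intros]:
  "(g has_derivative g') (at x within s) \<Longrightarrow>
    ((\<lambda>x. cosh (g x) :: real) has_derivative (\<lambda>h. g' h * sinh (g x))) (at x within s)"
  by (rule DERIV_compose_FDERIV) (auto intro!: derivative_eq_intros)

text \<open>An algebra of functions that contains \<open>oval\<close> and is closed under
  directional derivatives: the derivative of \<open>tanh\<close> is the square of
  \<open>1 / cosh\<close>, and that of \<open>1 / cosh\<close> is \<open>- tanh / cosh\<close>.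
  Closure gives smoothness by induction on the order.\<close>

inductive trig_hyperbolic :: "('a::euclidean_space \<Rightarrow> real) \<Rightarrow> bool" where
  const: "trig_hyperbolic (\<lambda>_. c)"
| sin: "trig_hyperbolic (\<lambda>z. sin (z \<bullet> u))"
| cos: "trig_hyperbolic (\<lambda>z. cos (z \<bullet> u))"
| tanh: "trig_hyperbolic (\<lambda>z. tanh (z \<bullet> u))"
| sech: "trig_hyperbolic (\<lambda>z. inverse (cosh (z \<bullet> u)))"
| add: "trig_hyperbolic f \<Longrightarrow> trig_hyperbolic g \<Longrightarrow> trig_hyperbolic (\<lambda>z. f z + g z)"
| mult: "trig_hyperbolic f \<Longrightarrow> trig_hyperbolic g \<Longrightarrow> trig_hyperbolic (\<lambda>z. f z * g z)"

lemma trig_hyperbolic_cmult: "trig_hyperbolic f \<Longrightarrow> trig_hyperbolic (\<lambda>z. c * f z)"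
  by (rule trig_hyperbolic.mult[OF trig_hyperbolic.const])

lemma trig_hyperbolic_derivative:
  assumes "trig_hyperbolic f"
  shows "\<exists>f'. (\<forall>x. (f has_derivative f' x) (at x)) \<and> (\<forall>h. trig_hyperbolic (\<lambda>x. f' x h))"
  using assms
proof (induction rule: trig_hyperbolic.induct)
  case (const c)
  show ?case
    by (rule exI[of _ "\<lambda>x h. 0"]) (auto intro: trig_hyperbolic.intros derivative_eq_intros)
next
  case (sin u)
  show ?case
    by (rule exI[of _ "\<lambda>x h. (h \<bullet> u) * cos (x \<bullet> u)"])
       (auto intro!: trig_hyperbolic_cmult trig_hyperbolic.cos derivative_eq_intros)
next
  case (cos u)
  show ?case
    by (rule exI[of _ "\<lambda>x h. - (h \<bullet> u) * sin (x \<bullet> u)"])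
       (auto intro!: trig_hyperbolic_cmult[of _ "- (_ \<bullet> u)", simplified] trig_hyperbolic.sin derivative_eq_intros)
next
  case (tanh u)
  have "((\<lambda>z. tanh (z \<bullet> u)) has_derivative (\<lambda>h. (h \<bullet> u) * (inverse (cosh (x \<bullet> u)) * inverse (cosh (x \<bullet> u))))) (at x)" for x
  proof -
    have "1 - (tanh (x \<bullet> u))\<^sup>2 = inverse (cosh (x \<bullet> u)) * inverse (cosh (x \<bullet> u))"
    proof -
      have "1 - (tanh (x \<bullet> u))\<^sup>2 = ((cosh (x \<bullet> u))\<^sup>2 - (sinh (x \<bullet> u))\<^sup>2) / (cosh (x \<bullet> u))\<^sup>2"
        by (simp add: tanh_def power_divide diff_divide_distrib)
      then show ?thesis
        unfolding hyperbolic_pythagoras by (simp add: power2_eq_square divide_inverse)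
    qed
    then have "(tanh has_field_derivative inverse (cosh (x \<bullet> u)) * inverse (cosh (x \<bullet> u))) (at (x \<bullet> u))"
      by (auto intro!: derivative_eq_intros)
    then show ?thesis
      by (rule DERIV_compose_FDERIV) (auto intro!: derivative_eq_intros)
  qed
  then show ?case
    by (intro exI[of _ "\<lambda>x h. (h \<bullet> u) * (inverse (cosh (x \<bullet> u)) * inverse (cosh (x \<bullet> u)))"])
       (auto intro!: trig_hyperbolic_cmult trig_hyperbolic.mult trig_hyperbolic.sech)
next
  case (sech u)
  have "((\<lambda>z. inverse (cosh (z \<bullet> u))) has_derivative (\<lambda>h. - (h \<bullet> u) * (tanh (x \<bullet> u) * inverse (cosh (x \<bullet> u))))) (at x)" for x
    by (auto intro!: derivative_eq_intros simp: tanh_def field_simps)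
  moreover have "trig_hyperbolic (\<lambda>x. - (h \<bullet> u) * (tanh (x \<bullet> u) * inverse (cosh (x \<bullet> u))))" for h
    by (rule trig_hyperbolic_cmult, rule trig_hyperbolic.mult, rule trig_hyperbolic.tanh, rule trig_hyperbolic.sech)
  ultimately show ?case
    by (intro exI[of _ "\<lambda>x h. - (h \<bullet> u) * (tanh (x \<bullet> u) * inverse (cosh (x \<bullet> u)))"] conjI allI)
next
  case (add f g)
  then obtain f' g' where "\<And>x. (f has_derivative f' x) (at x)" "\<And>h. trig_hyperbolic (\<lambda>x. f' x h)"
    "\<And>x. (g has_derivative g' x) (at x)" "\<And>h. trig_hyperbolic (\<lambda>x. g' x h)" by blast
  then show ?case
    by (intro exI[of _ "\<lambda>x h. f' x h + g' x h"]) (auto intro: has_derivative_add trig_hyperbolic.add)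
next
  case (mult f g)
  then obtain f' g' where "\<And>x. (f has_derivative f' x) (at x)" "\<And>h. trig_hyperbolic (\<lambda>x. f' x h)"
    "\<And>x. (g has_derivative g' x) (at x)" "\<And>h. trig_hyperbolic (\<lambda>x. g' x h)" by blast
  then show ?case using mult.hyps
    by (intro exI[of _ "\<lambda>x h. f x * g' x h + f' x h * g x"])
       (auto intro!: has_derivative_mult trig_hyperbolic.add trig_hyperbolic.mult)
qed

lemma trig_hyperbolic_C_k: "trig_hyperbolic f \<Longrightarrow> C_k n f"
proof (induction n arbitrary: f)
  case 0
  from trig_hyperbolic_derivative[OF 0] obtain f' where "\<forall>x. (f has_derivative f' x) (at x)"
    by (elim exE conjE)
  then have "isCont f x" for x by (blast intro: has_derivative_continuous)
  then show ?case by (simp add: continuous_at_imp_continuous_on)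
next
  case (Suc n)
  from trig_hyperbolic_derivative[OF Suc.prems] obtain f'
    where f': "\<forall>x. (f has_derivative f' x) (at x)" "\<forall>h. trig_hyperbolic (\<lambda>x. f' x h)"
    by (elim exE conjE)
  have "frechet_derivative f (at x) = f' x" for x
    using f'(1) by (intro frechet_derivative_at[symmetric]) blast
  moreover have "f differentiable (at x)" for x
    using f'(1) by (blast intro: differentiableI)
  ultimately show ?case using Suc.IH f'(2) by simp
qed

lemma trig_hyperbolic_smooth: "trig_hyperbolic f \<Longrightarrow> smooth f"
  by (simp add: smooth_def trig_hyperbolic_C_k)

section \<open>The mean curvature operator on the oval\<close>

lemma grad_eqI:
  assumes "GDERIV f x :> D"
  shows "grad f x = D"
  unfolding grad_def
proof (rule the_equality[where P="\<lambda>D. GDERIV f x :> D", OF assms])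
  fix E assume "GDERIV f x :> E"
  with assms have "(\<lambda>h. h \<bullet> E) = (\<lambda>h. h \<bullet> D)"
    unfolding gderiv_def by (rule has_derivative_unique[rotated])
  then show "E = D" by (metis vector_eq_ldot inner_commute)
qed

lemma grad_cong_open:
  assumes "open S" "x \<in> S" "\<And>y. y \<in> S \<Longrightarrow> f y = g y"
  shows "grad f x = grad g x"
proof -
  have "GDERIV f x :> D \<longleftrightarrow> GDERIV g x :> D" for D
    unfolding gderiv_def
    using has_derivative_transform_within_open[OF _ assms(1,2), of f _ UNIV g]
      has_derivative_transform_within_open[OF _ assms(1,2), of g _ UNIV f] assms(3) by fastforce
  then show ?thesis by (simp add: grad_def)
qed

lemma divergence_has_derivative:
  "(V has_derivative V') (at x) \<Longrightarrow> divergence V x = (\<Sum>b\<in>Basis. V' b \<bullet> b)"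
  by (simp add: divergence_def frechet_derivative_at[symmetric])

context three_axes
begin

definition oval :: "'a \<Rightarrow> real" where
  "oval z = cos (z \<bullet> e2) / cosh (z \<bullet> e3)"

text \<open>This is \<open>cosh (z \<bullet> e3) ^ 4\<close> times the squared norm of the gradient
  (see \<open>norm_grad_oval\<close>), so it vanishes exactly at the critical points of
  \<open>oval\<close>.\<close>

definition oval_gap :: "'a \<Rightarrow> real" where
  "oval_gap z = (cosh (z \<bullet> e3))\<^sup>2 - (cos (z \<bullet> e2))\<^sup>2"

definition oval_normal :: "'a \<Rightarrow> 'a" where
  "oval_normal z = (- sin (z \<bullet> e2) * cosh (z \<bullet> e3) / sqrt (oval_gap z)) *\<^sub>R e2
     + (- cos (z \<bullet> e2) * sinh (z \<bullet> e3) / sqrt (oval_gap z)) *\<^sub>R e3"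

lemma axes_inner: "e2 \<bullet> e3 = 0" "e3 \<bullet> e2 = 0" "e2 \<bullet> e2 = 1" "e3 \<bullet> e3 = 1"
  using axes by (simp_all add: inner_Basis)

lemma oval_smooth: "smooth oval"
proof -
  have "trig_hyperbolic (\<lambda>z. cos (z \<bullet> e2) * inverse (cosh (z \<bullet> e3)))"
    by (intro trig_hyperbolic.intros)
  then show ?thesis
    using trig_hyperbolic_smooth by (simp add: oval_def[abs_def] divide_inverse)
qed

lemma abs_oval_le: "\<bar>oval z\<bar> \<le> 1"
proof -
  have "\<bar>cos (z \<bullet> e2)\<bar> \<le> cosh (z \<bullet> e3)"
    using cosh_real_ge_1[of "z \<bullet> e3"] abs_cos_le_one[of "z \<bullet> e2"] by linarith
  then show ?thesis by (simp add: oval_def abs_divide divide_le_eq_1)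
qed

lemma oval_bounded: "bounded (range oval)"
  using abs_oval_le by (auto simp: bounded_iff)

lemma oval_gderiv:
  "GDERIV oval z :> (- sin (z \<bullet> e2) / cosh (z \<bullet> e3)) *\<^sub>R e2
     + (- cos (z \<bullet> e2) * sinh (z \<bullet> e3) / (cosh (z \<bullet> e3))\<^sup>2) *\<^sub>R e3"
  unfolding gderiv_def oval_def[abs_def]
  by (auto intro!: derivative_eq_intros simp: inner_add_right inner_diff_right fun_eq_iff power2_eq_square field_simps)

lemma oval_gap_alt: "oval_gap z = (sin (z \<bullet> e2))\<^sup>2 + (sinh (z \<bullet> e3))\<^sup>2"
  using cosh_square_eq[of "z \<bullet> e3"] sin_cos_squared_add[of "z \<bullet> e2"] unfolding oval_gap_def by linarith

lemma norm_grad_oval: "norm (grad oval z) = sqrt (oval_gap z) / (cosh (z \<bullet> e3))\<^sup>2"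
proof -
  let ?C = "cosh (z \<bullet> e3)"
  have "(norm (grad oval z))\<^sup>2 = (sin (z \<bullet> e2) / ?C)\<^sup>2 + (cos (z \<bullet> e2) * sinh (z \<bullet> e3) / ?C\<^sup>2)\<^sup>2"
    unfolding grad_eqI[OF oval_gderiv] power2_norm_eq_inner
    by (simp add: inner_add_left inner_add_right inner_diff_left inner_diff_right axes_inner power2_eq_square)
  also have "\<dots> = ((sin (z \<bullet> e2))\<^sup>2 * ?C\<^sup>2 + (cos (z \<bullet> e2))\<^sup>2 * (sinh (z \<bullet> e3))\<^sup>2) / (?C\<^sup>2)\<^sup>2"
  proof -
    have "(a / c)\<^sup>2 + (b / c\<^sup>2)\<^sup>2 = (a\<^sup>2 * c\<^sup>2 + b\<^sup>2) / (c\<^sup>2)\<^sup>2" if "c \<noteq> 0" for a b c :: real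
      using that by (simp add: field_simps)
    from this[of ?C] show ?thesis by (simp add: power_mult_distrib)
  qed
  also have "(sin (z \<bullet> e2))\<^sup>2 * ?C\<^sup>2 + (cos (z \<bullet> e2))\<^sup>2 * (sinh (z \<bullet> e3))\<^sup>2 = oval_gap z"
    unfolding oval_gap_def sin_squared_eq sinh_square_eq by (simp add: algebra_simps)
  finally have "norm (grad oval z) = sqrt (oval_gap z / (?C\<^sup>2)\<^sup>2)"
    by (metis norm_ge_zero real_sqrt_unique)
  then show ?thesis unfolding real_sqrt_divide real_sqrt_abs by simp
qed

lemma oval_normal: "grad oval z /\<^sub>R norm (grad oval z) = oval_normal z"
proof -
  have "grad oval z /\<^sub>R norm (grad oval z) =
    (- sin (z \<bullet> e2) / cosh (z \<bullet> e3) / (sqrt (oval_gap z) / (cosh (z \<bullet> e3))\<^sup>2)) *\<^sub>R e2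
     + (- cos (z \<bullet> e2) * sinh (z \<bullet> e3) / (cosh (z \<bullet> e3))\<^sup>2 / (sqrt (oval_gap z) / (cosh (z \<bullet> e3))\<^sup>2)) *\<^sub>R e3"
    unfolding norm_grad_oval unfolding grad_eqI[OF oval_gderiv]
    by (simp add: scaleR_add_right scaleR_diff_right divide_inverse mult.commute)
  also have "\<dots> = oval_normal z"
    unfolding oval_normal_def by (simp add: power2_eq_square)
  finally show ?thesis .
qed

text \<open>By the quotient rule the two numerators together contribute
  \<open>- 2 * cos y * cosh t / d\<close>, and the derivative of the denominator \<open>d\<close>
  gives back \<open>cos y * cosh t / d\<close>.\<close>

lemma divergence_oval_normal_ex:
  assumes "0 < oval_gap z"
  shows "\<exists>V'. (oval_normal has_derivative V') (at z) \<and>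
    (\<Sum>b\<in>Basis. V' b \<bullet> b) = - cos (z \<bullet> e2) * cosh (z \<bullet> e3) / sqrt (oval_gap z)"
proof -
  define y t where "y = z \<bullet> e2" and "t = z \<bullet> e3"
  define d where "d = sqrt (oval_gap z)"
  have d: "d > 0" "d * d = oval_gap z" using assms by (simp_all add: d_def)
  have dd: "((\<lambda>z. sqrt (oval_gap z)) has_derivative
      (\<lambda>h. (cosh t * sinh t * (h \<bullet> e3) + cos y * sin y * (h \<bullet> e2)) / d)) (at z)"
    using assms unfolding oval_gap_def[abs_def] y_def t_def d_def
    by (auto intro!: derivative_eq_intros simp: field_simps)
  define d' where "d' = (\<lambda>h. (cosh t * sinh t * (h \<bullet> e3) + cos y * sin y * (h \<bullet> e2)) / d)"
  define p' where "p' = (\<lambda>h. ((- cos y * (h \<bullet> e2) * cosh t - sin y * sinh t * (h \<bullet> e3)) * d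
    + sin y * cosh t * d' h) / (d * d))"
  define q' where "q' = (\<lambda>h. ((sin y * (h \<bullet> e2) * sinh t - cos y * cosh t * (h \<bullet> e3)) * d
    + cos y * sinh t * d' h) / (d * d))"
  note dd = dd[folded d'_def]
  have p: "((\<lambda>z. - sin (z \<bullet> e2) * cosh (z \<bullet> e3) / sqrt (oval_gap z)) has_derivative p') (at z)"
  proof (rule has_derivative_eq_rhs[OF has_derivative_divide'[OF _ dd]])
    show "((\<lambda>z. - sin (z \<bullet> e2) * cosh (z \<bullet> e3)) has_derivative
        (\<lambda>h. - cos y * (h \<bullet> e2) * cosh t - sin y * sinh t * (h \<bullet> e3))) (at z)"
      by (auto intro!: derivative_eq_intros simp: y_def t_def fun_eq_iff)
  qed (use d(1) in \<open>auto simp: p'_def y_def t_def d_def\<close>)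
  have q: "((\<lambda>z. - cos (z \<bullet> e2) * sinh (z \<bullet> e3) / sqrt (oval_gap z)) has_derivative q') (at z)"
  proof (rule has_derivative_eq_rhs[OF has_derivative_divide'[OF _ dd]])
    show "((\<lambda>z. - cos (z \<bullet> e2) * sinh (z \<bullet> e3)) has_derivative
        (\<lambda>h. sin y * (h \<bullet> e2) * sinh t - cos y * cosh t * (h \<bullet> e3))) (at z)"
      by (auto intro!: derivative_eq_intros simp: y_def t_def fun_eq_iff)
  qed (use d(1) in \<open>auto simp: q'_def y_def t_def d_def\<close>)
  define V' where "V' = (\<lambda>h. p' h *\<^sub>R e2 + q' h *\<^sub>R e3)"
  have V: "(oval_normal has_derivative V') (at z)"
    unfolding oval_normal_def[abs_def] V'_def
    by (intro has_derivative_add has_derivative_scaleR_left p q)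
  have "(\<Sum>b\<in>Basis. V' b \<bullet> b) = (\<Sum>b\<in>Basis. p' b * (e2 \<bullet> b) + q' b * (e3 \<bullet> b))"
    by (simp add: V'_def inner_add_left)
  also have "\<dots> = p' e2 + q' e3"
    using axes by (simp add: sum.distrib inner_Basis if_distrib[of "\<lambda>x. _ * x"] sum.delta' cong: if_cong)
  also have "\<dots> = (- 2 * cos y * cosh t * (d * d) + cos y * cosh t * ((sin y)\<^sup>2 + (sinh t)\<^sup>2)) / (d * d * d)"
  proof -
    have "p' e2 + q' e3 = ((- (cos y * cosh t)) * d + sin y * cosh t * (cos y * sin y) / d) / (d * d)
        + ((- (cos y * cosh t)) * d + cos y * sinh t * (cosh t * sinh t) / d) / (d * d)"
      by (simp add: p'_def q'_def d'_def axes_inner)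
    also have "\<dots> = (2 * (- (cos y * cosh t)) * (d * d) + (sin y * cosh t * (cos y * sin y) + cos y * sinh t * (cosh t * sinh t))) / (d * d * d)"
    proof -
      have "(a * d + b / d) / (d * d) + (a * d + c / d) / (d * d) = (2 * a * (d * d) + (b + c)) / (d * d * d)" for a b c
        using d(1) by (simp add: field_simps)
      then show ?thesis .
    qed
    finally show ?thesis by (simp add: power2_eq_square algebra_simps)
  qed
  \<comment> \<open>The sum of squares in the numerator is \<open>oval_gap z\<close>, that is
    \<open>d * d\<close>, by \<open>oval_gap_alt\<close>.\<close>
  also have "\<dots> = (- cos y * cosh t * (d * d)) / (d * d * d)"
    unfolding d(2) oval_gap_alt y_def t_def by (simp add: algebra_simps)
  also have "\<dots> = - cos y * cosh t / d"
    using d(1) by simp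
  finally show ?thesis using V by (auto simp: y_def t_def d_def)
qed

text \<open>A positive factor leaves the unit normal unchanged and multiplies the norm of the
  gradient. Agreement on an open set is what is available:
  \<open>oval + s * mc_operator oval\<close> is a multiple of \<open>oval\<close> only away from the
  critical points, where \<open>mc_operator\<close> returns 0.\<close>

lemma mc_operator_oval_scaled:
  assumes S: "open S" "x \<in> S" "\<And>z. z \<in> S \<Longrightarrow> f z = c * oval z" and c: "0 < c"
    and x: "0 < oval_gap x"
  shows "mc_operator f x = - c * oval x"
proof -
  have g: "grad f z = c *\<^sub>R grad oval z" if "z \<in> S" for z
  proof -
    have "GDERIV (\<lambda>z. c * oval z) z :> c *\<^sub>R grad oval z"
      using oval_gderiv[of z] unfolding grad_eqI[OF oval_gderiv] gderiv_def
      by (auto dest!: has_derivative_mult_right[of _ _ _ c])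
    then have "grad (\<lambda>z. c * oval z) z = c *\<^sub>R grad oval z" by (rule grad_eqI)
    then show ?thesis using grad_cong_open[OF S(1) that S(3)] by simp
  qed
  have n: "grad f z /\<^sub>R norm (grad f z) = oval_normal z" if "z \<in> S" for z
    using c unfolding g[OF that] oval_normal[symmetric] by simp
  obtain V' where V': "(oval_normal has_derivative V') (at x)"
    "(\<Sum>b\<in>Basis. V' b \<bullet> b) = - cos (x \<bullet> e2) * cosh (x \<bullet> e3) / sqrt (oval_gap x)"
    using divergence_oval_normal_ex[OF x] by blast
  have "((\<lambda>z. grad f z /\<^sub>R norm (grad f z)) has_derivative V') (at x)"
    using V'(1) S(1,2) by (rule has_derivative_transform_within_open) (simp add: n)
  then have "divergence (\<lambda>z. grad f z /\<^sub>R norm (grad f z)) x = - cos (x \<bullet> e2) * cosh (x \<bullet> e3) / sqrt (oval_gap x)"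
    using V'(2) by (simp add: divergence_has_derivative)
  then have "mc_operator f x = c * (sqrt (oval_gap x) / (cosh (x \<bullet> e3))\<^sup>2) * (- cos (x \<bullet> e2) * cosh (x \<bullet> e3) / sqrt (oval_gap x))"
    using c unfolding mc_operator_def g[OF S(2)] by (simp add: norm_grad_oval)
  also have "\<dots> = - c * oval x"
    using x by (simp add: oval_def power2_eq_square)
  finally show ?thesis .
qed

lemma open_oval_gap: "open {z. 0 < oval_gap z}"
  unfolding oval_gap_def by (intro open_Collect_less continuous_intros)

lemma mc_operator_oval: "0 < oval_gap x \<Longrightarrow> mc_operator oval x = - oval x"
  using mc_operator_oval_scaled[of UNIV x oval 1] by simp

lemma deriv_mc_operator_oval:
  assumes x: "0 < oval_gap x"
  shows "deriv (\<lambda>s. mc_operator (\<lambda>y. oval y + s * mc_operator oval y) x) 0 = oval x"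
proof -
  \<comment> \<open>The restriction to \<open>s < 1\<close> keeps the factor \<open>1 - s\<close>
    positive; a neighbourhood of 0 is all that the derivative sees.\<close>
  have "mc_operator (\<lambda>y. oval y + s * mc_operator oval y) x = - (1 - s) * oval x" if "s < 1" for s
  proof (rule mc_operator_oval_scaled[OF open_oval_gap])
    show "oval z + s * mc_operator oval z = (1 - s) * oval z" if "z \<in> {z. 0 < oval_gap z}" for z
      using that by (simp add: mc_operator_oval algebra_simps)
  qed (use that x in auto)
  moreover have "((\<lambda>s. - (1 - s) * oval x) has_field_derivative oval x) (at 0)"
    by (auto intro!: derivative_eq_intros)
  ultimately have "((\<lambda>s. mc_operator (\<lambda>y. oval y + s * mc_operator oval y) x) has_field_derivative oval x) (at 0)"
    by (elim has_field_derivative_transform_within_open[where S="{..<1}"]) auto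
  then show ?thesis by (rule DERIV_imp_deriv)
qed

definition oval_point :: 'a where
  "oval_point = arsinh 1 *\<^sub>R e3"

lemma oval_point_inner: "oval_point \<bullet> e2 = 0" "oval_point \<bullet> e3 = arsinh 1"
  by (simp_all add: oval_point_def axes_inner)

lemma cosh_arsinh_1: "cosh (arsinh 1 :: real) = sqrt 2"
  by (simp add: cosh_arsinh_real)

lemma oval_gap_point: "oval_gap oval_point = 1"
  by (simp add: oval_gap_def oval_point_inner cosh_arsinh_1)

lemma oval_at_point: "oval oval_point = 1 / sqrt 2"
  by (simp add: oval_def oval_point_inner cosh_arsinh_1)

lemma grad_oval_point: "grad oval oval_point \<noteq> 0"
  using norm_grad_oval[of oval_point] by (auto simp: oval_gap_point oval_point_inner cosh_arsinh_1)

lemma consistent_oval: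
  assumes "second_order_consistent S"
  shows "(\<lambda>k. S k oval oval_point - (1 - k + k\<^sup>2 / 2) / sqrt 2) \<in> O[at_right 0](\<lambda>k. k ^ 3)"
proof -
  have "(\<lambda>k. S k oval oval_point - (oval oval_point + k * - oval oval_point + k\<^sup>2 / 2 * oval oval_point)) \<in> O[at_right 0](\<lambda>k. k ^ 3)"
  proof -
    have d: "0 < oval_gap oval_point" by (simp add: oval_gap_point)
    show ?thesis
      using assms[unfolded second_order_consistent_def, rule_format, of oval oval_point]
        oval_smooth oval_bounded grad_oval_point
      unfolding mc_operator_oval[OF d] deriv_mc_operator_oval[OF d] by blast
  qed
  moreover have "oval oval_point + k * - oval oval_point + k\<^sup>2 / 2 * oval oval_point = (1 - k + k\<^sup>2 / 2) / sqrt 2" for k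
    unfolding oval_at_point by (simp add: field_simps)
  ultimately show ?thesis by simp
qed

end

section \<open>Mass of superlevel sets on a sphere\<close>

lemma cos_ge_quadratic: "1 - x\<^sup>2 / 2 \<le> cos (x :: real)"
proof -
  obtain t where "cos x = (\<Sum>m<2. cos_coeff m * x ^ m) + (cos (t + 1 / 2 * real 2 * pi) / fact 2) * x ^ 2"
    using Maclaurin_cos_expansion[of x 2] by blast
  then have "cos x = 1 - cos t * x\<^sup>2 / 2" by (simp add: numeral_2_eq_2 cos_coeff_def)
  moreover have "cos t * x\<^sup>2 \<le> 1 * x\<^sup>2" by (intro mult_right_mono) auto
  ultimately show ?thesis by simp
qed

lemma cos_le_quartic: "cos (x :: real) \<le> 1 - x\<^sup>2 / 2 + x ^ 4 / 24"
proof -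
  obtain t where "cos x = (\<Sum>m<4. cos_coeff m * x ^ m) + (cos (t + 1 / 2 * real 4 * pi) / fact 4) * x ^ 4"
    using Maclaurin_cos_expansion[of x 4] by blast
  moreover have "(\<Sum>m<4. cos_coeff m * x ^ m) = 1 - x\<^sup>2 / 2"
  proof -
    have "{..<4} = {0, 1, 2, 3 :: nat}" by auto
    then show ?thesis by (simp add: cos_coeff_def)
  qed
  moreover have "cos (t + 1 / 2 * real 4 * pi) / fact 4 = cos t / 24"
  proof -
    have "fact 4 = (24 :: real)" by (simp add: fact_numeral)
    then show ?thesis using cos_periodic[of t] by (simp add: mult.commute)
  qed
  ultimately have "cos x = 1 - x\<^sup>2 / 2 + cos t / 24 * x ^ 4" by (simp only:)
  moreover have "cos t * x ^ 4 \<le> 1 * x ^ 4" by (intro mult_right_mono) auto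
  ultimately show ?thesis by simp
qed

lemma sinh_ge_self: "0 \<le> x \<Longrightarrow> x \<le> sinh (x :: real)"
proof -
  assume "0 \<le> x"
  have "(\<lambda>x. sinh x - x) 0 \<le> (\<lambda>x. sinh x - x) x"
  proof (rule DERIV_nonneg_imp_nondecreasing[OF \<open>0 \<le> x\<close>])
    fix y :: real
    show "\<exists>d. DERIV (\<lambda>x. sinh x - x) y :> d \<and> 0 \<le> d"
      by (rule exI[of _ "cosh y - 1"]) (auto intro!: derivative_eq_intros simp: cosh_real_ge_1)
  qed
  then show ?thesis by simp
qed

lemma cosh_eq_sinh_half: "cosh (x :: real) = 1 + 2 * (sinh (x / 2))\<^sup>2"
  using cosh_double[of "x / 2"] by (simp add: cosh_square_eq)

lemma cosh_ge_quadratic: "1 + x\<^sup>2 / 2 \<le> cosh (x :: real)"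
proof -
  have "1 + x\<^sup>2 / 2 \<le> cosh x" if "0 \<le> x" for x :: real
  proof -
    have "(x / 2)\<^sup>2 \<le> (sinh (x / 2))\<^sup>2"
      using that by (intro power_mono sinh_ge_self) auto
    then show ?thesis by (simp add: cosh_eq_sinh_half[of x] power_divide)
  qed
  from this[of "\<bar>x\<bar>"] show ?thesis by simp
qed

text \<open>The constant \<open>4 / 5\<close> leaves room for the error of \<open>sinh\<close>: in
  \<open>oval_section_height_suff\<close> that error is at most \<open>1 / 5 * a^2\<close>, and the
  two add up to \<open>a^2\<close>.\<close>

lemma cosh_le_quadratic:
  assumes "\<bar>x\<bar> \<le> (1 :: real)" shows "cosh x \<le> 1 + 4 / 5 * x\<^sup>2"
proof -
  define u where "u = \<bar>x\<bar> / 2"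
  have u: "0 \<le> u" "u \<le> 1 / 2" using assms by (auto simp: u_def)
  have "exp u \<le> 1 + u + u\<^sup>2" using u by (intro exp_bound) auto
  moreover have "1 - u \<le> exp (- u)" using exp_ge_add_one_self[of "- u"] by simp
  ultimately have "sinh u \<le> u + u * u / 2" by (simp add: sinh_field_def power2_eq_square field_simps)
  moreover have "u * u \<le> u * (1 / 2)" using u by (intro mult_left_mono) auto
  ultimately have "sinh u \<le> 5 / 4 * u" by simp
  then have "(sinh u)\<^sup>2 \<le> (5 / 4 * u)\<^sup>2"
    using u by (intro power_mono) auto
  moreover have "cosh x = 1 + 2 * (sinh u)\<^sup>2"
    using cosh_eq_sinh_half[of "\<bar>x\<bar>"] by (simp add: u_def)
  moreover have "(5 / 4 * u)\<^sup>2 = 25 / 64 * x\<^sup>2"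
    by (simp add: u_def power_divide power_mult_distrib)
  ultimately have "cosh x \<le> 1 + 25 / 32 * x\<^sup>2" by linarith
  moreover have "25 / 32 * x\<^sup>2 \<le> 4 / 5 * x\<^sup>2" by (intro mult_right_mono) auto
  ultimately show ?thesis by linarith
qed

lemma abs_sinh_minus_le:
  assumes "\<bar>x\<bar> \<le> (1 :: real)" shows "\<bar>sinh x - x\<bar> \<le> \<bar>x\<bar> ^ 3"
proof -
  have "sinh x \<le> x + x ^ 3" if x: "0 \<le> x" "x \<le> 1" for x :: real
  proof -
    have "(\<lambda>x. x + x ^ 3 - sinh x) 0 \<le> (\<lambda>x. x + x ^ 3 - sinh x) x"
    proof (rule DERIV_nonneg_imp_nondecreasing[OF x(1)])
      fix y assume y: "0 \<le> y" "y \<le> x"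
      have "cosh y \<le> 1 + 4 / 5 * y\<^sup>2" using x y by (intro cosh_le_quadratic) auto
      also have "\<dots> \<le> 1 + 3 * y\<^sup>2" by simp
      finally show "\<exists>d. DERIV (\<lambda>x. x + x ^ 3 - sinh x) y :> d \<and> 0 \<le> d"
        by (intro exI[of _ "1 + 3 * y\<^sup>2 - cosh y"]) (auto intro!: derivative_eq_intros)
    qed
    then show ?thesis by simp
  qed
  from this[of "\<bar>x\<bar>"] sinh_ge_self[of "\<bar>x\<bar>"] assms show ?thesis
    by (cases "0 \<le> x") (auto simp: abs_if)
qed

text \<open>At radius \<open>R\<close> and \<open>sin\<^sup>2\<close> of the azimuth \<open>g\<close>, the level set is met at height \<open>a\<close> with
  \<open>c * a = Z + (1 - g) * a\<^sup>2 / 2 + \<dots>\<close>. To first order \<open>c * a = Z\<close>, and substituting this, with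
  \<open>c\<^sup>2 = 1/2\<close>, turns \<open>a\<^sup>2 / 2\<close> into \<open>Z\<^sup>2\<close>.\<close>

lemma oval_section_height_ge:
  fixes a g N R y :: real
  defines "c \<equiv> 1 / sqrt 2" and "w \<equiv> N + R\<^sup>2" and "Z \<equiv> - N + R\<^sup>2 * g / 2"
  assumes g: "0 \<le> g" "g \<le> 1" and N: "0 \<le> N" and R: "0 \<le> R" and w: "w \<le> 1/32"
    and a: "\<bar>a\<bar> \<le> R" and y: "y\<^sup>2 = (R\<^sup>2 - a\<^sup>2) * g"
    and sec: "cosh a - c * sinh a \<le> (1 + N) * cos y"
  shows "Z + (1 - g) * Z\<^sup>2 + N * R\<^sup>2 * g / 2 - R ^ 4 * g\<^sup>2 / 24 - 20 * w ^ 3 \<le> c * a"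
proof (rule ccontr)
  define T where "T = Z + (1 - g) * Z\<^sup>2 + N * R\<^sup>2 * g / 2 - R ^ 4 * g\<^sup>2 / 24 - 20 * w ^ 3"
  \<comment> \<open>The contrary assumption supplies an upper bound for \<open>a\<close>. The
    section inequality bounds \<open>c * a\<close> only from below, and with a quadratic term whose
    size must be controlled.\<close>
  assume "\<not> ?thesis"
  then have T: "c * a < T" by (simp add: T_def)
  have c: "c * c = 1 / 2" "7 / 10 \<le> c" "c \<le> 1"
  proof -
    show "c * c = 1 / 2" by (simp add: c_def)
    show "7 / 10 \<le> c"
      by (rule power2_le_imp_le) (simp_all add: power2_eq_square \<open>c * c = 1 / 2\<close> c_def)
    show "c \<le> 1" by (simp add: c_def)
  qed
  have w0: "0 \<le> w" using N by (simp add: w_def)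
  have R2: "R\<^sup>2 \<le> w" "N \<le> w" "0 \<le> R\<^sup>2" using N by (auto simp: w_def)
  have R1: "R \<le> 1"
  proof (rule power2_le_imp_le)
    show "R\<^sup>2 \<le> 1\<^sup>2" using R2 w by simp
  qed simp
  have R4: "R ^ 4 = R\<^sup>2 * R\<^sup>2" "R\<^sup>2 * R\<^sup>2 \<le> w * w" "N * R\<^sup>2 \<le> w * w"
    using mult_mono[OF R2(1) R2(1) w0 R2(3)] mult_mono[OF R2(2) R2(1) w0 R2(3)]
    by (simp_all add: power4_eq_xxxx power2_eq_square mult.assoc)
  have a2: "a\<^sup>2 \<le> R\<^sup>2" using a R by (metis abs_ge_zero power2_abs power_mono)
  have ZZ: "\<bar>Z\<bar> \<le> w"
  proof -
    have "R\<^sup>2 * g \<le> R\<^sup>2 * 1" using g R2 by (intro mult_left_mono) auto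
    moreover have "0 \<le> R\<^sup>2 * g" using g by simp
    ultimately show ?thesis using N R2 by (simp add: Z_def w_def abs_le_iff)
  qed
  have Z2: "Z\<^sup>2 \<le> w * w"
    using ZZ w0 by (metis abs_ge_zero power2_abs power2_eq_square power_mono)
  have "1 + a\<^sup>2 / 2 - c * a - \<bar>a\<bar> ^ 3 \<le> cosh a - c * sinh a"
  proof -
    have "\<bar>c * sinh a - c * a\<bar> = c * \<bar>sinh a - a\<bar>"
      using c(2) by (simp flip: right_diff_distrib add: abs_mult)
    also have "\<dots> \<le> 1 * \<bar>a\<bar> ^ 3"
      using c abs_sinh_minus_le[of a] a R1 by (intro mult_mono) auto
    finally show ?thesis using cosh_ge_quadratic[of a] by linarith
  qed
  also have "\<dots> \<le> (1 + N) * cos y" by (rule sec)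
  also have "\<dots> \<le> (1 + N) * (1 - y\<^sup>2 / 2 + y ^ 4 / 24)"
    using N by (intro mult_left_mono cos_le_quartic) auto
  also have "\<dots> \<le> 1 + N - R\<^sup>2 * g / 2 + a\<^sup>2 * g / 2 - N * R\<^sup>2 * g / 2 + N * a\<^sup>2 / 2 + R ^ 4 * g\<^sup>2 / 24 + N * w * w / 24"
  proof -
    have y4: "y ^ 4 \<le> R ^ 4 * g\<^sup>2"
    proof -
      have "y ^ 4 = ((R\<^sup>2 - a\<^sup>2) * g)\<^sup>2" unfolding y[symmetric] by simp
      also have "\<dots> \<le> (R\<^sup>2 * g)\<^sup>2"
        using a2 g by (intro power_mono mult_right_mono mult_nonneg_nonneg) auto
      finally show ?thesis by (simp add: power_mult_distrib)
    qed
    have "R ^ 4 * g\<^sup>2 \<le> (w * w) * 1"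
      using R4 g w0 by (intro mult_mono) (auto simp: power_le_one)
    then have "N * y ^ 4 \<le> N * (w * w)"
      using y4 N by (intro mult_left_mono) auto
    moreover have "N * a\<^sup>2 * g \<le> N * a\<^sup>2 * 1" using N g by (intro mult_left_mono) auto
    moreover have "(1 + N) * (1 - y\<^sup>2 / 2 + y ^ 4 / 24) =
      1 + N - R\<^sup>2 * g / 2 + a\<^sup>2 * g / 2 - N * R\<^sup>2 * g / 2 + N * a\<^sup>2 * g / 2 + y ^ 4 / 24 + N * y ^ 4 / 24"
      unfolding y by (simp add: algebra_simps add_divide_distrib diff_divide_distrib)
    ultimately show ?thesis using y4 by (simp add: mult.assoc)
  qed
  \<comment> \<open>The unknown \<open>a\<close> occurs on both sides; it remains to evaluate
    \<open>a^2 / 2\<close> up to order \<open>w ^ 3\<close>.\<close>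
  finally have main: "Z + (1 - g) * (a\<^sup>2 / 2) + N * R\<^sup>2 * g / 2 - R ^ 4 * g\<^sup>2 / 24
      - N * a\<^sup>2 / 2 - N * w * w / 24 - \<bar>a\<bar> ^ 3 \<le> c * a"
    unfolding Z_def by (simp add: algebra_simps diff_divide_distrib)
  have ww: "w * w \<le> w / 32" "w * w * w \<le> w * w / 32"
    using w w0 mult_left_mono[OF w w0] mult_left_mono[OF w, of "w * w"] by (simp_all add: mult.commute)
  have T_le: "T \<le> Z + 2 * (w * w)"
  proof -
    have "(1 - g) * Z\<^sup>2 \<le> 1 * (w * w)" using g Z2 by (intro mult_mono) auto
    moreover have "N * R\<^sup>2 * g \<le> (w * w) * 1"
      by (rule mult_mono[OF R4(3) g(2)]) (use w0 g in auto)
    moreover have "0 \<le> R ^ 4 * g\<^sup>2" "0 \<le> w ^ 3" using w0 by auto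
    moreover have "0 \<le> w * w" by simp
    ultimately show ?thesis unfolding T_def by linarith
  qed
  have main': "Z - w * w / 24 - N * a\<^sup>2 / 2 - N * w * w / 24 - \<bar>a\<bar> ^ 3 \<le> c * a"
  proof -
    have "R ^ 4 * g\<^sup>2 \<le> (w * w) * 1"
      using R4 g w0 by (intro mult_mono) (auto simp: power_le_one)
    moreover have "0 \<le> (1 - g) * (a\<^sup>2 / 2)" "0 \<le> N * R\<^sup>2 * g" using g N by auto
    ultimately show ?thesis using main by linarith
  qed
  have Nww: "N * w * w \<le> w * w * w" using R2 w0 by (intro mult_right_mono) auto
  \<comment> \<open>Bootstrapping: initially \<open>\<bar>a\<bar> \<le> R\<close> is only of order
    \<open>sqrt w\<close>. For positive \<open>a\<close> the contrary assumption improves this; for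
    negative \<open>a\<close> it is \<open>main'\<close>, where
    \<open>\<bar>a\<bar> ^ 3 \<le> w * \<bar>a\<bar>\<close> is absorbed by the linear term.\<close>
  have aw: "\<bar>a\<bar> \<le> 2 * w"
  proof (cases "0 \<le> a")
    case True
    have "7 / 10 * a \<le> c * a" using True c by (intro mult_right_mono) auto
    then have "7 / 10 * a \<le> w + 2 * (w * w)" using T T_le ZZ by linarith
    then show ?thesis using True ww by linarith
  next
    case False
    have "c * a \<le> 7 / 10 * a" using False c by (intro mult_right_mono_neg) auto
    moreover have "N * a\<^sup>2 \<le> w * w"
      using a2 R2 N by (intro mult_mono) auto
    moreover have "\<bar>a\<bar> ^ 3 \<le> w * \<bar>a\<bar>"
    proof -
      have "\<bar>a\<bar> ^ 3 = a\<^sup>2 * \<bar>a\<bar>" by (simp add: power3_eq_cube power2_eq_square abs_mult_self_eq flip: abs_mult)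
      also have "\<dots> \<le> w * \<bar>a\<bar>" using a2 R2 by (intro mult_right_mono) auto
      finally show ?thesis .
    qed
    moreover have "w * \<bar>a\<bar> \<le> 1 / 32 * \<bar>a\<bar>" using w by (intro mult_right_mono) auto
    ultimately show ?thesis using main' ZZ Nww ww False by linarith
  qed
  have a3: "\<bar>a\<bar> ^ 3 \<le> 8 * (w * w * w)"
  proof -
    have "\<bar>a\<bar> ^ 3 \<le> (2 * w) ^ 3" using aw by (intro power_mono) auto
    then show ?thesis by (simp add: power3_eq_cube mult.assoc)
  qed
  have Na: "N * a\<^sup>2 \<le> 4 * (w * w * w)"
  proof -
    have "a\<^sup>2 \<le> (2 * w)\<^sup>2" using aw by (metis abs_ge_zero power2_abs power_mono)
    then have "N * a\<^sup>2 \<le> w * (2 * w)\<^sup>2" using R2 N w0 by (intro mult_mono) auto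
    then show ?thesis by (simp add: power2_eq_square mult.assoc)
  qed
  \<comment> \<open>The first-order solution. As the square of \<open>c * a\<close> is
    \<open>a^2 / 2\<close>, it may replace the quadratic term at a cost of
    \<open>6 * w ^ 3\<close>.\<close>
  have "\<bar>c * a - Z\<bar> \<le> 2 * (w * w)"
  proof -
    have "Z - 2 * (w * w) \<le> c * a" using main' a3 Na Nww ww zero_le_square[of w] by linarith
    moreover have "c * a \<le> Z + 2 * (w * w)" using T T_le by linarith
    ultimately show ?thesis by linarith
  qed
  moreover have "\<bar>c * a + Z\<bar> \<le> 3 * w"
  proof -
    have "\<bar>c * a\<bar> \<le> 1 * \<bar>a\<bar>" unfolding abs_mult using c by (intro mult_right_mono) auto
    then show ?thesis using aw ZZ by linarith
  qed
  ultimately have "\<bar>(c * a - Z) * (c * a + Z)\<bar> \<le> 2 * (w * w) * (3 * w)"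
    unfolding abs_mult using w0 by (intro mult_mono) auto
  moreover have "(c * a - Z) * (c * a + Z) = a\<^sup>2 / 2 - Z\<^sup>2"
  proof -
    have "(c * a - Z) * (c * a + Z) = (c * c) * a\<^sup>2 - Z\<^sup>2" by (simp add: algebra_simps power2_eq_square)
    then show ?thesis by (simp add: c(1))
  qed
  ultimately have "Z\<^sup>2 - 6 * (w * w * w) \<le> a\<^sup>2 / 2" by (simp add: abs_le_iff)
  then have "(1 - g) * (Z\<^sup>2 - 6 * (w * w * w)) \<le> (1 - g) * (a\<^sup>2 / 2)"
    using g by (intro mult_left_mono) auto
  moreover have "(1 - g) * (6 * (w * w * w)) \<le> 1 * (6 * (w * w * w))"
    using g w0 by (intro mult_right_mono) auto
  ultimately have "(1 - g) * Z\<^sup>2 - 6 * (w * w * w) \<le> (1 - g) * (a\<^sup>2 / 2)"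
    by (simp add: right_diff_distrib)
  moreover have "0 \<le> w * w * w" using w0 by simp
  \<comment> \<open>The errors in units of \<open>w ^ 3\<close> are 8 from
    \<open>\<bar>a\<bar> ^ 3\<close>, 2 from \<open>N * a^2 / 2\<close>, 1/24 from
    \<open>N * w * w / 24\<close> and 6 from replacing \<open>a^2 / 2\<close>; their sum is below
    20.\<close>
  ultimately have "T \<le> c * a"
    using main a3 Na Nww unfolding T_def power3_eq_cube by linarith
  then show False using T by simp
qed

text \<open>A coarse converse, accurate to order \<open>w^2\<close>, which is what the first-order
  comparison of the means of \<open>1/\<rho>\<close> and \<rho> requires. The quadratic bounds for
  \<open>cos\<close> and \<open>cosh\<close> and the cubic one for \<open>sinh\<close> reduce it to
  \<open>Z + N * R^2 / 2 + a^2 \<le> c * a\<close>.\<close>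

lemma oval_section_height_suff:
  fixes a g N R y :: real
  defines "c \<equiv> 1 / sqrt 2" and "w \<equiv> N + R\<^sup>2" and "Z \<equiv> - N + R\<^sup>2 * g / 2"
  assumes g: "0 \<le> g" "g \<le> 1" and N: "0 \<le> N" and R: "0 \<le> R" and w: "w \<le> 1/32"
    and a: "\<bar>a\<bar> \<le> R" and y: "y\<^sup>2 = (R\<^sup>2 - a\<^sup>2) * g"
    and height: "Z + 10 * w\<^sup>2 \<le> c * a"
  shows "cosh a - c * sinh a \<le> (1 + N) * cos y"
proof -
  have c: "c * c = 1 / 2" "7 / 10 \<le> c" "c \<le> 1"
  proof -
    show "c * c = 1 / 2" by (simp add: c_def)
    show "7 / 10 \<le> c"
      by (rule power2_le_imp_le) (simp_all add: power2_eq_square \<open>c * c = 1 / 2\<close> c_def)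
    show "c \<le> 1" by (simp add: c_def)
  qed
  have w0: "0 \<le> w" using N by (simp add: w_def)
  have R2: "R\<^sup>2 \<le> w" "N \<le> w" "0 \<le> R\<^sup>2" using N by (auto simp: w_def)
  have R1: "R \<le> 1 / 5"
  proof (rule power2_le_imp_le)
    show "R\<^sup>2 \<le> (1 / 5)\<^sup>2" using R2 w by (simp add: power2_eq_square)
  qed simp
  have NR: "N * R\<^sup>2 \<le> w * w" using R2 N w0 by (intro mult_mono) auto
  have a2: "a\<^sup>2 \<le> R\<^sup>2" using a R by (metis abs_ge_zero power2_abs power_mono)
  have Rg: "R\<^sup>2 * g \<le> R\<^sup>2 * 1" "0 \<le> R\<^sup>2 * g" using mult_left_mono[of g 1 "R\<^sup>2"] g R2 by auto
  have ww: "w * w \<le> w / 32" using mult_left_mono[OF w w0] by simp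
  define a0 where "a0 = (Z + 10 * w\<^sup>2) / c"
  have a0: "c * a0 = Z + 10 * (w * w)" using c(2) by (simp add: a0_def power2_eq_square)
  have a0w: "\<bar>a0\<bar> \<le> 2 * w"
  proof -
    have "7 / 10 * \<bar>a0\<bar> \<le> c * \<bar>a0\<bar>" using c by (intro mult_right_mono) auto
    also have "\<dots> = \<bar>c * a0\<bar>" using c by (simp add: abs_mult)
    also have "\<dots> \<le> 21 / 16 * w"
    proof -
      have "\<bar>Z\<bar> \<le> w" using Rg N R2 by (simp add: Z_def w_def abs_le_iff)
      then show ?thesis unfolding a0 using ww w0 zero_le_square[of w] by linarith
    qed
    finally show ?thesis using w0 by linarith
  qed
  have "a0 \<le> a" using height c(2) by (simp add: a0_def divide_le_eq mult.commute)
  then have "0 \<le> (a - a0) * (c - a - a0)"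
    using a R1 a0w w c by (intro mult_nonneg_nonneg) auto
  then have "c * a0 - a0\<^sup>2 \<le> c * a - a\<^sup>2" by (simp add: algebra_simps power2_eq_square)
  moreover have "a0\<^sup>2 \<le> 4 * (w * w)"
  proof -
    have "a0\<^sup>2 \<le> (2 * w)\<^sup>2" using a0w by (metis abs_ge_zero power2_abs power_mono)
    then show ?thesis by (simp add: power2_eq_square)
  qed
  ultimately have ca: "Z + N * R\<^sup>2 / 2 + a\<^sup>2 \<le> c * a" using a0 NR zero_le_square[of w] by linarith
  have "cosh a - c * sinh a \<le> 1 + a\<^sup>2 - c * a"
  proof -
    have "\<bar>c * sinh a - c * a\<bar> = c * \<bar>sinh a - a\<bar>"
      using c(2) by (simp flip: right_diff_distrib add: abs_mult)
    also have "\<dots> \<le> 1 * \<bar>a\<bar> ^ 3"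
      using c abs_sinh_minus_le[of a] a R1 by (intro mult_mono) auto
    also have "\<dots> = \<bar>a\<bar> * a\<^sup>2" by (simp add: power3_eq_cube power2_eq_square)
    also have "\<dots> \<le> 1 / 5 * a\<^sup>2" using a R1 by (intro mult_right_mono) auto
    finally have "\<bar>c * sinh a - c * a\<bar> \<le> 1 / 5 * a\<^sup>2" .
    moreover have "cosh a \<le> 1 + 4 / 5 * a\<^sup>2" using a R1 by (intro cosh_le_quadratic) auto
    ultimately show ?thesis by linarith
  qed
  also have "\<dots> \<le> 1 + N - R\<^sup>2 * g / 2 - N * R\<^sup>2 / 2" using ca unfolding Z_def by linarith
  also have "\<dots> \<le> (1 + N) * (1 - y\<^sup>2 / 2)"
  proof -
    have "y\<^sup>2 \<le> R\<^sup>2 * g" unfolding y using g by (intro mult_right_mono) auto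
    moreover have "N * y\<^sup>2 \<le> N * R\<^sup>2"
      using calculation Rg N by (intro mult_left_mono) auto
    moreover have "(1 + N) * (1 - y\<^sup>2 / 2) = 1 + N - y\<^sup>2 / 2 - N * y\<^sup>2 / 2"
      by (simp add: algebra_simps)
    ultimately show ?thesis by linarith
  qed
  also have "\<dots> \<le> (1 + N) * cos y"
    using N by (intro mult_left_mono cos_ge_quadratic) auto
  finally show ?thesis .
qed


section \<open>From heights to masses\<close>

lemma measure_height_law:
  "Q \<in> sets borel \<Longrightarrow> measure height_law Q = measure lborel (Q \<inter> {-1<..<1}) / 2"
  unfolding height_law_def by (subst measure_uniform_measure) (auto simp: Int_commute)

lemma fmeasurable_Int_unit_interval:
  "Q \<in> sets borel \<Longrightarrow> Q \<inter> {-1<..<1::real} \<in> fmeasurable lborel"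
  by (rule fmeasurableI2[of "{-1<..<1}"]) (auto simp: fmeasurable_def)

lemma measure_height_law_le:
  assumes [measurable]: "Q \<in> sets borel" and "\<And>v. -1 < v \<Longrightarrow> v < 1 \<Longrightarrow> v \<in> Q \<Longrightarrow> a \<le> v" "a \<le> 1"
  shows "measure height_law Q \<le> (1 - a) / 2"
proof -
  have "measure height_law Q = measure lborel (Q \<inter> {-1<..<1}) / 2"
    by (simp add: measure_height_law)
  also have "measure lborel (Q \<inter> {-1<..<1}) \<le> measure lborel {a..1}"
    using assms by (intro measure_mono_fmeasurable) (auto simp: fmeasurable_def)
  also have "\<dots> = 1 - a" using assms by simp
  finally show ?thesis by simp
qed

lemma measure_height_law_ge:
  assumes [measurable]: "Q \<in> sets borel" and "\<And>v. -1 < v \<Longrightarrow> v < 1 \<Longrightarrow> a \<le> v \<Longrightarrow> v \<in> Q" "-1 \<le> a"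
  shows "(1 - a) / 2 \<le> measure height_law Q"
proof (cases "a \<le> 1")
  case True
  then have "1 - a = measure lborel {a<..<1}" by simp
  also have "\<dots> \<le> measure lborel (Q \<inter> {-1<..<1})"
    using assms by (intro measure_mono_fmeasurable fmeasurable_Int_unit_interval) auto
  also have "\<dots> = 2 * measure height_law Q"
    by (simp add: measure_height_law)
  finally show ?thesis by simp
next
  case False
  then have "(1 - a) / 2 \<le> 0" by simp
  then show ?thesis using measure_nonneg order_trans by blast
qed

text \<open>The heights on a sphere of radius \<open>R\<close>, at squared sine \<open>g\<close> of
  the azimuth, that belong to the superlevel set, after the addition formula for \<open>cosh\<close>
  at \<open>arsinh 1\<close> (see \<open>oval_level_iff\<close>); \<open>1 / sqrt 2\<close> is
  \<open>tanh (arsinh 1)\<close>. Values of \<open>v\<close> outside the unit interval may occur,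
  but \<open>height_law\<close> gives them no mass.\<close>

definition oval_section :: "real \<Rightarrow> real \<Rightarrow> real \<Rightarrow> real set" where
  "oval_section N R g = {v. cosh (R * v) - 1 / sqrt 2 * sinh (R * v) \<le> (1 + N) * cos (sqrt (R\<^sup>2 * (1 - v\<^sup>2) * g))}"

lemma oval_section_measurable [measurable]: "oval_section N R g \<in> sets borel"
proof -
  have "closed (oval_section N R g)"
    unfolding oval_section_def by (intro closed_Collect_le continuous_intros)
  then show ?thesis by (rule borel_closed)
qed

lemma sum_power3_le:
  fixes x y :: real
  assumes "0 \<le> x" "0 \<le> y" shows "(x + y) ^ 3 \<le> 4 * (x ^ 3 + y ^ 3)"
proof -
  have "0 \<le> 3 * (x + y) * (x - y)\<^sup>2" using assms by auto
  also have "\<dots> = 4 * (x ^ 3 + y ^ 3) - (x + y) ^ 3"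
    by (simp add: power2_eq_square power3_eq_cube algebra_simps)
  finally show ?thesis by simp
qed

text \<open>\<open>N\<close> need not be small compared with \<open>R\<close>: if the bound exceeds 1, that is, for
  \<open>R\<close> small compared with \<open>N\<close>, it holds trivially.\<close>

lemma measure_oval_section_le:
  assumes g: "0 \<le> g" "g \<le> 1" and N: "0 \<le> N" "N \<le> 1/64" and R: "0 < R"
  shows "measure height_law (oval_section N R g) \<le> 1/2 - sqrt 2 / (2 * R) *
    (- N + R\<^sup>2 * g / 2 + (1 - g) * (- N + R\<^sup>2 * g / 2)\<^sup>2 + N * R\<^sup>2 * g / 2 - R ^ 4 * g\<^sup>2 / 24 - 40000 * (N ^ 3 + R ^ 6))"
proof -
  define w where "w = N + R\<^sup>2"
  define Z where "Z = - N + R\<^sup>2 * g / 2"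
  define P where "P = Z + (1 - g) * Z\<^sup>2 + N * R\<^sup>2 * g / 2 - R ^ 4 * g\<^sup>2 / 24"
  have w0: "0 \<le> w" "N \<le> w" "R\<^sup>2 \<le> w" using N by (simp_all add: w_def)
  \<comment> \<open>Separating \<open>N\<close> from \<open>R\<close> makes the error integrable
    over all radii after division by \<open>R\<close>.\<close>
  have "w ^ 3 \<le> 4 * (N ^ 3 + R ^ 6)"
    using sum_power3_le[of N "R\<^sup>2"] N by (simp add: w_def flip: power_mult)
  then have "sqrt 2 / (2 * R) * (P - 40000 * (N ^ 3 + R ^ 6)) \<le> sqrt 2 / (2 * R) * (P - 10000 * w ^ 3)"
    using R by (intro mult_left_mono) auto
  moreover have "measure height_law (oval_section N R g) \<le> 1/2 - sqrt 2 / (2 * R) * (P - 10000 * w ^ 3)"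
  proof (cases "w \<le> 1/32")
    case True
    define a where "a = sqrt 2 / R * (P - 10000 * w ^ 3)"
    have "measure height_law (oval_section N R g) \<le> (1 - a) / 2"
    proof (rule measure_height_law_le)
      fix v :: real assume v: "-1 < v" "v < 1" "v \<in> oval_section N R g"
      have v2: "v\<^sup>2 \<le> 1" using v by (simp add: abs_square_le_1)
      have "P - 20 * w ^ 3 \<le> 1 / sqrt 2 * (R * v)"
        unfolding P_def Z_def w_def
      proof (rule oval_section_height_ge[OF g N(1)])
        show "\<bar>R * v\<bar> \<le> R" using v R by (simp add: abs_mult)
        show "(sqrt (R\<^sup>2 * (1 - v\<^sup>2) * g))\<^sup>2 = (R\<^sup>2 - (R * v)\<^sup>2) * g"
        proof -
          have "0 \<le> R\<^sup>2 * (1 - v\<^sup>2) * g" using g v2 by (intro mult_nonneg_nonneg) auto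
          then have "(sqrt (R\<^sup>2 * (1 - v\<^sup>2) * g))\<^sup>2 = R\<^sup>2 * (1 - v\<^sup>2) * g" by (rule real_sqrt_pow2)
          then show ?thesis by (simp add: power_mult_distrib algebra_simps)
        qed
      qed (use v R True in \<open>auto simp: oval_section_def w_def\<close>)
      moreover have "20 * w ^ 3 \<le> 10000 * w ^ 3" using w0 by (intro mult_right_mono) auto
      ultimately have "P - 10000 * w ^ 3 \<le> 1 / sqrt 2 * (R * v)" by linarith
      then have "sqrt 2 / R * (P - 10000 * w ^ 3) \<le> sqrt 2 / R * (1 / sqrt 2 * (R * v))"
        using R by (intro mult_left_mono) auto
      then show "a \<le> v" using R by (simp add: a_def)
    next
      \<comment> \<open>The threshold must not exceed 1 for the mass formula to apply. Since
        \<open>R \<le> 1/5\<close>, the main term is at most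
        \<open>3/2 * R^2 \<le> 3/10 * R\<close>, hence \<open>a\<close> at most
        \<open>3/10 * sqrt 2\<close>.\<close>
      have R5: "R \<le> 1 / 5"
      proof (rule power2_le_imp_le)
        show "R\<^sup>2 \<le> (1 / 5)\<^sup>2" using w0 True by (simp add: power2_eq_square)
      qed simp
      have Rg: "R\<^sup>2 * g \<le> R\<^sup>2" "0 \<le> R\<^sup>2 * g" using mult_left_mono[of g 1 "R\<^sup>2"] g by auto
      have Z1: "Z \<le> R\<^sup>2 / 2" "-1 \<le> Z" "Z \<le> 1" using Rg N w0 True by (auto simp: Z_def)
      have "Z + (1 - g) * Z\<^sup>2 \<le> 2 * (R\<^sup>2 / 2)"
      proof (cases "0 \<le> Z")
        case True
        have "(1 - g) * Z\<^sup>2 \<le> 1 * (Z * 1)"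
          using g True Z1 by (intro mult_mono) (auto simp: power2_eq_square intro: mult_left_le)
        then show ?thesis using Z1 by linarith
      next
        case False
        have "(1 - g) * Z\<^sup>2 \<le> 1 * (- Z)"
          using g False Z1 mult_left_le[of "- Z" "- Z"] by (intro mult_mono) (auto simp: power2_eq_square)
        then show ?thesis using zero_le_power2[of R] by linarith
      qed
      moreover have "N * R\<^sup>2 * g \<le> R\<^sup>2"
        using mult_right_mono[of N 1 "R\<^sup>2 * g"] Rg N by (simp add: mult.assoc)
      moreover have "0 \<le> R ^ 4 * g\<^sup>2" "0 \<le> w ^ 3" using w0 by auto
      ultimately have "P - 10000 * w ^ 3 \<le> 3/2 * R\<^sup>2" unfolding P_def by linarith
      also have "\<dots> \<le> 3/10 * R" using R5 R mult_right_mono[of R "1/5" R] by (simp add: power2_eq_square)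
      finally have "sqrt 2 / R * (P - 10000 * w ^ 3) \<le> sqrt 2 / R * (3/10 * R)"
        using R by (intro mult_left_mono) auto
      also have "\<dots> \<le> 1" using R sqrt2_less_2 by simp
      finally show "a \<le> 1" by (simp add: a_def)
    qed simp
    moreover have "(1 - a) / 2 = 1/2 - sqrt 2 / (2 * R) * (P - 10000 * w ^ 3)"
      by (simp add: a_def diff_divide_distrib)
    ultimately show ?thesis by simp
  next
    case False
    \<comment> \<open>For large \<open>w\<close> the error term alone must make the bound exceed 1.
      With \<open>R \<le> 8 * w\<close> and \<open>P \<le> w + 2 * w^2\<close>, the sum of
      \<open>P\<close> and \<open>R\<close> is at most \<open>290 * w^2 \<le> 9280 * w ^ 3\<close>;
      this is where 10000 comes from, and 40000 after \<open>sum_power3_le\<close>.\<close>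
    have ww: "w \<le> 32 * (w * w)" "w * w \<le> 32 * w ^ 3"
      using False mult_right_mono[of "1/32" w w] mult_right_mono[of "1/32" w "w * w"] w0
      by (simp_all add: power3_eq_cube mult.assoc)
    have R8: "1 / 8 \<le> R"
    proof (rule power2_le_imp_le)
      show "(1 / 8)\<^sup>2 \<le> R\<^sup>2" using False N by (simp add: w_def power2_eq_square)
    qed (use R in simp)
    have "1 / 8 * R \<le> R * R" using R8 R by (intro mult_right_mono) auto
    then have "R \<le> 8 * w" using w0(3) unfolding power2_eq_square by linarith
    moreover have "P \<le> w + 2 * (w * w)"
    proof -
      have Rg: "R\<^sup>2 * g \<le> R\<^sup>2" "0 \<le> R\<^sup>2 * g" using mult_left_mono[of g 1 "R\<^sup>2"] g by auto
      have Z: "\<bar>Z\<bar> \<le> w" using Rg N w0 by (simp add: Z_def w_def abs_le_iff)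
      then have "Z\<^sup>2 \<le> w * w" using w0 by (metis abs_ge_zero power2_abs power2_eq_square power_mono)
      then have "(1 - g) * Z\<^sup>2 \<le> 1 * (w * w)" using g by (intro mult_mono) auto
      moreover have "N * (R\<^sup>2 * g) \<le> w * w" using Rg N w0 by (intro mult_mono) auto
      moreover have "0 \<le> R ^ 4 * g\<^sup>2" by simp
      moreover have "0 \<le> w * w" by simp
      ultimately show ?thesis using Z unfolding P_def mult.assoc by linarith
    qed
    moreover have "0 \<le> w ^ 3" using w0 by simp
    ultimately have "P - 10000 * w ^ 3 \<le> - R" using ww by linarith
    then have "sqrt 2 / (2 * R) * (P - 10000 * w ^ 3) \<le> sqrt 2 / (2 * R) * (- R)"
      using R by (intro mult_left_mono) auto
    also have "\<dots> \<le> - 1/2" using R by simp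
    finally show ?thesis
      using height_law.finite_measure_mono[of "oval_section N R g" UNIV]
        emeasure_height_law[of UNIV] by (simp add: measure_def)
  qed
  ultimately show ?thesis by (simp add: P_def Z_def)
qed

text \<open>In the lower bound the height must stay above \<open>-1\<close>, which limits \<open>N\<close> by \<open>R\<close>. For smaller
  radii one applies it with \<open>N' = 0\<close>.\<close>

lemma measure_oval_section_ge:
  assumes g: "0 \<le> g" "g \<le> 1" and N: "0 \<le> N'" "N' \<le> N" "N \<le> 1/64" and R: "0 < R" "N' \<le> R / 4"
  shows "1/2 - sqrt 2 / (2 * R) * (- N' + R\<^sup>2 * g / 2 + 600 * (N'\<^sup>2 + R ^ 4))
    \<le> measure height_law (oval_section N R g)"
proof -
  define w where "w = N' + R\<^sup>2"
  define Z where "Z = - N' + R\<^sup>2 * g / 2"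
  have w0: "0 \<le> w" "N' \<le> w" "R\<^sup>2 \<le> w" using N by (simp_all add: w_def)
  have Rg: "R\<^sup>2 * g \<le> R\<^sup>2" "0 \<le> R\<^sup>2 * g" using mult_left_mono[of g 1 "R\<^sup>2"] g by auto
  have "w\<^sup>2 \<le> 2 * (N'\<^sup>2 + R ^ 4)"
    using sum_squares_bound[of N' "R\<^sup>2"] by (simp add: w_def power2_sum flip: power_mult)
  then have "sqrt 2 / (2 * R) * (Z + 300 * w\<^sup>2) \<le> sqrt 2 / (2 * R) * (Z + 600 * (N'\<^sup>2 + R ^ 4))"
    using R by (intro mult_left_mono) auto
  moreover have "1/2 - sqrt 2 / (2 * R) * (Z + 300 * w\<^sup>2) \<le> measure height_law (oval_section N R g)"
  proof (cases "w \<le> 1/32")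
    case True
    define a where "a = sqrt 2 / R * (Z + 10 * w\<^sup>2)"
    have "(1 - a) / 2 \<le> measure height_law (oval_section N R g)"
    proof (rule measure_height_law_ge)
      fix v :: real assume v: "-1 < v" "v < 1" "a \<le> v"
      have v2: "v\<^sup>2 \<le> 1" using v by (simp add: abs_square_le_1)
      define y where "y = sqrt (R\<^sup>2 * (1 - v\<^sup>2) * g)"
      have y: "y\<^sup>2 = (R\<^sup>2 - (R * v)\<^sup>2) * g"
      proof -
        have "0 \<le> R\<^sup>2 * (1 - v\<^sup>2) * g" using g v2 by (intro mult_nonneg_nonneg) auto
        then have "y\<^sup>2 = R\<^sup>2 * (1 - v\<^sup>2) * g" unfolding y_def by (rule real_sqrt_pow2)
        then show ?thesis by (simp add: power_mult_distrib algebra_simps)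
      qed
      have "cosh (R * v) - 1 / sqrt 2 * sinh (R * v) \<le> (1 + N') * cos y"
      proof (rule oval_section_height_suff[OF g N(1)])
        show "\<bar>R * v\<bar> \<le> R" using v R by (simp add: abs_mult)
        have "R / sqrt 2 * a \<le> R / sqrt 2 * v" using v R by (intro mult_left_mono) auto
        then show "- N' + R\<^sup>2 * g / 2 + 10 * (N' + R\<^sup>2)\<^sup>2 \<le> 1 / sqrt 2 * (R * v)"
          using R by (simp add: a_def Z_def w_def)
      qed (use y R True in \<open>auto simp: w_def\<close>)
      \<comment> \<open>Passing from \<open>N'\<close> to the larger \<open>N\<close> enlarges the
        section because the cosine is nonnegative here.\<close>
      also have "\<dots> \<le> (1 + N) * cos y"
      proof (rule mult_right_mono)
        have "(R * v)\<^sup>2 \<ge> 0" by simp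
        then have "y\<^sup>2 \<le> R\<^sup>2 * g" unfolding y using g by (intro mult_right_mono) auto
        then have "y\<^sup>2 \<le> 1" using Rg w0 True by linarith
        then show "0 \<le> cos y" using cos_ge_quadratic[of y] by linarith
      qed (use N in simp)
      finally show "v \<in> oval_section N R g" by (simp add: oval_section_def y_def)
    next
      have "- (R / 4) \<le> Z + 10 * w\<^sup>2"
        using R Rg zero_le_power2[of w] unfolding Z_def by linarith
      then have "sqrt 2 / R * (- (R / 4)) \<le> a"
        unfolding a_def using R by (intro mult_left_mono) auto
      moreover have "-1 \<le> sqrt 2 / R * (- (R / 4))" using R sqrt2_less_2 by simp
      ultimately show "-1 \<le> a" by linarith
    qed simp
    moreover have "sqrt 2 / (2 * R) * (Z + 10 * w\<^sup>2) \<le> sqrt 2 / (2 * R) * (Z + 300 * w\<^sup>2)"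
      using R by (intro mult_left_mono) auto
    moreover have "(1 - a) / 2 = 1/2 - sqrt 2 / (2 * R) * (Z + 10 * w\<^sup>2)"
      by (simp add: a_def diff_divide_distrib)
    ultimately show ?thesis by linarith
  next
    case False
    \<comment> \<open>For large \<open>w\<close> the bound must become nonpositive:
      \<open>R - Z \<le> 9 * w \<le> 288 * w^2\<close>, which explains 300, doubled when
      \<open>w^2\<close> is split into the squares of its summands.\<close>
    have ww: "w \<le> 32 * (w * w)"
      using False mult_right_mono[of "1/32" w w] w0 by simp
    have R8: "1 / 8 \<le> R"
    proof (rule power2_le_imp_le)
      show "(1 / 8)\<^sup>2 \<le> R\<^sup>2" using False N by (simp add: w_def power2_eq_square)
    qed (use R in simp)
    have "1 / 8 * R \<le> R * R" using R8 R by (intro mult_right_mono) auto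
    then have "R \<le> 8 * w" using w0(3) unfolding power2_eq_square by linarith
    moreover have "- w \<le> Z" using Rg N by (simp add: Z_def w_def)
    ultimately have "R \<le> Z + 300 * w\<^sup>2" using ww zero_le_square[of w] unfolding power2_eq_square by linarith
    then have "sqrt 2 / (2 * R) * R \<le> sqrt 2 / (2 * R) * (Z + 300 * w\<^sup>2)"
      using R by (intro mult_left_mono) auto
    moreover have "1/2 \<le> sqrt 2 / (2 * R) * R" using R by simp
    ultimately have "1/2 - sqrt 2 / (2 * R) * (Z + 300 * w\<^sup>2) \<le> 0" by linarith
    then show ?thesis using measure_nonneg order_trans by blast
  qed
  ultimately show ?thesis unfolding Z_def by linarith
qed

section \<open>The median of the oval\<close>

lemma integral_angle_law_cubic:
  "(\<integral>c. a0 + a1 * c + a2 * c\<^sup>2 + a3 * c ^ 3 \<partial>angle_law) = a0 + a2 / 2"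
  "integrable angle_law (\<lambda>c. a0 + a1 * c + a2 * c\<^sup>2 + a3 * c ^ 3)"
proof -
  have i: "integrable angle_law (\<lambda>c. c)" "integrable angle_law (\<lambda>c. c\<^sup>2)" "integrable angle_law (\<lambda>c. c ^ 3)"
    using integrable_angle_law_power[of 1] integrable_angle_law_power[of 2] integrable_angle_law_power[of 3] by simp_all
  have u: "measure angle_law UNIV = 1" using emeasure_angle_law_UNIV by (simp add: measure_def)
  have z: "(\<integral>c. c \<partial>angle_law) = 0" "(\<integral>c. c ^ 3 \<partial>angle_law) = 0"
    using integral_angle_law_odd[of 1] integral_angle_law_odd[of 3] by simp_all
  show "(\<integral>c. a0 + a1 * c + a2 * c\<^sup>2 + a3 * c ^ 3 \<partial>angle_law) = a0 + a2 / 2"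
    using i by (simp add: u z integral_angle_law_square)
  show "integrable angle_law (\<lambda>c. a0 + a1 * c + a2 * c\<^sup>2 + a3 * c ^ 3)"
    using i by simp
qed

text \<open>Here the choice of the point pays off: the mean of the coefficient of
  \<open>R ^ 4\<close> is 1/64 - 1/64 = 0. The coefficient 1/8 of \<open>N * R^2\<close> is -1/8,
  from the cross term of the square, plus 1/4.\<close>

lemma integral_angle_law_section_bound:
  fixes N R :: real
  defines "P \<equiv> \<lambda>g. - N + R\<^sup>2 * g / 2 + (1 - g) * (- N + R\<^sup>2 * g / 2)\<^sup>2 + N * R\<^sup>2 * g / 2 - R ^ 4 * g\<^sup>2 / 24"
  shows "(\<integral>c. P ((1 - c) / 2) \<partial>angle_law) = - N + N\<^sup>2 / 2 + R\<^sup>2 / 4 + N * R\<^sup>2 / 8"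
    and "integrable angle_law (\<lambda>c. P ((1 - c) / 2))"
proof -
  \<comment> \<open>With \<open>g = (1 - c) / 2\<close>, the first-order height
    \<open>- N + R^2 * g / 2\<close> becomes \<open>A - B * c\<close>, so \<open>P\<close> is a
    cubic in \<open>c\<close>.\<close>
  define A where "A = - N + R\<^sup>2 / 4"
  define B where "B = R\<^sup>2 / 4"
  have P: "P ((1 - c) / 2) = (- N + R\<^sup>2 / 4 + A\<^sup>2 / 2 + N * R\<^sup>2 / 4 - R ^ 4 / 96)
      + (- R\<^sup>2 / 4 + (A\<^sup>2 - 2 * A * B) / 2 - N * R\<^sup>2 / 4 + R ^ 4 / 48) * c
      + ((B\<^sup>2 - 2 * A * B) / 2 - R ^ 4 / 96) * c\<^sup>2 + B\<^sup>2 / 2 * c ^ 3" for c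
    unfolding P_def A_def B_def by (simp add: field_simps power2_eq_square power3_eq_cube power4_eq_xxxx)
  show "(\<integral>c. P ((1 - c) / 2) \<partial>angle_law) = - N + N\<^sup>2 / 2 + R\<^sup>2 / 4 + N * R\<^sup>2 / 8"
    unfolding P integral_angle_law_cubic
    unfolding A_def B_def by (simp add: field_simps power2_eq_square power4_eq_xxxx)
  show "integrable angle_law (\<lambda>c. P ((1 - c) / 2))"
    unfolding P by (rule integral_angle_law_cubic)
qed

lemma integral_measure_oval_section_le:
  assumes N: "0 \<le> N" "N \<le> 1/64" and R: "0 < R"
    and i: "integrable angle_law (\<lambda>c. measure height_law (oval_section N R ((1 - c) / 2)))"
  shows "(\<integral>c. measure height_law (oval_section N R ((1 - c) / 2)) \<partial>angle_law) \<le>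
    1/2 - sqrt 2 / (2 * R) * (- N + N\<^sup>2 / 2 + R\<^sup>2 / 4 + N * R\<^sup>2 / 8 - 40000 * (N ^ 3 + R ^ 6))"
proof -
  define P where "P = (\<lambda>g. - N + R\<^sup>2 * g / 2 + (1 - g) * (- N + R\<^sup>2 * g / 2)\<^sup>2 + N * R\<^sup>2 * g / 2 - R ^ 4 * g\<^sup>2 / 24)"
  have P: "(\<integral>c. P ((1 - c) / 2) \<partial>angle_law) = - N + N\<^sup>2 / 2 + R\<^sup>2 / 4 + N * R\<^sup>2 / 8"
    "integrable angle_law (\<lambda>c. P ((1 - c) / 2))"
    unfolding P_def by (rule integral_angle_law_section_bound)+
  have u: "measure angle_law UNIV = 1" using emeasure_angle_law_UNIV by (simp add: measure_def)
  have "(\<integral>c. measure height_law (oval_section N R ((1 - c) / 2)) \<partial>angle_law) \<le>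
    (\<integral>c. 1/2 - sqrt 2 / (2 * R) * (P ((1 - c) / 2) - 40000 * (N ^ 3 + R ^ 6)) \<partial>angle_law)"
  proof (rule integral_mono_AE)
    show "AE c in angle_law. measure height_law (oval_section N R ((1 - c) / 2)) \<le>
        1/2 - sqrt 2 / (2 * R) * (P ((1 - c) / 2) - 40000 * (N ^ 3 + R ^ 6))"
      using AE_angle_law
    proof (rule eventually_mono)
      fix c :: real assume "\<bar>c\<bar> \<le> 1"
      then have "0 \<le> (1 - c) / 2" "(1 - c) / 2 \<le> 1" by auto
      then show "measure height_law (oval_section N R ((1 - c) / 2)) \<le>
        1/2 - sqrt 2 / (2 * R) * (P ((1 - c) / 2) - 40000 * (N ^ 3 + R ^ 6))"
        unfolding P_def using N R by (rule measure_oval_section_le)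
    qed
  qed (use i P(2) in auto)
  also have "\<dots> = 1/2 - sqrt 2 / (2 * R) * ((\<integral>c. P ((1 - c) / 2) \<partial>angle_law) - 40000 * (N ^ 3 + R ^ 6))"
    using P(2) by (simp add: u)
  finally show ?thesis unfolding P(1) .
qed

lemma integral_measure_oval_section_ge:
  assumes N: "0 \<le> N'" "N' \<le> N" "N \<le> 1/64" and R: "0 < R" "N' \<le> R / 4"
    and i: "integrable angle_law (\<lambda>c. measure height_law (oval_section N R ((1 - c) / 2)))"
  shows "1/2 - sqrt 2 / (2 * R) * (- N' + R\<^sup>2 / 4 + 600 * (N'\<^sup>2 + R ^ 4)) \<le>
    (\<integral>c. measure height_law (oval_section N R ((1 - c) / 2)) \<partial>angle_law)"
proof -
  have u: "measure angle_law UNIV = 1" using emeasure_angle_law_UNIV by (simp add: measure_def)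
  define E where "E = - N' + 600 * (N'\<^sup>2 + R ^ 4)"
  have e: "- N' + R\<^sup>2 * ((1 - c) / 2) / 2 + 600 * (N'\<^sup>2 + R ^ 4) = (E + R\<^sup>2 / 4) + (- R\<^sup>2 / 4) * c + 0 * c\<^sup>2 + 0 * c ^ 3" for c
    by (simp add: E_def field_simps)
  have "(\<integral>c. 1/2 - sqrt 2 / (2 * R) * (- N' + R\<^sup>2 * ((1 - c) / 2) / 2 + 600 * (N'\<^sup>2 + R ^ 4)) \<partial>angle_law) \<le>
    (\<integral>c. measure height_law (oval_section N R ((1 - c) / 2)) \<partial>angle_law)"
  proof (rule integral_mono_AE)
    show "AE c in angle_law. 1/2 - sqrt 2 / (2 * R) * (- N' + R\<^sup>2 * ((1 - c) / 2) / 2 + 600 * (N'\<^sup>2 + R ^ 4)) \<le>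
        measure height_law (oval_section N R ((1 - c) / 2))"
      using AE_angle_law
    proof (rule eventually_mono)
      fix c :: real assume "\<bar>c\<bar> \<le> 1"
      then have "0 \<le> (1 - c) / 2" "(1 - c) / 2 \<le> 1" by auto
      then show "1/2 - sqrt 2 / (2 * R) * (- N' + R\<^sup>2 * ((1 - c) / 2) / 2 + 600 * (N'\<^sup>2 + R ^ 4)) \<le>
        measure height_law (oval_section N R ((1 - c) / 2))"
        using N R by (rule measure_oval_section_ge)
    qed
    show "integrable angle_law (\<lambda>c. 1/2 - sqrt 2 / (2 * R) * (- N' + R\<^sup>2 * ((1 - c) / 2) / 2 + 600 * (N'\<^sup>2 + R ^ 4)))"
      unfolding e using integral_angle_law_cubic(2)[of "E + R\<^sup>2 / 4" "- R\<^sup>2 / 4" 0 0] by simp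
  qed (rule i)
  moreover have "(\<integral>c. 1/2 - sqrt 2 / (2 * R) * (- N' + R\<^sup>2 * ((1 - c) / 2) / 2 + 600 * (N'\<^sup>2 + R ^ 4)) \<partial>angle_law)
    = 1/2 - sqrt 2 / (2 * R) * (E + R\<^sup>2 / 4)"
    unfolding e using integral_angle_law_cubic[of "E + R\<^sup>2 / 4" "- R\<^sup>2 / 4" 0 0] by (simp add: u)
  moreover have "E + R\<^sup>2 / 4 = - N' + R\<^sup>2 / 4 + 600 * (N'\<^sup>2 + R ^ 4)" by (simp add: E_def)
  ultimately show ?thesis by (simp only:)
qed

lemma weighted_median_ge:
  assumes "bdd_above {l. 1/2 \<le> level_mass M \<phi> x l}" "1/2 \<le> level_mass M \<phi> x l"
  shows "l \<le> weighted_median M \<phi> x"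
  unfolding weighted_median_def using assms by (intro cSup_upper) auto

lemma weighted_median_le:
  assumes "{l. 1/2 \<le> level_mass M \<phi> x l} \<noteq> {}" "\<And>l'. l \<le> l' \<Longrightarrow> level_mass M \<phi> x l' < 1/2"
  shows "weighted_median M \<phi> x \<le> l"
  unfolding weighted_median_def
proof (rule cSup_least[OF assms(1)])
  fix l' assume "l' \<in> {l. 1/2 \<le> level_mass M \<phi> x l}"
  then show "l' \<le> l" using assms(2)[of l'] by (cases "l \<le> l'") auto
qed

section \<open>Averaging over the radius\<close>

context three_axes
begin

lemma integrable_radius_power:
  assumes M: "median_kernel M"
  shows "integrable M (\<lambda>z. radius z ^ m)"
proof (rule Bochner_Integration.integrable_bound[OF integrable_median_kernel_moment[OF M, of m]])
  have [measurable_cong]: "sets M = sets borel" using M by (rule sets_median_kernel)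
  show "(\<lambda>z. radius z ^ m) \<in> borel_measurable M" by measurable
  show "AE z in M. norm (radius z ^ m) \<le> norm (norm z ^ m)"
    using radius_nonneg radius_le_norm by (auto intro!: power_mono)
qed

lemma integrable_truncated_inverse_radius:
  assumes M: "median_kernel M" and \<delta>: "0 < \<delta>"
  shows "integrable M (\<lambda>z. indicator {\<delta>..} (radius z) / radius z :: real)"
proof -
  have sets[measurable_cong]: "sets M = sets borel" using M by (rule sets_median_kernel)
  interpret finite_measure M using M by (rule finite_measure_median_kernel)
  show ?thesis
    using \<delta> by (intro integrable_const_bound[where B="1 / \<delta>"])
      (auto split: split_indicator intro!: divide_left_mono always_eventually)
qed

text \<open>Squared sine as \<open>(1 - cos 2) / 2\<close>. The degenerate cases, on the third axis
  and at radius 0, are consistent because both sides vanish.\<close>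

lemma sq_second_coordinate: "(z \<bullet> e2)\<^sup>2 = (radius z)\<^sup>2 * (1 - (height z)\<^sup>2) * ((1 - azimuth z) / 2)"
proof (cases "radius z = 0")
  case True
  then have "(z \<bullet> e1)\<^sup>2 + (z \<bullet> e2)\<^sup>2 + (z \<bullet> e3)\<^sup>2 = 0" by (simp add: radius_def)
  moreover have "0 \<le> (z \<bullet> e1)\<^sup>2" "0 \<le> (z \<bullet> e2)\<^sup>2" "0 \<le> (z \<bullet> e3)\<^sup>2" by simp_all
  ultimately have "(z \<bullet> e2)\<^sup>2 = 0" by linarith
  then show ?thesis using True by simp
next
  case False
  have r: "(radius z)\<^sup>2 = (z \<bullet> e1)\<^sup>2 + (z \<bullet> e2)\<^sup>2 + (z \<bullet> e3)\<^sup>2" by (simp add: radius_def)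
  have "(radius z)\<^sup>2 * (1 - (height z)\<^sup>2) = (z \<bullet> e1)\<^sup>2 + (z \<bullet> e2)\<^sup>2"
  proof -
    have "(radius z)\<^sup>2 * (height z)\<^sup>2 = (z \<bullet> e3)\<^sup>2"
      using False by (simp add: height_def power_divide)
    then show ?thesis using r by (simp add: right_diff_distrib)
  qed
  moreover have "((z \<bullet> e1)\<^sup>2 + (z \<bullet> e2)\<^sup>2) * ((1 - azimuth z) / 2) = (z \<bullet> e2)\<^sup>2"
  proof (cases "(z \<bullet> e1)\<^sup>2 + (z \<bullet> e2)\<^sup>2 = 0")
    case True
    moreover have "0 \<le> (z \<bullet> e1)\<^sup>2" "0 \<le> (z \<bullet> e2)\<^sup>2" by simp_all
    ultimately have "(z \<bullet> e2)\<^sup>2 = 0" by linarith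
    then show ?thesis using True by simp
  next
    case False
    then have "((z \<bullet> e1)\<^sup>2 + (z \<bullet> e2)\<^sup>2) * azimuth z = (z \<bullet> e1)\<^sup>2 - (z \<bullet> e2)\<^sup>2"
      by (simp add: azimuth_def cos2_def)
    then show ?thesis by (simp add: right_diff_distrib diff_divide_distrib add_divide_distrib)
  qed
  ultimately show ?thesis by simp
qed

text \<open>With \<open>a = r * (z \<bullet> e3)\<close>, the denominator
  \<open>cosh (arsinh 1 - a)\<close> is \<open>sqrt 2 * (cosh a - sinh a / sqrt 2)\<close>, and the
  positive factor \<open>sqrt 2\<close> cancels against that of the level. The cosine is even, so
  the square of the second coordinate suffices.\<close>

lemma oval_level_iff:
  assumes "0 \<le> N"
  shows "1 / (sqrt 2 * (1 + N)) \<le> oval (oval_point - r *\<^sub>R z) \<longleftrightarrow>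
    height z \<in> oval_section N (r * radius z) ((1 - azimuth z) / 2)"
proof -
  define a where "a = r * (z \<bullet> e3)"
  have a: "a = r * radius z * height z"
  proof (cases "radius z = 0")
    case True
    then have "(z \<bullet> e1)\<^sup>2 + (z \<bullet> e2)\<^sup>2 + (z \<bullet> e3)\<^sup>2 = 0" by (simp add: radius_def)
    moreover have "0 \<le> (z \<bullet> e1)\<^sup>2" "0 \<le> (z \<bullet> e2)\<^sup>2" "0 \<le> (z \<bullet> e3)\<^sup>2" by simp_all
    ultimately have "(z \<bullet> e3)\<^sup>2 = 0" by linarith
    then show ?thesis using True by (simp add: a_def)
  qed (simp add: a_def height_def)
  have "(r * radius z)\<^sup>2 * (1 - (height z)\<^sup>2) * ((1 - azimuth z) / 2) = (r * (z \<bullet> e2))\<^sup>2"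
    using sq_second_coordinate[of z] by (simp add: power_mult_distrib mult.assoc)
  then have y: "cos (sqrt ((r * radius z)\<^sup>2 * (1 - (height z)\<^sup>2) * ((1 - azimuth z) / 2))) = cos (r * (z \<bullet> e2))"
    by simp
  define C where "C = cosh a - 1 / sqrt 2 * sinh a"
  have "cosh (arsinh 1 - a) = sqrt 2 * cosh a - sinh a"
    by (simp add: cosh_diff cosh_arsinh_1)
  also have "\<dots> = sqrt 2 * C"
    by (simp add: C_def right_diff_distrib)
  finally have C: "cosh (arsinh 1 - a) = sqrt 2 * C" .
  then have "0 < sqrt 2 * C" by (metis cosh_real_pos)
  then have C0: "0 < C" by (simp add: zero_less_mult_iff)
  have "oval (oval_point - r *\<^sub>R z) = cos (r * (z \<bullet> e2)) / (sqrt 2 * C)"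
    by (simp add: oval_def inner_diff_left oval_point_inner C flip: a_def)
  then have "1 / (sqrt 2 * (1 + N)) \<le> oval (oval_point - r *\<^sub>R z) \<longleftrightarrow>
      1 / (sqrt 2 * (1 + N)) \<le> cos (r * (z \<bullet> e2)) / (sqrt 2 * C)" by simp
  also have "\<dots> \<longleftrightarrow> 1 / (1 + N) / sqrt 2 \<le> cos (r * (z \<bullet> e2)) / C / sqrt 2"
    by (simp add: mult.commute)
  also have "\<dots> \<longleftrightarrow> 1 / (1 + N) \<le> cos (r * (z \<bullet> e2)) / C"
    unfolding divide_le_cancel by simp
  also have "\<dots> \<longleftrightarrow> C \<le> (1 + N) * cos (r * (z \<bullet> e2))"
    unfolding pos_le_divide_eq[OF C0] using assms by (simp add: pos_divide_le_eq mult.commute)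
  finally show ?thesis unfolding oval_section_def mem_Collect_eq y C_def a[symmetric] .
qed

lemma level_mass_dilate:
  assumes M: "median_kernel M" and [measurable]: "\<phi> \<in> borel_measurable borel"
  shows "level_mass (dilate r M) \<phi> x l = measure M {z. l \<le> \<phi> (x - r *\<^sub>R z)}"
proof -
  have sets[measurable_cong]: "sets M = sets borel" using M by (rule sets_median_kernel)
  have "{z. l \<le> \<phi> (x - z)} \<in> sets borel" by measurable
  moreover have "space M = UNIV" using sets_eq_imp_space_eq[OF sets] by simp
  ultimately show ?thesis
    unfolding level_mass_def dilate_def superlevel_def
    by (subst measure_distr) (auto simp: vimage_def)
qed

lemma oval_measurable [measurable]: "oval \<in> borel_measurable borel"
  using oval_smooth unfolding smooth_def
  by (metis C_k.simps(1) borel_measurable_continuous_onI)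

lemma level_mass_oval:
  assumes M: "median_kernel M" and N: "0 \<le> N"
  shows "level_mass (dilate r M) oval oval_point (1 / (sqrt 2 * (1 + N))) =
      (\<integral>z. (\<integral>c. measure height_law (oval_section N (r * radius z) ((1 - c) / 2)) \<partial>angle_law) \<partial>M)"
    and "integrable M (\<lambda>z. \<integral>c. measure height_law (oval_section N (r * radius z) ((1 - c) / 2)) \<partial>angle_law)"
    and "integrable angle_law (\<lambda>c. measure height_law (oval_section N (r * \<rho>) ((1 - c) / 2)))"
proof -
  define X where "X = {p :: real \<times> real \<times> real. snd (snd p) \<in> oval_section N (r * fst p) ((1 - fst (snd p)) / 2)}"
  have "closed X"
    unfolding X_def oval_section_def mem_Collect_eq by (intro closed_Collect_le continuous_intros) auto
  then have X: "X \<in> sets (borel \<Otimes>\<^sub>M borel \<Otimes>\<^sub>M borel)" unfolding borel_prod by (rule borel_closed)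
  have s: "{v. (\<rho>, c, v) \<in> X} = oval_section N (r * \<rho>) ((1 - c) / 2)" for \<rho> c
    by (simp add: X_def)
  show "level_mass (dilate r M) oval oval_point (1 / (sqrt 2 * (1 + N))) =
      (\<integral>z. (\<integral>c. measure height_law (oval_section N (r * radius z) ((1 - c) / 2)) \<partial>angle_law) \<partial>M)"
    using median_kernel_measure_sections(3)[OF M X]
    unfolding s level_mass_dilate[OF M oval_measurable] oval_level_iff[OF N] by (simp add: X_def)
  show "integrable M (\<lambda>z. \<integral>c. measure height_law (oval_section N (r * radius z) ((1 - c) / 2)) \<partial>angle_law)"
    "integrable angle_law (\<lambda>c. measure height_law (oval_section N (r * \<rho>) ((1 - c) / 2)))"
    using median_kernel_measure_sections(2)[OF M X] median_kernel_measure_sections(1)[OF M X, of \<rho>]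
    unfolding s by simp_all
qed

text \<open>At radius \<rho> the sectional bound is taken at \<open>R = r * \<rho>\<close> and
  divided by \<open>R\<close>, which produces \<rho> to the powers -1, 1 and 5; the first of these
  is why integrability of \<open>1 / radius z\<close> is assumed.\<close>

lemma level_mass_oval_le:
  assumes M: "median_kernel M" and N: "0 \<le> N" "N \<le> 1/64" and r: "0 < r"
    and inv: "integrable M (\<lambda>z. 1 / radius z)"
  shows "level_mass (dilate r M) oval oval_point (1 / (sqrt 2 * (1 + N))) \<le>
    1/2 - sqrt 2 / (2 * r) * ((- N + N\<^sup>2 / 2 - 40000 * N ^ 3) * (\<integral>z. 1 / radius z \<partial>M)
      + (r\<^sup>2 / 4 + N * r\<^sup>2 / 8) * (\<integral>z. radius z \<partial>M) - 40000 * r ^ 6 * (\<integral>z. radius z ^ 5 \<partial>M))"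
proof -
  have i: "integrable M radius" "integrable M (\<lambda>z. radius z ^ 5)"
    using integrable_radius_power[OF M, of 1] integrable_radius_power[OF M, of 5] by simp_all
  have sp: "space M = UNIV" using sets_eq_imp_space_eq[OF sets_median_kernel[OF M]] by simp
  interpret finite_measure M using M by (rule finite_measure_median_kernel)
  have u: "measure M UNIV = 1" using emeasure_median_kernel_UNIV[OF M] by (simp add: measure_def)
  define k where "k = sqrt 2 / (2 * r)"
  define I where "I = (\<lambda>z. 1 / radius z)"
  let ?f = "\<lambda>z. (- N + N\<^sup>2 / 2 - 40000 * N ^ 3) * I z + (r\<^sup>2 / 4 + N * r\<^sup>2 / 8) * radius z
      - 40000 * r ^ 6 * radius z ^ 5"
  have inv': "integrable M I" using inv by (simp add: I_def)
  have f: "integrable M ?f" "(\<integral>z. ?f z \<partial>M) = (- N + N\<^sup>2 / 2 - 40000 * N ^ 3) * (\<integral>z. I z \<partial>M)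
      + (r\<^sup>2 / 4 + N * r\<^sup>2 / 8) * (\<integral>z. radius z \<partial>M) - 40000 * r ^ 6 * (\<integral>z. radius z ^ 5 \<partial>M)"
    using i inv' by simp_all
  have "level_mass (dilate r M) oval oval_point (1 / (sqrt 2 * (1 + N))) \<le>
    (\<integral>z. 1/2 - k * ?f z \<partial>M)"
    unfolding level_mass_oval(1)[OF M N(1)]
  proof (rule integral_mono_AE[OF level_mass_oval(2)[OF M N(1)]])
    show "AE z in M. (\<integral>c. measure height_law (oval_section N (r * radius z) ((1 - c) / 2)) \<partial>angle_law) \<le>
        1/2 - k * ?f z"
      using AE_median_kernel_radius_pos[OF M]
    proof (rule eventually_mono)
      fix z assume z: "0 < radius z"
      let ?R = "r * radius z"
      have R: "0 < ?R" using r z by simp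
      have "(\<integral>c. measure height_law (oval_section N ?R ((1 - c) / 2)) \<partial>angle_law) \<le>
        1/2 - sqrt 2 / (2 * ?R) * (- N + N\<^sup>2 / 2 + ?R\<^sup>2 / 4 + N * ?R\<^sup>2 / 8 - 40000 * (N ^ 3 + ?R ^ 6))"
        by (rule integral_measure_oval_section_le[OF N R level_mass_oval(3)[OF M N(1)]])
      also have "sqrt 2 / (2 * ?R) * (- N + N\<^sup>2 / 2 + ?R\<^sup>2 / 4 + N * ?R\<^sup>2 / 8 - 40000 * (N ^ 3 + ?R ^ 6))
        = k * ?f z"
      proof -
        have "radius z ^ 6 = radius z * radius z ^ 5" "(radius z)\<^sup>2 = radius z * radius z"
          by (simp_all add: power2_eq_square flip: power_Suc)
        then have "(- N + N\<^sup>2 / 2 + ?R\<^sup>2 / 4 + N * ?R\<^sup>2 / 8 - 40000 * (N ^ 3 + ?R ^ 6)) / radius z = ?f z"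
          using z by (simp add: I_def power_mult_distrib field_simps)
        moreover have "sqrt 2 / (2 * ?R) * E = k * (E / radius z)" for E by (simp add: k_def)
        ultimately show ?thesis by metis
      qed
      finally show "(\<integral>c. measure height_law (oval_section N ?R ((1 - c) / 2)) \<partial>angle_law) \<le>
        1/2 - k * ?f z" .
    qed
    show "integrable M (\<lambda>z. 1/2 - k * ?f z)"
      using f(1) by simp
  qed
  also have "\<dots> = 1/2 - k * (\<integral>z. ?f z \<partial>M)"
    using f(1) by (simp add: u sp)
  finally show ?thesis unfolding f(2) by (simp only: k_def I_def)
qed

lemma level_mass_oval_ge:
  assumes M: "median_kernel M" and N: "0 \<le> N" "N \<le> 1/64" and r: "0 < r"
    and \<delta>: "0 < \<delta>" "N \<le> r * \<delta> / 4"
  shows "1/2 - sqrt 2 / (2 * r) * ((- N + 600 * N\<^sup>2) * (\<integral>z. indicator {\<delta>..} (radius z) / radius z \<partial>M)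
      + r\<^sup>2 / 4 * (\<integral>z. radius z \<partial>M) + 600 * r ^ 4 * (\<integral>z. radius z ^ 3 \<partial>M))
    \<le> level_mass (dilate r M) oval oval_point (1 / (sqrt 2 * (1 + N)))"
proof -
  have i: "integrable M radius" "integrable M (\<lambda>z. radius z ^ 3)"
    using integrable_radius_power[OF M, of 1] integrable_radius_power[OF M, of 3] by simp_all
  have sets[measurable_cong]: "sets M = sets borel" using M by (rule sets_median_kernel)
  have sp: "space M = UNIV" using sets_eq_imp_space_eq[OF sets] by simp
  interpret finite_measure M using M by (rule finite_measure_median_kernel)
  have u: "measure M UNIV = 1" using emeasure_median_kernel_UNIV[OF M] by (simp add: measure_def)
  have inv: "integrable M (\<lambda>z. indicator {\<delta>..} (radius z) / radius z)"
    using M \<delta>(1) by (rule integrable_truncated_inverse_radius)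
  define k where "k = sqrt 2 / (2 * r)"
  define I where "I = (\<lambda>z. indicator {\<delta>..} (radius z) / radius z :: real)"
  let ?f = "\<lambda>z. (- N + 600 * N\<^sup>2) * I z + r\<^sup>2 / 4 * radius z + 600 * r ^ 4 * radius z ^ 3"
  have inv': "integrable M I" using inv by (simp add: I_def)
  have f: "integrable M ?f" "(\<integral>z. ?f z \<partial>M) = (- N + 600 * N\<^sup>2) * (\<integral>z. I z \<partial>M)
      + r\<^sup>2 / 4 * (\<integral>z. radius z \<partial>M) + 600 * r ^ 4 * (\<integral>z. radius z ^ 3 \<partial>M)"
    using i inv' by simp_all
  have "1/2 - k * (\<integral>z. ?f z \<partial>M) = (\<integral>z. 1/2 - k * ?f z \<partial>M)"
    using f(1) by (simp add: u sp)
  also have "\<dots> \<le> level_mass (dilate r M) oval oval_point (1 / (sqrt 2 * (1 + N)))"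
    unfolding level_mass_oval(1)[OF M N(1)]
  proof (rule integral_mono_AE[OF _ level_mass_oval(2)[OF M N(1)]])
    show "AE z in M. 1/2 - k * ?f z \<le>
        (\<integral>c. measure height_law (oval_section N (r * radius z) ((1 - c) / 2)) \<partial>angle_law)"
      using AE_median_kernel_radius_pos[OF M]
    proof (rule eventually_mono)
      fix z assume z: "0 < radius z"
      let ?R = "r * radius z"
      let ?i = "indicator {\<delta>..} (radius z) :: real"
      have R: "0 < ?R" using r z by simp
      \<comment> \<open>\<open>N * ?i\<close> is the parameter \<open>N'\<close> of the sectional
        bound: it is \<open>N\<close> on radii at least \<delta> and 0 below. The value 0 only gives
        up mass and leaves no inverse radius near the origin.\<close>
      have N': "0 \<le> N * ?i" "N * ?i \<le> N" "N * ?i \<le> ?R / 4"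
      proof -
        have "N \<le> ?R / 4" if "\<delta> \<le> radius z"
          using \<delta>(2) mult_left_mono[OF that, of r] r by linarith
        then show "0 \<le> N * ?i" "N * ?i \<le> N" "N * ?i \<le> ?R / 4"
          using N R by (auto split: split_indicator)
      qed
      have "k * ?f z = sqrt 2 / (2 * ?R) * (- (N * ?i) + ?R\<^sup>2 / 4 + 600 * ((N * ?i)\<^sup>2 + ?R ^ 4))"
      proof -
        have "radius z ^ 4 = radius z * radius z ^ 3" "(radius z)\<^sup>2 = radius z * radius z"
          by (simp_all add: power2_eq_square flip: power_Suc)
        moreover have "?i\<^sup>2 = ?i" by (simp split: split_indicator)
        ultimately have "(- (N * ?i) + ?R\<^sup>2 / 4 + 600 * ((N * ?i)\<^sup>2 + ?R ^ 4)) / radius z = ?f z"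
          using z by (simp add: I_def power_mult_distrib field_simps)
        moreover have "sqrt 2 / (2 * ?R) * E = k * (E / radius z)" for E by (simp add: k_def)
        ultimately show ?thesis by metis
      qed
      then show "1/2 - k * ?f z \<le>
        (\<integral>c. measure height_law (oval_section N ?R ((1 - c) / 2)) \<partial>angle_law)"
        using integral_measure_oval_section_ge[OF N'(1,2) N(2) R N'(3) level_mass_oval(3)[OF M N(1)]]
        by simp
    qed
    show "integrable M (\<lambda>z. 1/2 - k * ?f z)"
      using f(1) by simp
  qed
  finally show ?thesis unfolding f(2) by (simp only: k_def I_def)
qed

section \<open>From masses to medians\<close>

lemma bdd_above_oval_level:
  assumes M: "median_kernel M"
  shows "bdd_above {l. 1/2 \<le> level_mass (dilate r M) oval x l}"
proof (rule bdd_aboveI[of _ 1])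
  fix l assume l: "l \<in> {l. 1/2 \<le> level_mass (dilate r M) oval x l}"
  show "l \<le> 1"
  proof (rule ccontr)
    assume "\<not> l \<le> 1"
    then have "{z. l \<le> oval (x - r *\<^sub>R z)} = {}"
      using abs_oval_le by (auto simp: not_le abs_le_iff intro: order.strict_trans1)
    then show False using l by (simp add: level_mass_dilate[OF M oval_measurable])
  qed
qed

lemma weighted_median_oval_le:
  assumes M: "median_kernel M" and l: "level_mass (dilate r M) oval x l < 1/2"
  shows "weighted_median (dilate r M) oval x \<le> l"
proof (rule weighted_median_le)
  have sets[measurable_cong]: "sets M = sets borel" using M by (rule sets_median_kernel)
  interpret finite_measure M using M by (rule finite_measure_median_kernel)
  note lm = level_mass_dilate[OF M oval_measurable]
  have "{z. -1 \<le> oval (x - r *\<^sub>R z)} = UNIV"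
    using abs_oval_le by (auto simp: abs_le_iff minus_le_iff)
  then have "1/2 \<le> level_mass (dilate r M) oval x (-1)"
    using emeasure_median_kernel_UNIV[OF M] by (simp add: lm measure_def)
  then show "{l. 1/2 \<le> level_mass (dilate r M) oval x l} \<noteq> {}" by blast
  fix l' assume "l \<le> l'"
  then have "level_mass (dilate r M) oval x l' \<le> level_mass (dilate r M) oval x l"
    unfolding lm by (intro finite_measure_mono) (auto simp: sets)
  then show "level_mass (dilate r M) oval x l' < 1/2" using l by simp
qed

text \<open>Monotone convergence along the cutoffs \<open>1 / (n + 1)\<close>. At radius 0
  truncations and limit all have value 0.\<close>

lemma integrable_inverse_radius:
  assumes M: "median_kernel M" and b: "0 \<le> b"
    and le: "\<And>\<delta>. 0 < \<delta> \<Longrightarrow> (\<integral>z. indicator {\<delta>..} (radius z) / radius z \<partial>M) \<le> b"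
  shows "integrable M (\<lambda>z. 1 / radius z)" "(\<integral>z. 1 / radius z \<partial>M) \<le> b"
proof -
  have sets[measurable_cong]: "sets M = sets borel" using M by (rule sets_median_kernel)
  interpret finite_measure M using M by (rule finite_measure_median_kernel)
  define f where "f = (\<lambda>n z. indicator {1 / real (Suc n)..} (radius z) / radius z :: real)"
  have f0: "0 \<le> f n z" for n z using radius_nonneg[of z] by (simp add: f_def)
  have [measurable]: "f n \<in> borel_measurable M" for n unfolding f_def by measurable
  have fi: "integrable M (f n)" for n
    unfolding f_def
    by (rule integrable_truncated_inverse_radius[OF M]) simp
  have "(\<lambda>n. \<integral>\<^sup>+z. ennreal (f n z) \<partial>M) \<longlonglongrightarrow> (\<integral>\<^sup>+z. ennreal (1 / radius z) \<partial>M)"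
  proof (rule nn_integral_LIMSEQ)
    show "incseq (\<lambda>n z. ennreal (f n z))"
    proof (intro monoI le_funI ennreal_leI)
      fix m n :: nat and z assume "m \<le> n"
      then have "1 / real (Suc n) \<le> 1 / real (Suc m)" by (simp add: frac_le)
      then show "f m z \<le> f n z"
        using radius_nonneg[of z] unfolding f_def by (auto split: split_indicator)
    qed
    show "(\<lambda>n. ennreal (f n z)) \<longlonglongrightarrow> ennreal (1 / radius z)" for z
    proof (cases "radius z = 0")
      case False
      then have "0 < radius z" using radius_nonneg[of z] by simp
      then obtain n0 where n0: "1 / real (Suc n0) < radius z"
        using reals_Archimedean[of "radius z"] by (auto simp: inverse_eq_divide)
      have "eventually (\<lambda>n. ennreal (1 / radius z) = ennreal (f n z)) sequentially"
        using eventually_ge_at_top[of n0]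
      proof (rule eventually_mono)
        fix n assume "n0 \<le> n"
        then have "1 / real (Suc n) \<le> 1 / real (Suc n0)" by (simp add: frac_le)
        then show "ennreal (1 / radius z) = ennreal (f n z)" using n0 by (simp add: f_def)
      qed
      then show ?thesis by (rule Lim_transform_eventually[OF tendsto_const])
    qed (simp add: f_def)
  qed measurable
  moreover have "(\<integral>\<^sup>+z. ennreal (f n z) \<partial>M) \<le> ennreal b" for n
  proof -
    have "(\<integral>\<^sup>+z. ennreal (f n z) \<partial>M) = ennreal (\<integral>z. f n z \<partial>M)"
      using fi f0 by (intro nn_integral_eq_integral) auto
    also have "\<dots> \<le> ennreal b"
      unfolding f_def by (intro ennreal_leI le) simp
    finally show ?thesis .
  qed
  ultimately have le_b: "(\<integral>\<^sup>+z. ennreal (1 / radius z) \<partial>M) \<le> ennreal b"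
    by (intro LIMSEQ_le_const2) auto
  show i: "integrable M (\<lambda>z. 1 / radius z)"
  proof (rule integrableI_nonneg)
    show "(\<integral>\<^sup>+z. ennreal (1 / radius z) \<partial>M) < \<infinity>"
      using le_b by (rule order.strict_trans1) simp
  qed (use radius_nonneg in auto)
  have "ennreal (\<integral>z. 1 / radius z \<partial>M) \<le> ennreal b"
    using le_b i radius_nonneg by (subst nn_integral_eq_integral[symmetric]) auto
  then show "(\<integral>z. 1 / radius z \<partial>M) \<le> b" using b by simp
qed

lemma eventually_at_right_mult_less:
  assumes "0 < (e :: real)" shows "eventually (\<lambda>k. k * D < e) (at_right 0)"
proof (rule order_tendstoD(2)[of _ 0])
  show "((\<lambda>k. k * D) \<longlongrightarrow> 0) (at_right 0)"
    by (auto intro!: tendsto_eq_intros)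
qed (rule assms)

lemma consistent_median_ovalE:
  assumes "second_order_consistent (\<lambda>k. weighted_median (dilate (sqrt (2 * k)) M))"
  obtains C where "eventually (\<lambda>k. \<bar>sqrt 2 * weighted_median (dilate (sqrt (2 * k)) M) oval oval_point - (1 - k + k\<^sup>2 / 2)\<bar> \<le> C * k ^ 3) (at_right 0)"
proof -
  obtain c where c: "eventually (\<lambda>k. norm (weighted_median (dilate (sqrt (2 * k)) M) oval oval_point - (1 - k + k\<^sup>2 / 2) / sqrt 2) \<le> c * norm (k ^ 3)) (at_right 0)"
    using consistent_oval[OF assms] by (rule landau_o.bigE)
  have "eventually (\<lambda>k. \<bar>sqrt 2 * weighted_median (dilate (sqrt (2 * k)) M) oval oval_point - (1 - k + k\<^sup>2 / 2)\<bar> \<le> (sqrt 2 * c) * k ^ 3) (at_right 0)"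
    using c eventually_at_right_less[of 0]
  proof eventually_elim
    case (elim k)
    define m where "m = weighted_median (dilate (sqrt (2 * k)) M) oval oval_point"
    have "\<bar>sqrt 2 * m - (1 - k + k\<^sup>2 / 2)\<bar> = \<bar>sqrt 2 * (m - (1 - k + k\<^sup>2 / 2) / sqrt 2)\<bar>"
      by (simp add: right_diff_distrib)
    also have "\<dots> = sqrt 2 * \<bar>m - (1 - k + k\<^sup>2 / 2) / sqrt 2\<bar>"
      by (simp add: abs_mult)
    also have "\<dots> \<le> sqrt 2 * (c * norm (k ^ 3))"
      using elim(1) by (intro mult_left_mono) (simp_all add: m_def)
    finally show ?case using elim(2) by (simp add: m_def)
  qed
  then show ?thesis by (rule that)
qed

text \<open>If a truncated mean exceeded half the mean radius, then for some \<open>q < 1\<close>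
  the level with \<open>N = q * k\<close> would still have mass at least 1/2 for small
  \<open>k\<close>. The median times \<open>sqrt 2\<close> would then be at least
  \<open>1 - q * k\<close>, against the predicted \<open>1 - k\<close> up to second order.\<close>

lemma consistent_inverse_radius:
  assumes M: "median_kernel M"
    and cons: "second_order_consistent (\<lambda>k. weighted_median (dilate (sqrt (2 * k)) M))"
  shows "integrable M (\<lambda>z. 1 / radius z)" "(\<integral>z. 1 / radius z \<partial>M) \<le> (\<integral>z. radius z \<partial>M) / 2"
proof -
  define a1 where "a1 = (\<integral>z. radius z \<partial>M)"
  define a3 where "a3 = (\<integral>z. radius z ^ 3 \<partial>M)"
  have a: "0 \<le> a1" "0 \<le> a3"
    using radius_nonneg by (auto simp: a1_def a3_def intro!: integral_nonneg_AE always_eventually)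
  have "(\<integral>z. indicator {\<delta>..} (radius z) / radius z \<partial>M) \<le> a1 / 2" if \<delta>: "0 < \<delta>" for \<delta>
  proof (rule ccontr)
    define m where "m = (\<integral>z. indicator {\<delta>..} (radius z) / radius z \<partial>M)"
    assume "\<not> (\<integral>z. indicator {\<delta>..} (radius z) / radius z \<partial>M) \<le> a1 / 2"
    then have m: "a1 / 2 < m" by (simp add: m_def)
    \<comment> \<open>The midpoint between 1 and the critical ratio \<open>a1 / (2 * m)\<close>, so
      that \<open>q * m\<close> still exceeds \<open>a1 / 2\<close>.\<close>
    define q where "q = (a1 / 2 / m + 1) / 2"
    have m0: "0 < m" using m a by linarith
    have q: "0 < q" "q < 1" using m a m0 by (auto simp: q_def add_nonneg_pos)
    have "q * m = (a1 / 2 + m) / 2" using m0 by (simp add: q_def field_simps)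
    then have e: "0 < q * m - a1 / 2" using m by simp
    obtain C where C: "eventually (\<lambda>k. \<bar>sqrt 2 * weighted_median (dilate (sqrt (2 * k)) M) oval oval_point - (1 - k + k\<^sup>2 / 2)\<bar> \<le> C * k ^ 3) (at_right 0)"
      using cons by (rule consistent_median_ovalE)
    have "eventually (\<lambda>k::real. False) (at_right 0)"
      \<comment> \<open>The factor 8 yields \<open>r \<le> \<delta> / 2\<close> and thus
        \<open>N \<le> r * \<delta> / 4\<close>; 2400 is 600 times the 4 in
        \<open>r ^ 4 = 4 * k^2\<close>; the last condition keeps the higher order terms below the
        gain \<open>(1 - q) * k\<close>.\<close>
      using C eventually_at_right_less[of "0::real"]
        eventually_at_right_mult_less[of "1/64" 1, simplified]
        eventually_at_right_mult_less[of "\<delta>\<^sup>2" 8, OF zero_less_power[OF \<delta>]]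
        eventually_at_right_mult_less[OF e, of "600 * m + 2400 * a3"]
        eventually_at_right_mult_less[of "1 - q" "1/2 + \<bar>C\<bar>", simplified, OF q(2)]
    proof eventually_elim
      case (elim k)
      then have k: "0 < k" "k < 1/64" by simp_all
      define r where "r = sqrt (2 * k)"
      define N where "N = q * k"
      have r: "0 < r" "r\<^sup>2 = 2 * k" using k by (simp_all add: r_def)
      have r4: "r ^ 4 = 4 * k\<^sup>2"
      proof -
        have "r ^ 4 = (r\<^sup>2)\<^sup>2" by simp
        then show ?thesis unfolding r(2) by (simp add: power_mult_distrib)
      qed
      have N: "0 \<le> N" "N \<le> k" using q k by (simp_all add: N_def)
      then have N64: "N \<le> 1/64" using k by linarith
      have "r \<le> \<delta> / 2"
      proof (rule power2_le_imp_le)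
        show "r\<^sup>2 \<le> (\<delta> / 2)\<^sup>2" using elim(4) unfolding r(2) by (simp add: power_divide)
      qed (use \<delta> in simp)
      then have "r * r \<le> r * (\<delta> / 2)" using r by (intro mult_left_mono) auto
      then have N\<delta>: "N \<le> r * \<delta> / 4"
        using N(2) r(2) by (simp add: power2_eq_square)
      have bracket: "(- N + 600 * N\<^sup>2) * m + r\<^sup>2 / 4 * a1 + 600 * r ^ 4 * a3 \<le> 0"
      proof -
        have "N\<^sup>2 \<le> k\<^sup>2" using N by (intro power_mono) auto
        then have "600 * N\<^sup>2 * m \<le> 600 * k\<^sup>2 * m" using m0 by (intro mult_right_mono mult_left_mono) auto
        then have "(- N + 600 * N\<^sup>2) * m + r\<^sup>2 / 4 * a1 + 600 * r ^ 4 * a3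
          \<le> k * (k * (600 * m + 2400 * a3) - (q * m - a1 / 2))"
          unfolding r(2) r4 N_def by (simp add: algebra_simps power2_eq_square)
        also have "\<dots> \<le> 0" using elim(5) k by (intro mult_nonneg_nonpos) auto
        finally show ?thesis .
      qed
      have "1/2 - sqrt 2 / (2 * r) * 0 \<le> 1/2 - sqrt 2 / (2 * r) * ((- N + 600 * N\<^sup>2) * m + r\<^sup>2 / 4 * a1 + 600 * r ^ 4 * a3)"
        using bracket r by (intro diff_left_mono mult_left_mono) auto
      also have "\<dots> \<le> level_mass (dilate r M) oval oval_point (1 / (sqrt 2 * (1 + N)))"
        unfolding m_def a1_def a3_def by (rule level_mass_oval_ge[OF M N(1) N64 r(1) \<delta> N\<delta>])
      finally have "1 / (sqrt 2 * (1 + N)) \<le> weighted_median (dilate r M) oval oval_point"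
        by (intro weighted_median_ge bdd_above_oval_level[OF M]) simp
      then have "sqrt 2 * (1 / (sqrt 2 * (1 + N))) \<le> sqrt 2 * weighted_median (dilate r M) oval oval_point"
        by (intro mult_left_mono) auto
      moreover have "1 - N \<le> sqrt 2 * (1 / (sqrt 2 * (1 + N)))"
      proof -
        have "(1 - N) * (1 + N) \<le> 1" by (simp add: algebra_simps)
        then show ?thesis using N by (simp add: pos_le_divide_eq)
      qed
      ultimately have "1 - N \<le> 1 - k + k\<^sup>2 / 2 + C * k ^ 3"
        using elim(1) unfolding r_def by linarith
      then have "(1 - q) * k \<le> k\<^sup>2 / 2 + C * k ^ 3"
        by (simp add: N_def algebra_simps)
      also have "C * k ^ 3 \<le> \<bar>C\<bar> * k\<^sup>2"
        using k power_decreasing[of 2 3 k] by (intro mult_mono) auto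
      also have "k\<^sup>2 / 2 + \<bar>C\<bar> * k\<^sup>2 = k * (1/2 + \<bar>C\<bar>) * k"
        by (simp add: algebra_simps power2_eq_square)
      also have "\<dots> < (1 - q) * k"
        using elim(6) k by (intro mult_strict_right_mono) auto
      finally show False by simp
    qed
    then show False by simp
  qed
  then show "integrable M (\<lambda>z. 1 / radius z)" "(\<integral>z. 1 / radius z \<partial>M) \<le> (\<integral>z. radius z \<partial>M) / 2"
    using integrable_inverse_radius[OF M, of "a1 / 2"] a by (auto simp: a1_def)
qed

theorem median_filter_not_second_order_consistent:
  fixes M :: "'a measure"
  assumes M: "median_kernel M"
  shows "\<not> second_order_consistent (\<lambda>k. weighted_median (dilate (sqrt (2 * k)) M))"
proof
  assume cons: "second_order_consistent (\<lambda>k. weighted_median (dilate (sqrt (2 * k)) M))"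
  define m where "m = (\<integral>z. 1 / radius z \<partial>M)"
  define a1 where "a1 = (\<integral>z. radius z \<partial>M)"
  define a5 where "a5 = (\<integral>z. radius z ^ 5 \<partial>M)"
  have nonneg: "0 \<le> m" "0 \<le> a1" "0 \<le> a5"
    using radius_nonneg by (auto simp: m_def a1_def a5_def intro!: integral_nonneg_AE always_eventually)
  have inv: "integrable M (\<lambda>z. 1 / radius z)" and ma: "m \<le> a1 / 2"
    using consistent_inverse_radius[OF M cons] by (simp_all add: m_def a1_def)
  \<comment> \<open>The final defect is a multiple of \<open>a1 * k^2\<close>, so strict positivity
    is essential; it follows from unit mass and the almost sure positivity of the radius.\<close>
  have a1: "0 < a1"
  proof (rule ccontr)
    interpret finite_measure M using M by (rule finite_measure_median_kernel)
    have sp: "space M = UNIV" using sets_eq_imp_space_eq[OF sets_median_kernel[OF M]] by simp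
    assume "\<not> 0 < a1"
    then have "(\<integral>z. radius z \<partial>M) = 0" using nonneg by (simp add: a1_def)
    then have "AE z in M. radius z = 0"
      using integrable_radius_power[OF M, of 1] radius_nonneg
      by (subst (asm) integral_nonneg_eq_0_iff_AE) auto
    with AE_median_kernel_radius_pos[OF M] have "AE z in M. False"
      by eventually_elim simp
    then have "emeasure M UNIV = 0"
      by (simp add: trivial_limit_def[symmetric] ae_filter_eq_bot_iff sp)
    then show False using emeasure_median_kernel_UNIV[OF M] by simp
  qed
  obtain C where C: "eventually (\<lambda>k. \<bar>sqrt 2 * weighted_median (dilate (sqrt (2 * k)) M) oval oval_point - (1 - k + k\<^sup>2 / 2)\<bar> \<le> C * k ^ 3) (at_right 0)"
    using cons by (rule consistent_median_ovalE)
  have "eventually (\<lambda>k::real. False) (at_right 0)"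
    using C eventually_at_right_less[of "0::real"]
      eventually_at_right_mult_less[of "1/128" 1, simplified]
      eventually_at_right_mult_less[OF divide_pos_pos[OF a1, of 8], of "320000 * (m + a5)", simplified]
      eventually_at_right_mult_less[of "1/4" "3 + C", simplified]
  proof eventually_elim
    case (elim k)
    then have k: "0 < k" "k < 1/128" by simp_all
    define r where "r = sqrt (2 * k)"
    \<comment> \<open>The predicted level is \<open>N = k + k^2 / 2\<close> up to third order. For
      \<open>N = k + b * k^2\<close> with \<open>b \<ge> 1/2\<close>, the bracket below is, by
      \<open>m \<le> a1 / 2\<close> and to second order, at least
      \<open>a1 * k^2 * (1 - b) / 2\<close>. So \<open>b < 1\<close> keeps the mass below 1/2, while
      \<open>b > 1/2\<close> puts the level below the predicted one; 3/4 lies halfway.\<close>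
    define N where "N = k + 3/4 * k\<^sup>2"
    have r: "0 < r" "r\<^sup>2 = 2 * k" using k by (simp_all add: r_def)
    have r6: "r ^ 6 = 8 * k ^ 3"
    proof -
      have "r ^ 6 = (r\<^sup>2) ^ 3" by simp
      then show ?thesis unfolding r(2) by (simp add: power_mult_distrib)
    qed
    have kk: "0 < k\<^sup>2" "k\<^sup>2 \<le> k" using k by (auto simp: power2_eq_square mult_left_le)
    have N: "k \<le> N" "N \<le> 2 * k" "0 \<le> N" "N \<le> 1/64" using k kk unfolding N_def by linarith+
    \<comment> \<open>The constant 320000 is 8 times 40000, once from \<open>(2 * k) ^ 3\<close> as
      bound for \<open>N ^ 3\<close> and once from \<open>r ^ 6 = 8 * k ^ 3\<close>.\<close>
    have bracket: "0 < (- N + N\<^sup>2 / 2 - 40000 * N ^ 3) * m + (r\<^sup>2 / 4 + N * r\<^sup>2 / 8) * a1 - 40000 * r ^ 6 * a5"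
    proof -
      have "k\<^sup>2 \<le> N\<^sup>2" using N k by (intro power_mono) auto
      moreover have "N ^ 3 \<le> (2 * k) ^ 3" using N by (intro power_mono) auto
      ultimately have "- k - k\<^sup>2 / 4 - 320000 * k ^ 3 \<le> - N + N\<^sup>2 / 2 - 40000 * N ^ 3"
        by (simp add: N_def power_mult_distrib)
      then have "(- k - k\<^sup>2 / 4 - 320000 * k ^ 3) * m \<le> (- N + N\<^sup>2 / 2 - 40000 * N ^ 3) * m"
        using nonneg by (intro mult_right_mono) auto
      moreover have "(k / 2 + k\<^sup>2 / 4) * a1 \<le> (r\<^sup>2 / 4 + N * r\<^sup>2 / 8) * a1"
        using nonneg N k mult_right_mono[OF N(1), of k] unfolding r(2)
        by (intro mult_right_mono) (auto simp: power2_eq_square)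
      moreover have "(k + k\<^sup>2 / 4) * m \<le> (k + k\<^sup>2 / 4) * (a1 / 2)"
        using ma k by (intro mult_left_mono) auto
      moreover have "0 < k\<^sup>2 * (a1 / 8 - k * (320000 * (m + a5)))"
        using elim(4) kk by (intro mult_pos_pos) auto
      ultimately show ?thesis
        unfolding r6 by (simp add: algebra_simps power2_eq_square power3_eq_cube)
    qed
    have "level_mass (dilate r M) oval oval_point (1 / (sqrt 2 * (1 + N))) \<le>
      1/2 - sqrt 2 / (2 * r) * ((- N + N\<^sup>2 / 2 - 40000 * N ^ 3) * m + (r\<^sup>2 / 4 + N * r\<^sup>2 / 8) * a1 - 40000 * r ^ 6 * a5)"
      unfolding m_def a1_def a5_def by (rule level_mass_oval_le[OF M N(3,4) r(1) inv])
    also have "\<dots> < 1/2 - 0"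
      using bracket r by (intro diff_strict_left_mono mult_pos_pos) auto
    finally have "weighted_median (dilate r M) oval oval_point \<le> 1 / (sqrt 2 * (1 + N))"
      by (intro weighted_median_oval_le[OF M]) simp
    then have "sqrt 2 * weighted_median (dilate r M) oval oval_point \<le> sqrt 2 * (1 / (sqrt 2 * (1 + N)))"
      by (intro mult_left_mono) auto
    moreover have "sqrt 2 * (1 / (sqrt 2 * (1 + N))) \<le> 1 - N + N\<^sup>2"
    proof -
      have "0 \<le> N ^ 3" using N by simp
      then have "1 \<le> (1 - N + N\<^sup>2) * (1 + N)" by (simp add: algebra_simps power2_eq_square power3_eq_cube)
      then show ?thesis using N by (simp add: pos_divide_le_eq)
    qed
    ultimately have "1 - k + k\<^sup>2 / 2 - C * k ^ 3 \<le> 1 - N + N\<^sup>2"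
      using elim(1) unfolding r_def by linarith
    moreover have "N\<^sup>2 \<le> k\<^sup>2 + 3 * k ^ 3"
    proof -
      have "k ^ 4 \<le> k ^ 3" using k by (intro power_decreasing) auto
      moreover have "N\<^sup>2 = k\<^sup>2 + 3/2 * k ^ 3 + 9/16 * k ^ 4"
        by (simp add: N_def power2_eq_square power3_eq_cube power4_eq_xxxx algebra_simps)
      moreover have "0 \<le> k ^ 3" using k by simp
      ultimately show ?thesis by linarith
    qed
    \<comment> \<open>The second-order coefficient of \<open>1 - N + N^2\<close> is -3/4 + 1 = 1/4,
      short of the predicted 1/2 by 1/4, which terms of order \<open>k ^ 3\<close> cannot
      compensate.\<close>
    ultimately have "k\<^sup>2 * (1/4) \<le> k\<^sup>2 * (k * (3 + C))"
      by (simp add: N_def algebra_simps power2_eq_square power3_eq_cube)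
    then have "1/4 \<le> k * (3 + C)" using kk by (simp only: mult_le_cancel_left_pos)
    then show False using elim(5) by simp
  qed
  then show False by simp
qed

end

theorem proposition6:
  assumes "CARD('n::finite) \<ge> 3"
  shows "\<not> (\<exists>K :: (real ^ 'n) measure.
            median_kernel K \<and>
            second_order_consistent (\<lambda>k. weighted_median (dilate (sqrt (2 * k)) K)))"
proof -
  \<comment> \<open>Dimension at least 3 supplies the three distinct axes on which the test function
    and the spherical coordinates are built.\<close>
  obtain T :: "'n set" where "card T = 3"
    using obtain_subset_with_card_n[OF assms] by blast
  then obtain i j l :: 'n where "i \<noteq> j" "i \<noteq> l" "j \<noteq> l"
    by (auto simp: card_3_iff)
  then interpret three_axes "axis i 1 :: real ^ 'n" "axis j 1" "axis l 1"
    by unfold_locales (auto simp: axis_eq_axis)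
  show ?thesis using median_filter_not_second_order_consistent by blast
qed

end
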